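(* Let $L>0$, $g>0$, $\mu>0$, $\Omega=(2\pi L\mathbb{T})^2\times\mathbb{R}$, let $\bar\rho=\bar\rho(x_3)\in L^\infty(\mathbb{R})$ satisfy $\bar\rho'\in C_0^\infty(\mathbb{R})$, $\inf_{\mathbb{R}}\bar\rho>0$ and $\bar\rho'(x_3^0)>0$ for some $x_3^0$, and let $\bar{\mathbf M}$ be either $M\mathbf e_1$ with $M\neq0$ constant, or $M\mathbf e_3$ with $M$ constant, $|M|\in(0,M_{\mathrm c})$. Let $\mathbb{A}^{\mathrm g}$ and $\lambda(\xi)$ be as in the context and set $$\Lambda:=\sup_{\xi\in\mathbb{A}^{\mathrm g}\cap(L^{-1}\mathbb{Z})^2}\lambda(\xi).$$ Then there exist a constant $\Lambda^*\in(2\Lambda/3,\Lambda]$ and a real-valued, horizontally periodic solution $(\varrho,\mathbf u,\mathbf N,q)$ on $\Omega$ of the linearized problem $$\varrho_t+\bar\rho'u_3=0,\quad \bar\rho\mathbf u_t+\nabla q+g\varrho\mathbf e_3=\mu\Delta\mathbf u+(\nabla\times\mathbf N)\times\bar{\mathbf M},\quad \mathbf N_t=\nabla\times(\mathbf u\times\bar{\mathbf M}),\quad\operatorname{div}\mathbf u=\operatorname{div}\mathbf N=0,$$ with $\lim_{|x_3|\to\infty}(\varrho,\mathbf u,\mathbf N)(t,\mathbf x',x_3)=\mathbf 0$ for all $t>0$, such that: (1) $\|(\varrho,\mathbf u,\mathbf N,q)(0)\|_{H^k(\Omega)}<\infty$ for every $k\in\mathbb{N}$; (2) for every $t>0$ and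 $k\in\mathbb{N}$, $(\varrho,\mathbf u,\mathbf N,q)(t)\in H^k(\Omega)$, $\|(\varrho,\mathbf N,q)(t)\|_{H^k}=e^{\Lambda^*t}\|(\varrho,\mathbf N,q)(0)\|_{H^k}$ and $\|u_i(t)\|_{H^k}=e^{\Lambda^*t}\|u_i(0)\|_{H^k}$ for $i=1,2,3$; (3) $\operatorname{div}\mathbf u(0)=\operatorname{div}\mathbf N(0)=0$ and $\|(u_1,u_2)(0)\|_{L^2}\,\|u_3(0)\|_{L^2}>0$; (4) if $\bar{\mathbf M}=M\mathbf e_3$, then $\|N_3(0)\|_{L^2}>0$.
   Context: Functions on $\Omega$ are $2\pi L$-periodic in $x_1,x_2$; $\mathbf x=(\mathbf x',x_3)$; $'=d/dx_3$; $\mathbf e_1=(1,0,0)$, $\mathbf e_3=(0,0,1)$. Functions $\psi$ below are real-valued functions of $x_3$, and $\xi=(\xi_1,\xi_2)\in\mathbb{R}^2$. $M_{\mathrm c}:=\sqrt{\sup_{\psi\in H^1(\mathbb{R}),\psi\not\equiv0}\int g\bar\rho'\psi^2dx_3/\int|\psi'|^2dx_3}\in(0,\infty]$. Horizontal case ($\bar{\mathbf M}=M\mathbf e_1$): for $0<|M\xi_1|/|\xi|<M_{\mathrm c}$, $S(\xi):=\sqrt{\sup_{\psi\in H^1,\psi\not\equiv0}(g|\xi|^2\int\bar\rho'\psi^2/(M\xi_1)^2-\int|\psi'|^2)/\int|\psi|^2}$; $\mathbb{A}^{\mathrm g}:=(\{\xi:|\xi_1M|/|\xi|\in(0,M_{\mathrm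 c}),|\xi|<S(\xi)\}\cup\{\xi_1=0\})\setminus\{\mathbf 0\}$; $E_0(\psi):=\int[M^2\xi_1^2(\psi^2+|\psi'|^2/|\xi|^2)-g\bar\rho'\psi^2]dx_3$. Vertical case ($\bar{\mathbf M}=M\mathbf e_3$): $\mathcal M_{\mathrm{vc}}:=\{\psi\in H^2:\int(g\bar\rho'\psi^2-M^2|\psi'|^2)>0\}$; $|\xi|^M_{\mathrm{vc}}:=\sqrt{\inf_{\psi\in\mathcal M_{\mathrm{vc}}}M^2\int|\psi''|^2/\int(g\bar\rho'\psi^2-M^2|\psi'|^2)}$; $\mathbb{A}^{\mathrm g}:=\{\xi:|\xi|>|\xi|^M_{\mathrm{vc}}\}$; $E_0(\psi):=\int[M^2(|\psi'|^2+|\psi''|^2/|\xi|^2)-g\bar\rho'\psi^2]dx_3$. In both cases, for $\xi\ne0$: $\mathcal A:=\{\psi\in H^2(\mathbb{R}):\int\bar\rho(|\xi|^2\psi^2+|\psi'|^2)dx_3=1\}$, $E_1(\psi):=\mu\int(4|\xi|^2|\psi'|^2+||\xi|^2\psi+\psi''|^2)dx_3$, $E(\psi,s):=|\xi|^2E_0(\psi)+sE_1(\psi)$, $\alpha(\xi,s):=\inf_{\psi\in\mathcal A}E(\psi,s)$, $\mathfrak S_\xi:=\sup\{s>0:\alpha(\xi,\tau)<0\ \forall\tau\in(0,s)\}>0$; for $\xi\in\mathbb{A}^{\mathrm g}$, $\lambda(\xi)$ denotes the unique $s\in(0,\mathfrak S_\xi)$ with $s=\sqrt{-\alpha(\xi,s)}$.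 It is known that $\mathbb{A}^{\mathrm g}\cap(L^{-1}\mathbb{Z})^2$ is nonempty and $0<\Lambda<\infty$. *)

theory Defs
  imports "HOL-Analysis.Analysis"
begin

definition test1 :: "(real \<Rightarrow> real) \<Rightarrow> bool" where
  "test1 \<phi> \<longleftrightarrow> (\<forall>n x. ((deriv ^^ n) \<phi>) differentiable (at x)) \<and> (\<exists>R. \<forall>x. \<bar>x\<bar> > R \<longrightarrow> \<phi> x = 0)"

definition L2R :: "(real \<Rightarrow> real) \<Rightarrow> bool" where
  "L2R f \<longleftrightarrow> f \<in> borel_measurable lborel \<and> integrable lborel (\<lambda>x. (f x)\<^sup>2)"

definition weak_deriv :: "(real \<Rightarrow> real) \<Rightarrow> (real \<Rightarrow> real) \<Rightarrow> bool" where
  "weak_deriv f f1 \<longleftrightarrow> (\<forall>\<phi>. test1 \<phi> \<longrightarrow>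
     (\<integral>x. f x * deriv \<phi> x \<partial>lborel) = - (\<integral>x. f1 x * \<phi> x \<partial>lborel))"

definition H1R :: "(real \<Rightarrow> real) \<Rightarrow> (real \<Rightarrow> real) \<Rightarrow> bool" where
  "H1R \<psi> \<psi>1 \<longleftrightarrow> L2R \<psi> \<and> L2R \<psi>1 \<and> weak_deriv \<psi> \<psi>1"

definition H2R :: "(real \<Rightarrow> real) \<Rightarrow> (real \<Rightarrow> real) \<Rightarrow> (real \<Rightarrow> real) \<Rightarrow> bool" where
  "H2R \<psi> \<psi>1 \<psi>2 \<longleftrightarrow> H1R \<psi> \<psi>1 \<and> H1R \<psi>1 \<psi>2"

definition nonzeroR :: "(real \<Rightarrow> real) \<Rightarrow> bool" where
  "nonzeroR \<psi> \<longleftrightarrow> \<not> (AE x in lborel. \<psi> x = 0)"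

definition esqrt :: "ereal \<Rightarrow> ereal" where
  "esqrt a = (case a of ereal r \<Rightarrow> ereal (sqrt r) | PInfty \<Rightarrow> PInfty | MInfty \<Rightarrow> MInfty)"

definition Mc :: "real \<Rightarrow> (real \<Rightarrow> real) \<Rightarrow> ereal" where
  "Mc g rho' = esqrt (Sup {ereal ((\<integral>x. g * rho' x * (\<psi> x)\<^sup>2 \<partial>lborel) / (\<integral>x. (\<psi>1 x)\<^sup>2 \<partial>lborel))
                      | \<psi> \<psi>1. H1R \<psi> \<psi>1 \<and> nonzeroR \<psi>})"

definition S_hor :: "real \<Rightarrow> (real \<Rightarrow> real) \<Rightarrow> real \<Rightarrow> real \<times> real \<Rightarrow> real" where
  "S_hor g rho' M \<xi> = sqrt (Sup {((g * (norm \<xi>)\<^sup>2 * (\<integral>x. rho' x * (\<psi> x)\<^sup>2 \<partial>lborel) / (M * fst \<xi>)\<^sup>2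
                 - (\<integral>x. (\<psi>1 x)\<^sup>2 \<partial>lborel)) / (\<integral>x. (\<psi> x)\<^sup>2 \<partial>lborel))
             | \<psi> \<psi>1. H1R \<psi> \<psi>1 \<and> nonzeroR \<psi>})"

definition xi_vc :: "real \<Rightarrow> (real \<Rightarrow> real) \<Rightarrow> real \<Rightarrow> real" where
  "xi_vc g rho' M = sqrt (Inf {M\<^sup>2 * (\<integral>x. (\<psi>2 x)\<^sup>2 \<partial>lborel) /
         (\<integral>x. g * rho' x * (\<psi> x)\<^sup>2 - M\<^sup>2 * (\<psi>1 x)\<^sup>2 \<partial>lborel)
      | \<psi> \<psi>1 \<psi>2. H2R \<psi> \<psi>1 \<psi>2 \<and> (\<integral>x. g * rho' x * (\<psi> x)\<^sup>2 - M\<^sup>2 * (\<psi>1 x)\<^sup>2 \<partial>lborel) > 0})"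

text \<open>The set A^g; vert = True means Mbar = M e3, vert = False means Mbar = M e1.\<close>
definition Ag :: "bool \<Rightarrow> real \<Rightarrow> (real \<Rightarrow> real) \<Rightarrow> real \<Rightarrow> (real \<times> real) set" where
  "Ag vert g rho' M =
    (if vert then {\<xi>. norm \<xi> > xi_vc g rho' M}
     else ({\<xi>. 0 < \<bar>fst \<xi> * M\<bar> / norm \<xi> \<and> ereal (\<bar>fst \<xi> * M\<bar> / norm \<xi>) < Mc g rho'
               \<and> norm \<xi> < S_hor g rho' M \<xi>} \<union> {\<xi>. fst \<xi> = 0}) - {0})"

definition E0 :: "bool \<Rightarrow> real \<Rightarrow> (real \<Rightarrow> real) \<Rightarrow> real \<Rightarrow> real \<times> real
                   \<Rightarrow> (real \<Rightarrow> real) \<Rightarrow> (real \<Rightarrow> real) \<Rightarrow> (real \<Rightarrow> real) \<Rightarrow> real" where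
  "E0 vert g rho' M \<xi> \<psi> \<psi>1 \<psi>2 =
    (if vert then (\<integral>x. M\<^sup>2 * ((\<psi>1 x)\<^sup>2 + (\<psi>2 x)\<^sup>2 / (norm \<xi>)\<^sup>2) - g * rho' x * (\<psi> x)\<^sup>2 \<partial>lborel)
     else (\<integral>x. M\<^sup>2 * (fst \<xi>)\<^sup>2 * ((\<psi> x)\<^sup>2 + (\<psi>1 x)\<^sup>2 / (norm \<xi>)\<^sup>2) - g * rho' x * (\<psi> x)\<^sup>2 \<partial>lborel))"

definition E1 :: "real \<Rightarrow> real \<times> real \<Rightarrow> (real \<Rightarrow> real) \<Rightarrow> (real \<Rightarrow> real) \<Rightarrow> (real \<Rightarrow> real) \<Rightarrow> real" where
  "E1 \<mu> \<xi> \<psi> \<psi>1 \<psi>2 = \<mu> * (\<integral>x. 4 * (norm \<xi>)\<^sup>2 * (\<psi>1 x)\<^sup>2 + ((norm \<xi>)\<^sup>2 * \<psi> x + \<psi>2 x)\<^sup>2 \<partial>lborel)"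

definition Adm :: "(real \<Rightarrow> real) \<Rightarrow> real \<times> real
      \<Rightarrow> ((real \<Rightarrow> real) \<times> (real \<Rightarrow> real) \<times> (real \<Rightarrow> real)) set" where
  "Adm rho \<xi> = {(\<psi>, \<psi>1, \<psi>2). H2R \<psi> \<psi>1 \<psi>2 \<and>
       (\<integral>x. rho x * ((norm \<xi>)\<^sup>2 * (\<psi> x)\<^sup>2 + (\<psi>1 x)\<^sup>2) \<partial>lborel) = 1}"

definition alpha :: "bool \<Rightarrow> real \<Rightarrow> real \<Rightarrow> (real \<Rightarrow> real) \<Rightarrow> (real \<Rightarrow> real) \<Rightarrow> real
                     \<Rightarrow> real \<times> real \<Rightarrow> real \<Rightarrow> real" where
  "alpha vert g \<mu> rho rho' M \<xi> s =
     Inf ((\<lambda>(\<psi>, \<psi>1, \<psi>2). (norm \<xi>)\<^sup>2 * E0 vert g rho' M \<xi> \<psi> \<psi>1 \<psi>2 + s * E1 \<mu> \<xi> \<psi> \<psi>1 \<psi>2)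
            ` Adm rho \<xi>)"

definition Sfrak :: "bool \<Rightarrow> real \<Rightarrow> real \<Rightarrow> (real \<Rightarrow> real) \<Rightarrow> (real \<Rightarrow> real) \<Rightarrow> real
                     \<Rightarrow> real \<times> real \<Rightarrow> ereal" where
  "Sfrak vert g \<mu> rho rho' M \<xi> =
     Sup {ereal s | s. s > 0 \<and> (\<forall>\<tau>\<in>{0<..<s}. alpha vert g \<mu> rho rho' M \<xi> \<tau> < 0)}"

definition lam :: "bool \<Rightarrow> real \<Rightarrow> real \<Rightarrow> (real \<Rightarrow> real) \<Rightarrow> (real \<Rightarrow> real) \<Rightarrow> real
                     \<Rightarrow> real \<times> real \<Rightarrow> real" where
  "lam vert g \<mu> rho rho' M \<xi> =
     (THE s. 0 < s \<and> ereal s < Sfrak vert g \<mu> rho rho' M \<xi> \<and>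
             s = sqrt (- alpha vert g \<mu> rho rho' M \<xi> s))"

definition lattice :: "real \<Rightarrow> (real \<times> real) set" where
  "lattice L = {(of_int m / L, of_int n / L) | m n :: int. True}"

definition Lambda :: "bool \<Rightarrow> real \<Rightarrow> real \<Rightarrow> (real \<Rightarrow> real) \<Rightarrow> (real \<Rightarrow> real) \<Rightarrow> real
                     \<Rightarrow> real \<Rightarrow> real" where
  "Lambda vert g \<mu> rho rho' M L =
     Sup (lam vert g \<mu> rho rho' M ` (Ag vert g rho' M \<inter> lattice L))"

section \<open>Functions on Omega = (2 pi L T)^2 x R, represented as horizontally periodic functions on R^3\<close>

definition pd :: "3 \<Rightarrow> (real^3 \<Rightarrow> real) \<Rightarrow> real^3 \<Rightarrow> real" where
  "pd i f x = deriv (\<lambda>h. f (x + h *\<^sub>R axis i 1)) 0"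

definition smooth3 :: "(real^3 \<Rightarrow> real) \<Rightarrow> bool" where
  "smooth3 f \<longleftrightarrow> (\<forall>is :: 3 list. foldr pd is f differentiable_on UNIV)"

definition hper :: "real \<Rightarrow> (real^3 \<Rightarrow> real) \<Rightarrow> bool" where
  "hper L f \<longleftrightarrow> (\<forall>x. f (x + (2 * pi * L) *\<^sub>R axis 1 1) = f x \<and> f (x + (2 * pi * L) *\<^sub>R axis 2 1) = f x)"

definition dmi :: "nat \<Rightarrow> nat \<Rightarrow> nat \<Rightarrow> (real^3 \<Rightarrow> real) \<Rightarrow> real^3 \<Rightarrow> real" where
  "dmi a b c f = (pd 1 ^^ a) ((pd 2 ^^ b) ((pd 3 ^^ c) f))"

definition Cell :: "real \<Rightarrow> (real^3) set" where
  "Cell L = {x. 0 \<le> x$1 \<and> x$1 < 2 * pi * L \<and> 0 \<le> x$2 \<and> x$2 < 2 * pi * L}"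

definition inHk :: "real \<Rightarrow> nat \<Rightarrow> (real^3 \<Rightarrow> real) \<Rightarrow> bool" where
  "inHk L k f \<longleftrightarrow> smooth3 f \<and> hper L f \<and>
     (\<forall>a b c. a + b + c \<le> k \<longrightarrow> set_integrable lborel (Cell L) (\<lambda>x. (dmi a b c f x)\<^sup>2))"

definition Hk_sq :: "real \<Rightarrow> nat \<Rightarrow> (real^3 \<Rightarrow> real) \<Rightarrow> real" where
  "Hk_sq L k f = (\<Sum>a\<le>k. \<Sum>b\<le>k - a. \<Sum>c\<le>k - a - b.
       (LINT x : Cell L | lborel. (dmi a b c f x)\<^sup>2))"

definition Hk_norm :: "real \<Rightarrow> nat \<Rightarrow> (real^3 \<Rightarrow> real) \<Rightarrow> real" where
  "Hk_norm L k f = sqrt (Hk_sq L k f)"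

definition cmp :: "(real^3 \<Rightarrow> real^3) \<Rightarrow> 3 \<Rightarrow> real^3 \<Rightarrow> real" where
  "cmp u i = (\<lambda>x. u x $ i)"

definition vHk_sq :: "real \<Rightarrow> nat \<Rightarrow> (real^3 \<Rightarrow> real^3) \<Rightarrow> real" where
  "vHk_sq L k u = (\<Sum>i\<in>UNIV. Hk_sq L k (cmp u i))"

definition vinHk :: "real \<Rightarrow> nat \<Rightarrow> (real^3 \<Rightarrow> real^3) \<Rightarrow> bool" where
  "vinHk L k u \<longleftrightarrow> (\<forall>i. inHk L k (cmp u i))"

definition grad :: "(real^3 \<Rightarrow> real) \<Rightarrow> real^3 \<Rightarrow> real^3" where
  "grad f x = (\<chi> i. pd i f x)"

definition divg :: "(real^3 \<Rightarrow> real^3) \<Rightarrow> real^3 \<Rightarrow> real" where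
  "divg u x = (\<Sum>i\<in>UNIV. pd i (cmp u i) x)"

definition curl :: "(real^3 \<Rightarrow> real^3) \<Rightarrow> real^3 \<Rightarrow> real^3" where
  "curl u x = vector [pd 2 (cmp u 3) x - pd 3 (cmp u 2) x,
                      pd 3 (cmp u 1) x - pd 1 (cmp u 3) x,
                      pd 1 (cmp u 2) x - pd 2 (cmp u 1) x]"

definition lapv :: "(real^3 \<Rightarrow> real^3) \<Rightarrow> real^3 \<Rightarrow> real^3" where
  "lapv u x = (\<chi> i. \<Sum>j\<in>UNIV. pd j (pd j (cmp u i)) x)"

definition dts :: "(real \<Rightarrow> real^3 \<Rightarrow> real) \<Rightarrow> real \<Rightarrow> real^3 \<Rightarrow> real" where
  "dts f t x = deriv (\<lambda>s. f s x) t"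

definition dtv :: "(real \<Rightarrow> real^3 \<Rightarrow> real^3) \<Rightarrow> real \<Rightarrow> real^3 \<Rightarrow> real^3" where
  "dtv u t x = (\<chi> i. deriv (\<lambda>s. u s x $ i) t)"

definition Mbar :: "bool \<Rightarrow> real \<Rightarrow> real^3" where
  "Mbar vert M = M *\<^sub>R (if vert then axis 3 1 else axis 1 1)"

definition lin_solution :: "bool \<Rightarrow> real \<Rightarrow> real \<Rightarrow> (real \<Rightarrow> real) \<Rightarrow> (real \<Rightarrow> real) \<Rightarrow> real
      \<Rightarrow> (real \<Rightarrow> real^3 \<Rightarrow> real) \<Rightarrow> (real \<Rightarrow> real^3 \<Rightarrow> real^3) \<Rightarrow> (real \<Rightarrow> real^3 \<Rightarrow> real^3)
      \<Rightarrow> (real \<Rightarrow> real^3 \<Rightarrow> real) \<Rightarrow> bool" where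
  "lin_solution vert g \<mu> rho rho' M vr u N q \<longleftrightarrow>
    (\<forall>t>0. \<forall>x.
       (\<lambda>s. vr s x) differentiable (at t) \<and>
       (\<forall>i. (\<lambda>s. u s x $ i) differentiable (at t)) \<and>
       (\<forall>i. (\<lambda>s. N s x $ i) differentiable (at t)) \<and>
       dts vr t x + rho' (x$3) * (u t x $ 3) = 0 \<and>
       rho (x$3) *\<^sub>R dtv u t x + grad (q t) x + (g * vr t x) *\<^sub>R axis 3 1
         = \<mu> *\<^sub>R lapv (u t) x + cross3 (curl (N t) x) (Mbar vert M) \<and>
       dtv N t x = curl (\<lambda>y. cross3 (u t y) (Mbar vert M)) x \<and>
       divg (u t) x = 0 \<and> divg (N t) x = 0)"

end

theory Submission
  imports Defs "HOL-Complex_Analysis.Great_Picard"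
begin

text \<open>For a frequency \<open>\<xi>\<close> and a growth rate \<open>l\<close> with \<open>l\<^sup>2 = - \<alpha>(\<xi>, l)\<close> the form
  \<open>B = E(\<cdot>, l) + l\<^sup>2 \<integral> \<rho> (|\<xi>|\<^sup>2 \<psi>\<^sup>2 + \<psi>'\<^sup>2)\<close> is nonnegative on \<open>H\<^sup>2\<close> and has infimum \<open>0\<close> on the
  admissible set. It is a coercive form minus \<open>g |\<xi>|\<^sup>2 \<integral> \<rho>' \<psi>\<^sup>2\<close>, which only sees the compact support of
  \<open>\<rho>'\<close>. Along a minimising sequence that converges uniformly there (Arzela-Ascoli), the parallelogram
  law for \<open>B \<ge> 0\<close> makes \<open>B\<close> of the differences small, hence the sequence is Cauchy in \<open>H\<^sup>2\<close>; this gives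
  a minimiser without weak compactness. Its Euler-Lagrange equation is a fourth order linear equation whose
  coefficients are constant near \<open>\<plusminus>\<infinity>\<close>, so the minimiser is smooth with all derivatives in
  \<open>L\<^sup>2\<close>. Taking it as the vertical velocity profile of a normal mode and eliminating the pressure from
  the horizontal momentum balance turns that equation into the vertical momentum balance.
  The rate \<open>l = \<lambda>(\<xi>)\<close> exists because \<open>\<alpha>\<close> is concave and nondecreasing in its second
  argument, and it is bounded in \<open>\<xi>\<close>, so some lattice frequency comes close to the supremum.\<close>

section \<open>Smooth functions and test functions\<close>

text \<open>Minimising sequences on the whole line may lose mass at infinity, so no compact
  embedding is available; the nonnegativity of \<open>B\<close> on all of H^2, which is the
  definition of \<alpha> made homogeneous, is what replaces it. H^2 is encoded by triples of a
  function and its weak derivatives, fixed only almost everywhere, hence the passage to continuous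
  representatives before any pointwise bound. A second gap lies between function spaces: the
  thresholds \<open>Mc\<close> and \<open>S_hor\<close> are suprema over H^1, while \<alpha> is an
  infimum over H^2. Steklov averages bridge it: they do not increase L^2 norms and the potential
  term passes to the limit, so a strict inequality survives. Once a function of negative
  \<open>E0\<close> is at hand, s^2 + \<alpha>(\<xi>, s) changes sign, and its zero is the growth
  rate. The viscous term makes the form elliptic of fourth order for both directions of the field,
  so one argument serves the horizontal and the vertical case.\<close>

definition smooth1 :: "(real \<Rightarrow> real) \<Rightarrow> bool" where
  "smooth1 f \<longleftrightarrow> (\<forall>n x. ((deriv ^^ n) f) differentiable (at x))"

lemma smooth1_iff: "smooth1 f \<longleftrightarrow> (\<forall>x. f differentiable (at x)) \<and> smooth1 (deriv f)"
proof -
  have "(\<forall>n. P n) \<longleftrightarrow> P 0 \<and> (\<forall>n. P (Suc n))" for P :: "nat \<Rightarrow> bool"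
    by (metis not0_implies_Suc)
  from this[of "\<lambda>n. \<forall>x. ((deriv ^^ n) f) differentiable (at x)"]
  show ?thesis unfolding smooth1_def
    by (simp add: funpow_swap1 del: funpow.simps(2)) (simp add: funpow_swap1)
qed

text \<open>If a class \<open>P\<close> is closed under taking derivatives, every iterated
  derivative of a member is again a member, by induction on the order, and hence differentiable.
  Smoothness is proved below by exhibiting such classes, which avoids formulas for n-th
  derivatives.\<close>

lemma smooth1_coinduct:
  assumes "P f" and step: "\<And>f. P f \<Longrightarrow> \<exists>f'. P f' \<and> (\<forall>x. (f has_real_derivative f' x) (at x))"
  shows "smooth1 f"
proof -
  have "P ((deriv ^^ n) f)" for n
  proof (induction n)
    case (Suc n)
    from step[OF Suc] obtain f' where f': "P f'" "\<forall>x. ((deriv ^^ n) f has_real_derivative f' x) (at x)" by blast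
    then have "deriv ((deriv ^^ n) f) = f'" by (auto intro: DERIV_imp_deriv)
    then show ?case using f' by simp
  qed (simp add: assms)
  then show ?thesis unfolding smooth1_def
    by (meson real_differentiable_def step)
qed

lemma smooth1_deriv: "smooth1 f \<Longrightarrow> smooth1 (deriv f)"
  using smooth1_iff by blast

lemma smooth1_DERIV: "smooth1 f \<Longrightarrow> (f has_real_derivative deriv f x) (at x)"
  using smooth1_iff by (metis DERIV_deriv_iff_real_differentiable)

lemma smooth1_antideriv:
  assumes "\<And>x. (F has_real_derivative f x) (at x)" "smooth1 f"
  shows "smooth1 F"
proof -
  have "deriv F = f" using assms(1) by (auto intro: DERIV_imp_deriv)
  then show ?thesis using assms smooth1_iff[of F] by (auto simp: real_differentiable_def)
qed

lemma smooth1_continuous: "smooth1 f \<Longrightarrow> continuous_on A f"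
  by (meson DERIV_isCont continuous_at_imp_continuous_on smooth1_DERIV)

lemma smooth1_const [simp]: "smooth1 (\<lambda>x. c)"
  by (rule smooth1_coinduct[where P = "\<lambda>f. \<exists>c. f = (\<lambda>x. c)"]) (auto intro!: derivative_eq_intros)

lemma smooth1_add:
  assumes "smooth1 f" "smooth1 g" shows "smooth1 (\<lambda>x. f x + g x)"
proof (rule smooth1_coinduct[where P = "\<lambda>h. \<exists>f g. smooth1 f \<and> smooth1 g \<and> h = (\<lambda>x. f x + g x)"])
  fix h :: "real \<Rightarrow> real" assume "\<exists>f g. smooth1 f \<and> smooth1 g \<and> h = (\<lambda>x. f x + g x)"
  then obtain f g where "smooth1 f" "smooth1 g" and h: "h = (\<lambda>x. f x + g x)" by blast
  then show "\<exists>f'. (\<exists>f g. smooth1 f \<and> smooth1 g \<and> f' = (\<lambda>x. f x + g x)) \<and>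
              (\<forall>x. (h has_real_derivative f' x) (at x))"
    unfolding h by (intro exI[of _ "\<lambda>x. deriv f x + deriv g x"])
      (auto intro!: derivative_eq_intros smooth1_deriv smooth1_DERIV)
qed (use assms in blast)

text \<open>A product differentiates to a sum of two products, so products alone do not form an
  invariant class. Finite sums of products of smooth functions do, and the coinduction runs on these
  sums, represented by lists of summands.\<close>

lemma smooth1_mult:
  assumes "smooth1 f" "smooth1 g" shows "smooth1 (\<lambda>x. f x * g x)"
proof -
  define S where "S \<equiv> {h. \<exists>f g. smooth1 f \<and> smooth1 g \<and> h = (\<lambda>x::real. f x * g x :: real)}"
  define T where "T \<equiv> {h. \<exists>hs. set hs \<subseteq> S \<and> h = (\<lambda>x::real. \<Sum>u\<leftarrow>hs. u x :: real)}"
  have D: "\<exists>hs'. set hs' \<subseteq> S \<and> (\<forall>x. ((\<lambda>x. \<Sum>u\<leftarrow>hs. u x) has_real_derivative (\<Sum>u\<leftarrow>hs'. u x)) (at x))"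
    if "set hs \<subseteq> S" for hs
    using that
  proof (induction hs)
    case Nil then show ?case by (auto intro!: exI[of _ "[]"])
  next
    case (Cons h hs)
    then obtain hs' where hs': "set hs' \<subseteq> S"
      "\<And>x. ((\<lambda>x. \<Sum>u\<leftarrow>hs. u x) has_real_derivative (\<Sum>u\<leftarrow>hs'. u x)) (at x)" by auto
    from Cons obtain f g where fg: "smooth1 f" "smooth1 g" "h = (\<lambda>x. f x * g x)"
      unfolding S_def by auto
    have "set ((\<lambda>x. deriv f x * g x) # (\<lambda>x. f x * deriv g x) # hs') \<subseteq> S"
    proof -
      have "(\<lambda>x. deriv f x * g x) \<in> S" "(\<lambda>x. f x * deriv g x) \<in> S"
        using smooth1_deriv[OF fg(1)] smooth1_deriv[OF fg(2)] fg(1,2) unfolding S_def by blast+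
      then show ?thesis using hs'(1) by simp
    qed
    moreover have "((\<lambda>x. \<Sum>u\<leftarrow>h # hs. u x) has_real_derivative
       (\<Sum>u\<leftarrow>(\<lambda>x. deriv f x * g x) # (\<lambda>x. f x * deriv g x) # hs'. u x)) (at x)" for x
      using fg by (auto intro!: derivative_eq_intros smooth1_DERIV hs'(2))
    ultimately show ?case by blast
  qed
  show ?thesis
  proof (rule smooth1_coinduct[where P = "\<lambda>h. h \<in> T"])
    have "(\<lambda>x. f x * g x) \<in> S" using assms unfolding S_def by blast
    then show "(\<lambda>x. f x * g x) \<in> T" unfolding T_def by (auto intro!: exI[of _ "[(\<lambda>x. f x * g x)]"])
  next
    fix h assume "h \<in> T"
    then obtain hs where "set hs \<subseteq> S" "h = (\<lambda>x. \<Sum>u\<leftarrow>hs. u x)" unfolding T_def by blast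
    then show "\<exists>f'. f' \<in> T \<and> (\<forall>x. (h has_real_derivative f' x) (at x))"
      using D[of hs] unfolding T_def by blast
  qed
qed

text \<open>The free factor \<open>b\<close> in the invariant absorbs the factor \<open>c\<close>
  that each differentiation produces.\<close>

lemma smooth1_affine:
  assumes "smooth1 f" shows "smooth1 (\<lambda>x. f (c * x + d))"
proof (rule smooth1_coinduct[where P = "\<lambda>h. \<exists>f b. smooth1 f \<and> h = (\<lambda>x. b * f (c * x + d))"])
  show "\<exists>fa b. smooth1 fa \<and> (\<lambda>x. f (c * x + d)) = (\<lambda>x. b * fa (c * x + d))"
    using assms by (auto intro!: exI[of _ f] exI[of _ 1])
next
  fix h assume "\<exists>f b. smooth1 f \<and> h = (\<lambda>x. b * f (c * x + d))"
  then obtain f b where f: "smooth1 f" and h: "h = (\<lambda>x. b * f (c * x + d))" by blast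
  have "(h has_real_derivative b * c * deriv f (c * x + d)) (at x)" for x
    unfolding h by (rule derivative_eq_intros DERIV_chain2[OF smooth1_DERIV[OF f]] refl)+ simp
  then show "\<exists>f'. (\<exists>f b. smooth1 f \<and> f' = (\<lambda>x. b * f (c * x + d))) \<and>
            (\<forall>x. (h has_real_derivative f' x) (at x))"
    using smooth1_deriv[OF f] by (intro exI[of _ "\<lambda>x. b * c * deriv f (c * x + d)"]) blast
qed

text \<open>Derivatives of the flat function stay in the class of functions
  \<open>p(1/x) exp(-1/x)\<close>, \<open>p\<close> a polynomial, extended by \<open>0\<close> to \<open>x \<le> 0\<close>.\<close>

definition flat_poly :: "real poly \<Rightarrow> real \<Rightarrow> real" where
  "flat_poly p x = (if x > 0 then poly p (1/x) * exp (- (1/x)) else 0)"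

text \<open>The power y^k generalises the induction: splitting off the constant coefficient of
  \<open>pCons a p\<close> leaves the polynomial \<open>p\<close> with one more factor y.\<close>

lemma poly_times_exp_minus_tendsto_0:
  "((\<lambda>y::real. y ^ k * poly p y * exp (- y)) \<longlongrightarrow> 0) at_top"
proof (induction p arbitrary: k)
  case (pCons a p)
  have "((\<lambda>y. a * (y ^ k / exp y) + y ^ Suc k * poly p y * exp (- y)) \<longlongrightarrow> a * 0 + 0) at_top"
    by (intro tendsto_intros pCons tendsto_power_div_exp_0)
  then show ?case by (simp add: algebra_simps exp_minus divide_inverse)
qed simp

text \<open>For x > 0 the chain rule gives y^2 (p - p')(y) exp(-y) at y = 1/x, and the two
  \<open>pCons 0\<close> encode y^2. At 0 the right difference quotient is y p(y) exp(-y) with y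
  tending to infinity, so both one-sided limits are 0.\<close>

lemma flat_poly_DERIV:
  "(flat_poly p has_real_derivative flat_poly (pCons 0 (pCons 0 (p - pderiv p))) x) (at x)"
proof -
  consider "x > 0" | "x < 0" | "x = 0" by linarith
  then show ?thesis
  proof cases
    case 1
    have D: "((\<lambda>x. poly p (1/x) * exp (- (1/x))) has_real_derivative
       flat_poly (pCons 0 (pCons 0 (p - pderiv p))) x) (at x)"
      using 1 by (auto intro!: derivative_eq_intros DERIV_chain2[OF poly_DERIV]
          simp: flat_poly_def field_simps power2_eq_square)
    have "eventually (\<lambda>y. flat_poly p y = poly p (1/y) * exp (- (1/y))) (nhds x)"
      using eventually_nhds_in_open[of "{0<..}" x] 1 by (auto simp: flat_poly_def elim: eventually_mono)
    from DERIV_cong_ev[OF refl this refl] D show ?thesis by blast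
  next
    case 2
    have D: "((\<lambda>x. 0) has_real_derivative flat_poly (pCons 0 (pCons 0 (p - pderiv p))) x) (at x)"
      using 2 by (auto simp: flat_poly_def)
    have "eventually (\<lambda>y. flat_poly p y = 0) (nhds x)"
      using eventually_nhds_in_open[of "{..<0}" x] 2 by (auto simp: flat_poly_def elim: eventually_mono)
    from DERIV_cong_ev[OF refl this refl] D show ?thesis by blast
  next
    case 3
    have "((\<lambda>h. flat_poly p h / h) \<longlongrightarrow> 0) (at_right 0)"
    proof (rule Lim_transform_eventually)
      have "((\<lambda>y. y ^ 1 * poly p y * exp (- y)) \<longlongrightarrow> 0) at_top"
        by (rule poly_times_exp_minus_tendsto_0)
      from filterlim_compose[OF this filterlim_inverse_at_top_right]
      show "((\<lambda>h. inverse h ^ 1 * poly p (inverse h) * exp (- inverse h)) \<longlongrightarrow> 0) (at_right (0::real))" .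
      show "\<forall>\<^sub>F h in at_right 0. inverse h ^ 1 * poly p (inverse h) * exp (- inverse h) = flat_poly p h / h"
        using eventually_at_right_less by eventually_elim (auto simp: flat_poly_def field_simps)
    qed
    moreover have "((\<lambda>h. flat_poly p h / h) \<longlongrightarrow> 0) (at_left 0)"
    proof (rule Lim_transform_eventually[OF tendsto_const])
      show "\<forall>\<^sub>F h in at_left 0. 0 = flat_poly p h / h"
        using eventually_at_left_real[of "-1" 0] by (auto simp: flat_poly_def elim: eventually_mono)
    qed
    ultimately have "((\<lambda>h. flat_poly p h / h) \<longlongrightarrow> 0) (at 0)"
      by (simp add: filterlim_split_at)
    then show ?thesis using 3 by (simp add: has_field_derivative_iff flat_poly_def)
  qed
qed

section \<open>Smooth bumps built from the flat function\<close>

definition flat :: "real \<Rightarrow> real" where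
  "flat x = (if x > 0 then exp (- (1/x)) else 0)"

lemma smooth1_flat: "smooth1 flat"
proof -
  have "flat = flat_poly 1" by (auto simp: flat_def flat_poly_def)
  then show ?thesis
    by (intro smooth1_coinduct[where P = "\<lambda>f. \<exists>p. f = flat_poly p"]) (auto intro: flat_poly_DERIV)
qed

lemma flat_nonneg: "0 \<le> flat x" and flat_le_1: "flat x \<le> 1" and flat_pos_iff: "0 < flat x \<longleftrightarrow> x > 0"
  by (auto simp: flat_def)

text \<open>The sharpness \<open>n\<close> is kept as a parameter: for growing \<open>n\<close> the
  bumps stay below 1 and converge pointwise to the indicator of the open interval, so integrals
  against bumps determine integrals over intervals.\<close>

definition bump :: "real \<Rightarrow> real \<Rightarrow> real \<Rightarrow> real \<Rightarrow> real" where
  "bump n a b x = flat (n * (x - a)) * flat (n * (b - x))"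

lemma smooth1_bump: "smooth1 (bump n a b)"
proof -
  have "smooth1 (\<lambda>x. flat (n * x + - n * a) * flat (- n * x + n * b))"
    by (intro smooth1_mult smooth1_affine smooth1_flat)
  then show ?thesis by (simp add: bump_def[abs_def] algebra_simps)
qed

lemma bump_bounds: "0 \<le> bump n a b x" "bump n a b x \<le> 1"
  unfolding bump_def by (auto intro!: mult_nonneg_nonneg flat_nonneg mult_le_one flat_le_1)

lemma bump_pos_iff: "n > 0 \<Longrightarrow> 0 < bump n a b x \<longleftrightarrow> a < x \<and> x < b"
  using flat_nonneg[of "n * (x - a)"] flat_nonneg[of "n * (b - x)"]
    flat_pos_iff[of "n * (x - a)"] flat_pos_iff[of "n * (b - x)"]
  by (auto simp: bump_def zero_less_mult_iff)

lemma bump_outside: "n > 0 \<Longrightarrow> \<not> (a < x \<and> x < b) \<Longrightarrow> bump n a b x = 0"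
  using bump_pos_iff[of n a b x] bump_bounds(1)[of n a b x] by auto

lemma flat_scale_tendsto: "x > 0 \<Longrightarrow> (\<lambda>n. flat (real (Suc n) * x)) \<longlonglongrightarrow> 1"
proof -
  assume x: "x > 0"
  have "(\<lambda>n. exp (- (inverse (real (Suc n)) * (1 / x)))) \<longlonglongrightarrow> exp (- (0 * (1 / x)))"
    by (intro tendsto_intros LIMSEQ_inverse_real_of_nat)
  moreover have "flat (real (Suc n) * x) = exp (- (inverse (real (Suc n)) * (1 / x)))" for n
    using x by (simp add: flat_def divide_inverse)
  ultimately show ?thesis by simp
qed

lemma bump_tendsto: "(\<lambda>n. bump (real (Suc n)) a b x) \<longlonglongrightarrow> indicator {a<..<b} x"
proof (cases "a < x \<and> x < b")
  case True
  then have "(\<lambda>n. bump (real (Suc n)) a b x) \<longlonglongrightarrow> 1 * 1"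
    unfolding bump_def by (intro tendsto_mult flat_scale_tendsto) auto
  with True show ?thesis by simp
next
  case False
  then have "bump (real (Suc n)) a b x = 0" for n by (intro bump_outside) auto
  then show ?thesis using False by auto
qed

section \<open>Test functions\<close>

lemma test1_iff: "test1 \<phi> \<longleftrightarrow> smooth1 \<phi> \<and> (\<exists>R. \<forall>x. \<bar>x\<bar> > R \<longrightarrow> \<phi> x = 0)"
  by (simp add: test1_def smooth1_def)

lemma test1_bump: "n > 0 \<Longrightarrow> test1 (bump n a b)"
  unfolding test1_iff
  by (intro conjI smooth1_bump exI[of _ "\<bar>a\<bar> + \<bar>b\<bar>"]) (auto intro!: bump_outside)

lemma test1_deriv: assumes "test1 \<phi>" shows "test1 (deriv \<phi>)"
proof -
  from assms obtain R where R: "\<And>x. \<bar>x\<bar> > R \<Longrightarrow> \<phi> x = 0" and s: "smooth1 \<phi>" unfolding test1_iff by blast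
  have "deriv \<phi> x = 0" if "\<bar>x\<bar> > R" for x
  proof -
    have "open {x::real. \<bar>x\<bar> > R}" by (intro open_Collect_less continuous_intros)
    then have "eventually (\<lambda>y. \<phi> y = 0) (nhds x)"
      using eventually_nhds_in_open[of "{x::real. \<bar>x\<bar> > R}" x] that R by (auto elim: eventually_mono)
    then have "deriv \<phi> x = deriv (\<lambda>x. 0) x" by (intro deriv_cong_ev) auto
    then show ?thesis by simp
  qed
  then show ?thesis using s smooth1_deriv unfolding test1_iff by blast
qed

lemma test1_add: "test1 f \<Longrightarrow> test1 g \<Longrightarrow> test1 (\<lambda>x. f x + g x)"
proof -
  assume f: "test1 f" and g: "test1 g"
  then obtain R S where "\<And>x. \<bar>x\<bar> > R \<Longrightarrow> f x = 0" "\<And>x. \<bar>x\<bar> > S \<Longrightarrow> g x = 0" unfolding test1_iff by blast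
  then have "\<forall>x. \<bar>x\<bar> > max R S \<longrightarrow> f x + g x = 0" by auto
  then show ?thesis using f g smooth1_add unfolding test1_iff by blast
qed

lemma test1_mult_smooth: "test1 f \<Longrightarrow> smooth1 g \<Longrightarrow> test1 (\<lambda>x. g x * f x)"
  unfolding test1_iff by (auto intro: smooth1_mult)

lemma test1_cmult: "test1 f \<Longrightarrow> test1 (\<lambda>x. c * f x)"
  by (rule test1_mult_smooth) auto

lemma test1_bounded: assumes "test1 f" obtains C where "C > 0" "\<And>x. \<bar>f x\<bar> \<le> C"
proof -
  from assms obtain R where R: "\<And>x. \<bar>x\<bar> > R \<Longrightarrow> f x = 0" and s: "smooth1 f" unfolding test1_iff by blast
  have "bounded (f ` {-R..R})" by (intro compact_imp_bounded compact_continuous_image smooth1_continuous s) auto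
  then obtain C where C: "\<forall>x\<in>{-R..R}. \<bar>f x\<bar> \<le> C" unfolding bounded_iff by auto
  have "\<bar>f x\<bar> \<le> max 1 C" for x
  proof (cases "\<bar>x\<bar> > R")
    case False
    then have "x \<in> {-R..R}" by auto
    then have "\<bar>f x\<bar> \<le> C" using C by blast
    then show ?thesis by simp
  qed (simp add: R)
  then show thesis by (intro that[of "max 1 C"]) auto
qed

lemma test1_borel: "test1 f \<Longrightarrow> f \<in> borel_measurable borel"
  using borel_measurable_continuous_onI smooth1_continuous test1_iff by blast

section \<open>Weak derivatives on the line\<close>

text \<open>Weak derivatives are treated in this class instead of L^2, because primitives of L^2
  functions, constants and affine functions occur along the way and need not be square integrable on
  the line.\<close>

definition loc_int :: "(real \<Rightarrow> real) \<Rightarrow> bool" where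
  "loc_int f \<longleftrightarrow> f \<in> borel_measurable borel \<and> (\<forall>a b. integrable lborel (\<lambda>x. indicator {a..b} x * f x))"

lemma loc_int_integrable: "loc_int f \<Longrightarrow> integrable lborel (\<lambda>x. indicator {a..b} x * f x)"
  by (simp add: loc_int_def)

lemma loc_int_borel: "loc_int f \<Longrightarrow> f \<in> borel_measurable borel"
  by (simp add: loc_int_def)

lemma loc_int_continuous: assumes "continuous_on UNIV f" shows "loc_int f"
proof -
  have "set_integrable lborel {a..b} f" for a b
    by (intro borel_integrable_atLeastAtMost' continuous_on_subset[OF assms]) auto
  then show ?thesis using borel_measurable_continuous_onI[OF assms] by (simp add: loc_int_def set_integrable_def)
qed

lemma loc_int_mult_compact:
  assumes "loc_int f" "g \<in> borel_measurable borel" "\<And>x. \<bar>g x\<bar> \<le> C" "\<And>x. \<bar>x\<bar> > R \<Longrightarrow> g x = 0"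
  shows "integrable lborel (\<lambda>x. f x * g x)"
proof (rule Bochner_Integration.integrable_bound)
  show "integrable lborel (\<lambda>x. C * (indicator {-R..R} x * f x))"
    using loc_int_integrable[OF assms(1)] by simp
  show "(\<lambda>x. f x * g x) \<in> borel_measurable lborel"
    using loc_int_borel[OF assms(1)] assms(2) by simp
  have "\<bar>f x * g x\<bar> \<le> \<bar>C * (indicator {-R..R} x * f x)\<bar>" for x
  proof (cases "\<bar>x\<bar> > R")
    case False
    have "\<bar>g x\<bar> * \<bar>f x\<bar> \<le> \<bar>C\<bar> * \<bar>f x\<bar>" using assms(3)[of x] by (intro mult_right_mono) auto
    then show ?thesis using False by (auto simp: abs_mult indicator_def mult.commute)
  qed (simp add: assms(4))
  then show "AE x in lborel. norm (f x * g x) \<le> norm (C * (indicator {-R..R} x * f x))" by simp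
qed

lemma loc_int_mult_test1: assumes "loc_int f" "test1 \<phi>" shows "integrable lborel (\<lambda>x. f x * \<phi> x)"
proof -
  obtain C where "\<And>x. \<bar>\<phi> x\<bar> \<le> C" using test1_bounded[OF assms(2)] by blast
  moreover obtain R where "\<And>x. \<bar>x\<bar> > R \<Longrightarrow> \<phi> x = 0" using assms(2) test1_iff by blast
  ultimately show ?thesis using loc_int_mult_compact[OF assms(1) test1_borel[OF assms(2)]] by blast
qed

lemma loc_int_const: "loc_int (\<lambda>x. c)"
  by (intro loc_int_continuous) auto

lemma loc_int_add: "loc_int f \<Longrightarrow> loc_int g \<Longrightarrow> loc_int (\<lambda>x. f x + g x)"
  unfolding loc_int_def by (auto simp: distrib_left)

lemma loc_int_cmult: assumes "loc_int f" shows "loc_int (\<lambda>x. c * f x)"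
proof -
  have "integrable lborel (\<lambda>x. c * (indicator {a..b} x * f x))" for a b
    using assms unfolding loc_int_def by simp
  then show ?thesis using assms unfolding loc_int_def by (auto simp: mult.left_commute)
qed

lemma loc_int_diff: "loc_int f \<Longrightarrow> loc_int g \<Longrightarrow> loc_int (\<lambda>x. f x - g x)"
  using loc_int_add[of f "\<lambda>x. -1 * g x"] loc_int_cmult[of g "-1"] by simp

lemma test1_integrable: "test1 \<phi> \<Longrightarrow> integrable lborel \<phi>"
  using loc_int_mult_test1[OF loc_int_const[of 1]] by simp

section \<open>Oriented primitives of locally integrable functions, normalised at 0\<close>

definition prim :: "(real \<Rightarrow> real) \<Rightarrow> real \<Rightarrow> real" where
  "prim f x = integral {0..x} f - integral {x..0} f"

lemma loc_int_HK:
  assumes "loc_int f"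
  shows "f integrable_on {a..b}" "integral {a..b} f = (\<integral>x. indicator {a..b} x * f x \<partial>lborel)"
proof -
  have "set_integrable lborel {a..b} f" using assms by (simp add: loc_int_def set_integrable_def)
  from set_borel_integral_eq_integral[OF this]
  show "f integrable_on {a..b}" "integral {a..b} f = (\<integral>x. indicator {a..b} x * f x \<partial>lborel)"
    by (simp_all add: set_lebesgue_integral_def)
qed

lemma prim_diff:
  assumes "loc_int f" "a \<le> b"
  shows "prim f b - prim f a = (\<integral>x. indicator {a..b} x * f x \<partial>lborel)"
proof -
  have *: "integral {x..z} f = integral {x..y} f + integral {y..z} f" if "x \<le> y" "y \<le> z" for x y z
    using Henstock_Kurzweil_Integration.integral_combine[OF that loc_int_HK(1)[OF assms(1)]] by simp
  have "prim f b - prim f a = integral {a..b} f"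
  proof -
    consider "0 \<le> a" | "a \<le> 0" "0 \<le> b" | "b \<le> 0" by linarith
    then show ?thesis
    proof cases
      case 1 
      then have "integral {a..0} f = 0" "integral {b..0} f = 0" using assms(2) by (cases "a = 0"; cases "b = 0"; auto)+
      then show ?thesis using *[of 0 a b] 1 assms(2) by (auto simp: prim_def)
    next
      case 2 
      then have "integral {0..a} f = 0" "integral {b..0} f = 0" using assms(2) by (cases "a = 0"; cases "b = 0"; auto)+
      then show ?thesis using *[of a 0 b] 2 by (auto simp: prim_def)
    next
      case 3 
      then have "integral {0..a} f = 0" "integral {0..b} f = 0" using assms(2) by (cases "a = 0"; cases "b = 0"; auto)+
      then show ?thesis using *[of a b 0] 3 assms(2) by (auto simp: prim_def)
    qed
  qed
  then show ?thesis using loc_int_HK(2)[OF assms(1)] by simp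
qed

lemma prim_continuous: assumes "loc_int f" shows "continuous_on UNIV (prim f)"
proof -
  have "isCont (prim f) x" for x
  proof -
    have "continuous_on {x-1..x+1} (\<lambda>y. prim f (x-1) + integral {x-1..y} f)"
      by (intro continuous_intros indefinite_integral_continuous_1 loc_int_HK assms)
    moreover have "prim f (x-1) + integral {x-1..y} f = prim f y" if "y \<in> {x-1..x+1}" for y
      using prim_diff[OF assms, of "x-1" y] that loc_int_HK[OF assms] by simp
    ultimately have "continuous_on {x-1..x+1} (prim f)" by (subst (asm) continuous_on_cong) auto
    then have "continuous_on {x-1<..<x+1} (prim f)" by (rule continuous_on_subset) auto
    then show ?thesis by (simp add: continuous_on_eq_continuous_at)
  qed
  then show ?thesis by (simp add: continuous_at_imp_continuous_on)
qed

lemma prim_DERIV: assumes "continuous_on UNIV f" shows "(prim f has_real_derivative f x) (at x)"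
proof -
  note li = loc_int_continuous[OF assms]
  have "((\<lambda>y. integral {x-1..y} f) has_real_derivative f x) (at x within {x-1..x+1})"
    by (intro integral_has_real_derivative continuous_on_subset[OF assms]) auto
  then have "((\<lambda>y. prim f (x-1) + integral {x-1..y} f) has_real_derivative f x) (at x within {x-1..x+1})"
    by (auto intro!: derivative_eq_intros)
  then have "((\<lambda>y. prim f (x-1) + integral {x-1..y} f) has_real_derivative f x) (at x within {x-1<..<x+1})"
    by (rule DERIV_subset) auto
  then have D: "((\<lambda>y. prim f (x-1) + integral {x-1..y} f) has_real_derivative f x) (at x)"
    by (subst (asm) at_within_open) auto
  have "eventually (\<lambda>y. prim f (x-1) + integral {x-1..y} f = prim f y) (nhds x)"
    using eventually_nhds_in_open[of "{x-1<..<x+1}" x]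
    by (auto elim!: eventually_mono simp: loc_int_HK[OF li] prim_diff[OF li, symmetric])
  from DERIV_cong_ev[OF refl this refl] D show ?thesis by blast
qed

lemma prim_loc_int: "loc_int f \<Longrightarrow> loc_int (prim f)"
  by (rule loc_int_continuous[OF prim_continuous])

section \<open>Integration by parts against test functions\<close>

lemma integral_deriv_interval:
  assumes "smooth1 \<phi>" "a \<le> b"
  shows "(\<integral>x. indicator {a..b} x * deriv \<phi> x \<partial>lborel) = \<phi> b - \<phi> a"
  using integral_FTC_Icc_real[OF assms(2), of \<phi> "deriv \<phi>"] smooth1_DERIV[OF assms(1)]
    smooth1_continuous[OF smooth1_deriv[OF assms(1)], of UNIV]
  by (simp add: mult.commute continuous_on_eq_continuous_at)

lemma test1_support: assumes "test1 \<phi>" obtains R where "R > 0" "\<And>x. \<bar>x\<bar> \<ge> R \<Longrightarrow> \<phi> x = 0" "\<And>x. \<bar>x\<bar> \<ge> R \<Longrightarrow> deriv \<phi> x = 0"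
proof -
  obtain R where R: "\<And>x. \<bar>x\<bar> > R \<Longrightarrow> \<phi> x = 0" using assms test1_iff by blast
  obtain S where S: "\<And>x. \<bar>x\<bar> > S \<Longrightarrow> deriv \<phi> x = 0" using test1_deriv[OF assms] test1_iff by blast
  show thesis
  proof (rule that[of "max 1 (max R S + 1)"])
    show "\<phi> x = 0" if "max 1 (max R S + 1) \<le> \<bar>x\<bar>" for x using that by (intro R) linarith
    show "deriv \<phi> x = 0" if "max 1 (max R S + 1) \<le> \<bar>x\<bar>" for x using that by (intro S) linarith
  qed simp
qed

lemma integral_deriv_test1:
  assumes "test1 \<phi>" shows "(\<integral>x. deriv \<phi> x \<partial>lborel) = 0"
proof -
  obtain R where R: "R > 0" "\<And>x. \<bar>x\<bar> \<ge> R \<Longrightarrow> \<phi> x = 0" "\<And>x. \<bar>x\<bar> \<ge> R \<Longrightarrow> deriv \<phi> x = 0"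
    using test1_support[OF assms] by metis
  have "(\<integral>x. deriv \<phi> x \<partial>lborel) = (\<integral>x. indicator {-R..R} x * deriv \<phi> x \<partial>lborel)"
  proof (intro Bochner_Integration.integral_cong refl)
    fix x show "deriv \<phi> x = indicator {-R..R} x * deriv \<phi> x"
      using R(3)[of x] by (cases "\<bar>x\<bar> \<ge> R") (auto simp: indicator_def)
  qed
  then show ?thesis using R integral_deriv_interval[of \<phi> "-R" R] assms test1_iff by auto
qed

text \<open>\<open>prim f\<close> need not be differentiable everywhere when \<open>f\<close> is
  only locally integrable, so Fubini does the integration by parts: \<phi>'(x) f(y) is integrated
  over -R \<le> y \<le> x. The inner integral over y is an increment of \<open>prim f\<close>, the
  one over x is - \<phi>(y).\<close>

lemma integral_prim_test1:
  assumes f: "loc_int f" and \<phi>: "test1 \<phi>"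
  shows "(\<integral>x. prim f x * deriv \<phi> x \<partial>lborel) = - (\<integral>x. f x * \<phi> x \<partial>lborel)"
proof -
  obtain R where R: "R > 0" "\<And>x. \<bar>x\<bar> \<ge> R \<Longrightarrow> \<phi> x = 0" "\<And>x. \<bar>x\<bar> \<ge> R \<Longrightarrow> deriv \<phi> x = 0"
    using test1_support[OF \<phi>] by metis
  have s: "smooth1 \<phi>" using \<phi> test1_iff by blast
  define h where "h = (\<lambda>y. indicator {-R..R} y * f y)"
  define G where "G = (\<lambda>x y. deriv \<phi> x * h y * indicator {y..} x)"
  have [measurable]: "f \<in> borel_measurable borel" "\<phi> \<in> borel_measurable borel" "deriv \<phi> \<in> borel_measurable borel"
    using loc_int_borel[OF f] test1_borel[OF \<phi>] test1_borel[OF test1_deriv[OF \<phi>]] by auto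
  have hm[measurable]: "h \<in> borel_measurable borel" unfolding h_def by measurable
  have hi: "integrable lborel h" unfolding h_def using f loc_int_def by blast
  have di: "integrable lborel (deriv \<phi>)" by (intro test1_integrable test1_deriv \<phi>)
  have P: "integrable (lborel \<Otimes>\<^sub>M lborel) (\<lambda>(x, y). deriv \<phi> x * h y)"
  proof (rule lborel_pair.Fubini_integrable)
    show "integrable lborel (\<lambda>x. LINT y|lborel. norm (case (x, y) of (x, y) \<Rightarrow> deriv \<phi> x * h y))"
      using di by (simp add: abs_mult)
    show "AE x in lborel. integrable lborel (\<lambda>y. case (x, y) of (x, y) \<Rightarrow> deriv \<phi> x * h y)"
      using hi by simp
  qed measurable
  have GP: "integrable (lborel \<Otimes>\<^sub>M lborel) (\<lambda>(x, y). G x y)"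
  proof (rule Bochner_Integration.integrable_bound[OF P])
    have "{p :: real \<times> real. snd p \<le> fst p} \<in> sets (borel \<Otimes>\<^sub>M borel)"
      unfolding borel_prod by (intro borel_closed closed_Collect_le continuous_intros)
    then have "(\<lambda>p. indicator {p :: real \<times> real. snd p \<le> fst p} p :: real) \<in> borel_measurable (borel \<Otimes>\<^sub>M borel)"
      by (intro borel_measurable_indicator)
    moreover have "(\<lambda>(x, y). G x y) = (\<lambda>p. deriv \<phi> (fst p) * h (snd p) * indicator {p :: real \<times> real. snd p \<le> fst p} p)"
      by (auto simp: G_def indicator_def)
    ultimately show "(\<lambda>(x, y). G x y) \<in> borel_measurable (lborel \<Otimes>\<^sub>M lborel)"
      by simp
    show "AE x in lborel \<Otimes>\<^sub>M lborel. norm (case x of (x, y) \<Rightarrow> G x y) \<le> norm (case x of (x, y) \<Rightarrow> deriv \<phi> x * h y)"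
      by (auto simp: G_def indicator_def)
  qed
  have "(\<integral>x. (\<integral>y. G x y \<partial>lborel) \<partial>lborel) = (\<integral>y. (\<integral>x. G x y \<partial>lborel) \<partial>lborel)"
    using lborel_pair.Fubini_integral[OF GP] by simp
  moreover have "(\<integral>y. G x y \<partial>lborel) = deriv \<phi> x * (prim f x - prim f (-R))" for x
  proof (cases "\<bar>x\<bar> \<ge> R")
    case False
    have "(\<integral>y. G x y \<partial>lborel) = (\<integral>y. deriv \<phi> x * (indicator {-R..x} y * f y) \<partial>lborel)"
      using False by (intro Bochner_Integration.integral_cong) (auto simp: G_def h_def indicator_def)
    then show ?thesis using prim_diff[OF f, of "-R" x] False by simp
  qed (simp add: G_def R)
  moreover have "(\<integral>x. G x y \<partial>lborel) = - (f y * \<phi> y)" for y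
  proof (cases "\<bar>y\<bar> \<ge> R")
    case True 
    then show ?thesis
    proof (cases "\<bar>y\<bar> = R")
      case True
      then have "y = R \<or> y = -R" by auto
      then show ?thesis
      proof
        assume "y = R"
        then have "G x y = 0" for x using R(3)[of x] R(1) by (auto simp: G_def indicator_def)
        then show ?thesis using \<open>y = R\<close> R by simp
      next
        assume y: "y = -R"
        have "(\<integral>x. G x y \<partial>lborel) = (\<integral>x. h y * (indicator {-R..R} x * deriv \<phi> x) \<partial>lborel)"
          using R(3) R(1) y by (intro Bochner_Integration.integral_cong) (auto simp: G_def indicator_def)
        then show ?thesis using y R by (simp add: integral_deriv_interval[OF s])
      qed
    next
      case False then have "h y = 0" using True by (auto simp: h_def indicator_def)
      then show ?thesis using True R by (simp add: G_def)
    qed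
  next
    case False
    have "(\<integral>x. G x y \<partial>lborel) = (\<integral>x. h y * (indicator {y..R} x * deriv \<phi> x) \<partial>lborel)"
      using R(3) R(1) by (intro Bochner_Integration.integral_cong) (auto simp: G_def indicator_def)
    also have "\<dots> = h y * - \<phi> y" using False R by (simp add: integral_deriv_interval[OF s])
    also have "h y = f y" using False by (auto simp: h_def indicator_def)
    finally show ?thesis by simp
  qed
  ultimately have E: "(\<integral>x. deriv \<phi> x * (prim f x - prim f (-R)) \<partial>lborel) = - (\<integral>x. f x * \<phi> x \<partial>lborel)"
    by simp
  have Z: "(\<integral>x. deriv \<phi> x \<partial>lborel) = 0" by (rule integral_deriv_test1[OF \<phi>])
  have "(\<integral>x. deriv \<phi> x * (prim f x - prim f (-R)) \<partial>lborel)
     = (\<integral>x. prim f x * deriv \<phi> x - prim f (-R) * deriv \<phi> x \<partial>lborel)"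
    by (simp add: algebra_simps)
  also have "\<dots> = (\<integral>x. prim f x * deriv \<phi> x \<partial>lborel) - (\<integral>x. prim f (-R) * deriv \<phi> x \<partial>lborel)"
    by (intro Bochner_Integration.integral_diff integrable_mult_right di
        loc_int_mult_test1 prim_loc_int f test1_deriv \<phi>)
  finally show ?thesis using E Z by simp
qed

text \<open>Vanishing mean is the condition under which a primitive has compact support: left of the
  support it is 0 by the normalisation at -R, right of it it equals the total integral.\<close>

lemma test1_antideriv:
  assumes \<eta>: "test1 \<eta>" and "(\<integral>x. \<eta> x \<partial>lborel) = 0"
  obtains \<phi> where "test1 \<phi>" "deriv \<phi> = \<eta>"
proof -
  obtain R where R: "R > 0" "\<And>x. \<bar>x\<bar> \<ge> R \<Longrightarrow> \<eta> x = 0" using test1_support[OF \<eta>] by metis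
  have c: "continuous_on UNIV \<eta>" using \<eta> smooth1_continuous test1_iff by blast
  note li = loc_int_continuous[OF c]
  define \<phi> where "\<phi> = (\<lambda>x. prim \<eta> x - prim \<eta> (-R))"
  have D: "(\<phi> has_real_derivative \<eta> x) (at x)" for x
    unfolding \<phi>_def using prim_DERIV[OF c] by (auto intro!: derivative_eq_intros)
  have "\<phi> x = 0" if "\<bar>x\<bar> > R" for x
  proof (cases "x > 0")
    case True
    have "(\<integral>x. \<eta> x \<partial>lborel) = (\<integral>y. indicator {-R..x} y * \<eta> y \<partial>lborel)"
    proof (intro Bochner_Integration.integral_cong refl)
      fix y show "\<eta> y = indicator {-R..x} y * \<eta> y"
        using R(2)[of y] that True by (cases "\<bar>y\<bar> \<ge> R") (auto simp: indicator_def)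
    qed
    then show ?thesis using prim_diff[OF li, of "-R" x] R assms True by (simp add: \<phi>_def)
  next
    case False
    have "(\<integral>y. indicator {x..-R} y * \<eta> y \<partial>lborel) = (\<integral>y. 0 \<partial>(lborel::real measure))"
      using R by (intro Bochner_Integration.integral_cong) (auto simp: indicator_def)
    then show ?thesis using prim_diff[OF li, of x "-R"] that False by (simp add: \<phi>_def)
  qed
  moreover have "smooth1 \<phi>" using smooth1_antideriv[OF D] \<eta> test1_iff by blast
  ultimately have "test1 \<phi>" unfolding test1_iff by blast
  moreover have "deriv \<phi> = \<eta>" using D DERIV_imp_deriv by blast
  ultimately show thesis using that by blast
qed

text \<open>The positive and the negative part of \<open>g\<close>, cut off to a bounded interval,
  are densities of finite measures that agree on all half-lines. Hence the measures coincide, the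
  densities agree almost everywhere, and both vanish because they are never nonzero at the same
  point.\<close>

lemma AE_zero_if_interval_integrals_zero:
  assumes g: "loc_int g" and z: "\<And>a b. a < b \<Longrightarrow> (\<integral>x. indicator {a<..<b} x * g x \<partial>lborel) = 0"
  shows "AE x in lborel. g x = 0"
proof -
  have [measurable]: "g \<in> borel_measurable borel" using g loc_int_borel by blast
  have z': "(\<integral>x. indicator {a<..<b} x * g x \<partial>lborel) = 0" for a b
    using z[of a b] by (cases "a < b") auto
  have "AE x in lborel. x \<in> {-real n<..<real n} \<longrightarrow> g x = 0" for n
  proof -
    define f where "f = (\<lambda>x. indicator {-real n<..<real n} x * g x)"
    have [measurable]: "f \<in> borel_measurable borel" unfolding f_def by measurable
    have fi: "integrable lborel f"
      by (rule Bochner_Integration.integrable_bound[OF loc_int_integrable[OF g, of "-real n" "real n"]])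
        (auto simp: f_def indicator_def)
    have pi: "integrable lborel (\<lambda>x. max 0 (f x) * indicator A x)" "integrable lborel (\<lambda>x. max 0 (- f x) * indicator A x)"
      if [measurable]: "A \<in> sets borel" for A
      by (rule Bochner_Integration.integrable_bound[OF fi]; auto simp: indicator_def)+
    \<comment> \<open>\<open>ennreal\<close> sends negative numbers to 0, so
      \<open>ennreal (f x)\<close> and \<open>ennreal (- f x)\<close> are the positive and the
      negative part.\<close>
    have e: "emeasure (density lborel (\<lambda>x. ennreal (f x))) A = ennreal (\<integral>x. max 0 (f x) * indicator A x \<partial>lborel)"
        "emeasure (density lborel (\<lambda>x. ennreal (- f x))) A = ennreal (\<integral>x. max 0 (- f x) * indicator A x \<partial>lborel)"
      if [measurable]: "A \<in> sets borel" for A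
      unfolding nn_integral_eq_integral[OF pi(1)[OF that], simplified, symmetric]
        nn_integral_eq_integral[OF pi(2)[OF that], simplified, symmetric]
      by (subst emeasure_density; auto intro!: nn_integral_cong simp: indicator_def max_def ennreal_neg)+
    have "density lborel (\<lambda>x. ennreal (f x)) = density lborel (\<lambda>x. ennreal (- f x))"
    proof (rule measure_eqI_lessThan)
      fix x :: real
      have "(\<integral>y. max 0 (f y) * indicator {x<..} y \<partial>lborel) - (\<integral>y. max 0 (- f y) * indicator {x<..} y \<partial>lborel)
        = (\<integral>y. max 0 (f y) * indicator {x<..} y - max 0 (- f y) * indicator {x<..} y \<partial>lborel)"
        by (intro Bochner_Integration.integral_diff[symmetric] pi) auto
      also have "\<dots> = (\<integral>y. indicator {max x (-real n)<..<real n} y * g y \<partial>lborel)"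
        by (intro Bochner_Integration.integral_cong) (auto simp: f_def indicator_def max_def)
      finally show "emeasure (density lborel (\<lambda>x. ennreal (f x))) {x<..} = emeasure (density lborel (\<lambda>x. ennreal (- f x))) {x<..}"
        by (simp add: e z')
    qed (auto simp: e)
    moreover have "integral\<^sup>N lborel (\<lambda>x. ennreal (f x)) \<noteq> \<infinity>"
      using e(1)[of UNIV] by (simp add: emeasure_density)
    ultimately have "AE x in lborel. ennreal (f x) = ennreal (- f x)"
      by (subst (asm) finite_density_unique) auto
    then have "AE x in lborel. f x = 0"
    proof eventually_elim
      case (elim x) then show ?case
        by (cases "f x \<ge> 0") (auto simp: ennreal_neg ennreal_eq_0_iff)
    qed
    then show ?thesis by eventually_elim (auto simp: f_def)
  qed
  then have "AE x in lborel. \<forall>n. x \<in> {-real n<..<real n} \<longrightarrow> g x = 0" by (subst AE_all_countable) auto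
  then show ?thesis
  proof eventually_elim
    case (elim x)
    obtain n where "\<bar>x\<bar> < real n" using reals_Archimedean2 by blast
    then have "x \<in> {-real n<..<real n}" by auto
    then show ?case using elim by blast
  qed
qed

lemma bump_not_AE_zero:
  assumes "n > 0" "a < b" shows "\<not> (AE x in lborel. bump n a b x = 0)"
proof
  assume "AE x in lborel. bump n a b x = 0"
  then have "AE x in lborel. \<not> (x \<in> {a<..<b})"
  proof eventually_elim
    case (elim x)
    then show ?case using bump_pos_iff[OF assms(1), of a b x] by simp
  qed
  then have "emeasure lborel {a<..<b} = 0"
    by (subst (asm) AE_iff_measurable[OF _ refl]) (auto simp: greaterThanLessThan_def greaterThan_def lessThan_def Collect_conj_eq)
  then show False using assms(2) by simp
qed

lemma test1_unit: obtains \<eta> where "test1 \<eta>" "(\<integral>x. \<eta> x \<partial>lborel) = 1"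
proof -
  define b where "b = bump 1 0 1"
  have t: "test1 b" by (simp add: b_def test1_bump)
  have "(\<integral>x. b x \<partial>lborel) \<noteq> 0"
  proof
    assume "(\<integral>x. b x \<partial>lborel) = 0"
    then have "AE x in lborel. b x = 0"
      using integral_nonneg_eq_0_iff_AE[OF test1_integrable[OF t]] bump_bounds(1) by (auto simp: b_def)
    then show False using bump_not_AE_zero[of 1 0 1] by (simp add: b_def)
  qed
  then show thesis
    by (intro that[of "\<lambda>x. inverse (\<integral>x. b x \<partial>lborel) * b x"] test1_cmult t) simp
qed

text \<open>Subtracting a multiple of a fixed test function \<open>\<eta>0\<close> of integral 1
  turns any test function into one of mean zero, which is a derivative. So \<open>h\<close> acts on
  test functions like the constant \<open>c\<close>, and letting bumps tend to indicators transfers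
  this to intervals.\<close>

lemma du_Bois_Reymond:
  assumes h: "loc_int h" and z: "\<And>\<phi>. test1 \<phi> \<Longrightarrow> (\<integral>x. h x * deriv \<phi> x \<partial>lborel) = 0"
  obtains c where "AE x in lborel. h x = c"
    and "\<And>\<eta>. test1 \<eta> \<Longrightarrow> (\<integral>x. h x * \<eta> x \<partial>lborel) = c * (\<integral>x. \<eta> x \<partial>lborel)"
proof -
  obtain \<eta>0 where t0: "test1 \<eta>0" and I0: "(\<integral>x. \<eta>0 x \<partial>lborel) = 1" using test1_unit .
  define c where "c = (\<integral>x. h x * \<eta>0 x \<partial>lborel)"
  have c: "(\<integral>x. h x * \<eta> x \<partial>lborel) = c * (\<integral>x. \<eta> x \<partial>lborel)" if \<eta>: "test1 \<eta>" for \<eta>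
  proof -
    define d where "d = (\<integral>x. \<eta> x \<partial>lborel)"
    have t: "test1 (\<lambda>x. \<eta> x + (-d) * \<eta>0 x)" by (intro test1_add test1_cmult \<eta> t0)
    have "(\<integral>x. \<eta> x + (-d) * \<eta>0 x \<partial>lborel) = (\<integral>x. \<eta> x \<partial>lborel) + (\<integral>x. (-d) * \<eta>0 x \<partial>lborel)"
      by (intro Bochner_Integration.integral_add test1_integrable test1_cmult \<eta> t0)
    then have "(\<integral>x. \<eta> x + (-d) * \<eta>0 x \<partial>lborel) = 0" by (simp add: d_def I0)
    then obtain \<phi> where \<phi>: "test1 \<phi>" "deriv \<phi> = (\<lambda>x. \<eta> x + (-d) * \<eta>0 x)" using test1_antideriv[OF t] by blast
    have "0 = (\<integral>x. h x * (\<eta> x + (-d) * \<eta>0 x) \<partial>lborel)" using z[OF \<phi>(1)] \<phi>(2) by simp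
    also have "\<dots> = (\<integral>x. h x * \<eta> x + (-d) * (h x * \<eta>0 x) \<partial>lborel)" by (simp add: algebra_simps)
    also have "\<dots> = (\<integral>x. h x * \<eta> x \<partial>lborel) + (\<integral>x. (-d) * (h x * \<eta>0 x) \<partial>lborel)"
      by (intro Bochner_Integration.integral_add integrable_mult_right loc_int_mult_test1 h \<eta> t0)
    finally show ?thesis by (simp add: d_def c_def)
  qed
  have "AE x in lborel. h x - c = 0"
  proof (rule AE_zero_if_interval_integrals_zero)
    show li: "loc_int (\<lambda>x. h x - c)" by (intro loc_int_diff h loc_int_const)
    fix a b :: real assume ab: "a < b"
    have "(\<lambda>n. \<integral>x. (h x - c) * bump (real (Suc n)) a b x \<partial>lborel) \<longlonglongrightarrow> (\<integral>x. (h x - c) * indicator {a<..<b} x \<partial>lborel)"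
    proof (rule integral_dominated_convergence)
      show "integrable lborel (\<lambda>x. \<bar>indicator {a..b} x * (h x - c)\<bar>)"
        using loc_int_integrable[OF li] by (intro integrable_abs)
      show "(\<lambda>x. (h x - c) * indicator {a<..<b} x) \<in> borel_measurable lborel"
        using loc_int_borel[OF li] by simp
      show "(\<lambda>x. (h x - c) * bump (real (Suc n)) a b x) \<in> borel_measurable lborel" for n
        using loc_int_borel[OF li] test1_borel[OF test1_bump] by simp
      show "AE x in lborel. (\<lambda>n. (h x - c) * bump (real (Suc n)) a b x) \<longlonglongrightarrow> (h x - c) * indicator {a<..<b} x"
        by (intro AE_I2 tendsto_intros bump_tendsto)
      show "AE x in lborel. norm ((h x - c) * bump (real (Suc n)) a b x) \<le> \<bar>indicator {a..b} x * (h x - c)\<bar>" for n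
      proof (intro AE_I2)
        fix x
        show "norm ((h x - c) * bump (real (Suc n)) a b x) \<le> \<bar>indicator {a..b} x * (h x - c)\<bar>"
        proof (cases "a < x \<and> x < b")
          case True
          then show ?thesis
            using bump_bounds[of "real (Suc n)" a b x] by (auto simp: abs_mult intro!: mult_left_le)
        next
          case False
          then have "bump (real (Suc n)) a b x = 0" by (intro bump_outside) auto
          then show ?thesis by simp
        qed
      qed
    qed
    moreover have "(\<integral>x. (h x - c) * bump (real (Suc n)) a b x \<partial>lborel) = 0" for n
    proof -
      have t: "test1 (bump (real (Suc n)) a b)" by (intro test1_bump) simp
      have "(\<integral>x. (h x - c) * bump (real (Suc n)) a b x \<partial>lborel)
        = (\<integral>x. h x * bump (real (Suc n)) a b x - c * bump (real (Suc n)) a b x \<partial>lborel)"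
        by (simp add: left_diff_distrib)
      also have "\<dots> = (\<integral>x. h x * bump (real (Suc n)) a b x \<partial>lborel) - (\<integral>x. c * bump (real (Suc n)) a b x \<partial>lborel)"
        by (intro Bochner_Integration.integral_diff loc_int_mult_test1 h t integrable_mult_right test1_integrable)
      finally show ?thesis using c[OF t] by simp
    qed
    ultimately have "(\<integral>x. (h x - c) * indicator {a<..<b} x \<partial>lborel) = 0"
      by (simp add: LIMSEQ_const_iff)
    then show "(\<integral>x. indicator {a<..<b} x * (h x - c) \<partial>lborel) = 0" by (simp add: mult.commute)
  qed
  then have "AE x in lborel. h x = c" by simp
  then show thesis using c that by blast
qed

lemma weak_deriv_imp_prim:
  assumes "loc_int f" "loc_int f1" "weak_deriv f f1"
  obtains c where "AE x in lborel. f x = c + prim f1 x"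
proof -
  have "(\<integral>x. (f x - prim f1 x) * deriv \<phi> x \<partial>lborel) = 0" if \<phi>: "test1 \<phi>" for \<phi>
  proof -
    have "(\<integral>x. (f x - prim f1 x) * deriv \<phi> x \<partial>lborel) = (\<integral>x. f x * deriv \<phi> x - prim f1 x * deriv \<phi> x \<partial>lborel)"
      by (simp add: left_diff_distrib)
    also have "\<dots> = (\<integral>x. f x * deriv \<phi> x \<partial>lborel) - (\<integral>x. prim f1 x * deriv \<phi> x \<partial>lborel)"
      by (intro Bochner_Integration.integral_diff loc_int_mult_test1 assms prim_loc_int test1_deriv \<phi>)
    also have "\<dots> = 0" using integral_prim_test1[OF assms(2) \<phi>] assms(3) \<phi> unfolding weak_deriv_def by simp
    finally show ?thesis .
  qed
  from du_Bois_Reymond[OF loc_int_diff[OF assms(1) prim_loc_int[OF assms(2)]] this]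
  obtain c where "AE x in lborel. f x - prim f1 x = c" by blast
  then have "AE x in lborel. f x = c + prim f1 x" by eventually_elim simp
  then show thesis using that by blast
qed

text \<open>The same correction by \<open>\<eta>0\<close>, one order higher: a corrected test
  function is some \<phi>', and \<open>h\<close> annihilates its derivative \<phi>''. This
  identifies the weak derivative of \<open>h\<close> as the constant \<open>- e\<close>, and the
  representation by a primitive makes \<open>h\<close> affine.\<close>

lemma weak_deriv2_zero_imp_affine:
  assumes h: "loc_int h" and z: "\<And>\<phi>. test1 \<phi> \<Longrightarrow> (\<integral>x. h x * deriv (deriv \<phi>) x \<partial>lborel) = 0"
  obtains c d where "AE x in lborel. h x = c + d * x"
proof -
  obtain \<eta>0 where t0: "test1 \<eta>0" and I0: "(\<integral>x. \<eta>0 x \<partial>lborel) = 1" using test1_unit .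
  define e where "e = (\<integral>x. h x * deriv \<eta>0 x \<partial>lborel)"
  have "weak_deriv h (\<lambda>x. - e)"
    unfolding weak_deriv_def
  proof (intro allI impI)
    fix \<eta> assume \<eta>: "test1 \<eta>"
    define d where "d = (\<integral>x. \<eta> x \<partial>lborel)"
    have t: "test1 (\<lambda>x. \<eta> x + (-d) * \<eta>0 x)" by (intro test1_add test1_cmult \<eta> t0)
    have "(\<integral>x. \<eta> x + (-d) * \<eta>0 x \<partial>lborel) = (\<integral>x. \<eta> x \<partial>lborel) + (\<integral>x. (-d) * \<eta>0 x \<partial>lborel)"
      by (intro Bochner_Integration.integral_add test1_integrable test1_cmult \<eta> t0)
    then have "(\<integral>x. \<eta> x + (-d) * \<eta>0 x \<partial>lborel) = 0" by (simp add: d_def I0)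
    then obtain \<phi> where \<phi>: "test1 \<phi>" "deriv \<phi> = (\<lambda>x. \<eta> x + (-d) * \<eta>0 x)" using test1_antideriv[OF t] by blast
    have "(deriv \<phi> has_real_derivative deriv \<eta> x + (-d) * deriv \<eta>0 x) (at x)" for x
      using smooth1_DERIV[of \<eta> x] smooth1_DERIV[of \<eta>0 x] \<eta> t0 unfolding \<phi>(2) test1_iff
      by (auto intro!: derivative_eq_intros)
    then have dd: "deriv (deriv \<phi>) x = deriv \<eta> x + (-d) * deriv \<eta>0 x" for x
      using DERIV_imp_deriv by blast
    have "0 = (\<integral>x. h x * deriv \<eta> x + (-d) * (h x * deriv \<eta>0 x) \<partial>lborel)"
      using z[OF \<phi>(1)] by (simp add: dd algebra_simps)
    also have "\<dots> = (\<integral>x. h x * deriv \<eta> x \<partial>lborel) + (\<integral>x. (-d) * (h x * deriv \<eta>0 x) \<partial>lborel)"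
      by (intro Bochner_Integration.integral_add integrable_mult_right loc_int_mult_test1 h \<eta> t0 test1_deriv)
    finally show "(\<integral>x. h x * deriv \<eta> x \<partial>lborel) = - (\<integral>x. - e * \<eta> x \<partial>lborel)"
      by (simp add: d_def e_def mult.commute)
  qed
  from weak_deriv_imp_prim[OF h loc_int_const this] obtain c where c: "AE x in lborel. h x = c + prim (\<lambda>x. -e) x" by blast
  have "prim (\<lambda>x. -e) x = - e * x" for x
    by (cases "x \<ge> 0") (auto simp: prim_def)
  then have "AE x in lborel. h x = c + (- e) * x" using c by simp
  then show thesis using that by blast
qed

section \<open>Square-integrable functions\<close>

definition normsq :: "(real \<Rightarrow> real) \<Rightarrow> real" where "normsq f = (\<integral>x. (f x)\<^sup>2 \<partial>lborel)"

definition inner_L2 :: "(real \<Rightarrow> real) \<Rightarrow> (real \<Rightarrow> real) \<Rightarrow> real" where "inner_L2 f g = (\<integral>x. f x * g x \<partial>lborel)"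

lemma normsq_nonneg: "0 \<le> normsq f"
  by (simp add: normsq_def)

lemma inner_L2_commute: "inner_L2 f g = inner_L2 g f"
  by (simp add: inner_L2_def mult.commute)

lemma L2R_borel: "L2R f \<Longrightarrow> f \<in> borel_measurable borel"
  by (simp add: L2R_def)

lemma L2R_int: "L2R f \<Longrightarrow> integrable lborel (\<lambda>x. (f x)\<^sup>2)"
  by (simp add: L2R_def)

lemma L2R_mult: assumes "L2R f" "L2R g" shows "integrable lborel (\<lambda>x. f x * g x)"
proof (rule Bochner_Integration.integrable_bound)
  show "integrable lborel (\<lambda>x. (f x)\<^sup>2 + (g x)\<^sup>2)" using assms L2R_int by auto
  show "(\<lambda>x. f x * g x) \<in> borel_measurable lborel" using assms L2R_borel by auto
  have "\<bar>f x * g x\<bar> \<le> (f x)\<^sup>2 + (g x)\<^sup>2" for x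
  proof -
    have "2 * (\<bar>f x\<bar> * \<bar>g x\<bar>) \<le> (f x)\<^sup>2 + (g x)\<^sup>2"
      using sum_squares_bound[of "\<bar>f x\<bar>" "\<bar>g x\<bar>"] by simp
    moreover have "0 \<le> \<bar>f x\<bar> * \<bar>g x\<bar>" by simp
    ultimately show ?thesis unfolding abs_mult by linarith
  qed
  then show "AE x in lborel. norm (f x * g x) \<le> norm ((f x)\<^sup>2 + (g x)\<^sup>2)" by simp
qed

lemma L2R_bounded_mult:
  assumes "L2R f" "a \<in> borel_measurable borel" "\<And>x. \<bar>a x\<bar> \<le> C" shows "L2R (\<lambda>x. a x * f x)"
  unfolding L2R_def
proof
  show "(\<lambda>x. a x * f x) \<in> borel_measurable lborel" using assms L2R_borel by auto
  show "integrable lborel (\<lambda>x. (a x * f x)\<^sup>2)"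
  proof (rule Bochner_Integration.integrable_bound)
    show "integrable lborel (\<lambda>x. C\<^sup>2 * (f x)\<^sup>2)" using assms L2R_int by auto
    show "(\<lambda>x. (a x * f x)\<^sup>2) \<in> borel_measurable lborel" using assms L2R_borel by auto
    have "(a x * f x)\<^sup>2 \<le> C\<^sup>2 * (f x)\<^sup>2" for x
      unfolding power_mult_distrib using assms(3)[of x] by (intro mult_right_mono) (auto simp: abs_le_square_iff[symmetric])
    then show "AE x in lborel. norm ((a x * f x)\<^sup>2) \<le> norm (C\<^sup>2 * (f x)\<^sup>2)" by simp
  qed
qed

lemma L2R_cmult: "L2R f \<Longrightarrow> L2R (\<lambda>x. c * f x)"
  by (rule L2R_bounded_mult[of _ _ "\<bar>c\<bar>"]) auto

lemma L2R_add: assumes "L2R f" "L2R g" shows "L2R (\<lambda>x. f x + g x)"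
  unfolding L2R_def
proof
  show "(\<lambda>x. f x + g x) \<in> borel_measurable lborel" using assms L2R_borel by auto
  have "integrable lborel (\<lambda>x. (f x)\<^sup>2 + (g x)\<^sup>2 + 2 * (f x * g x))"
    using assms L2R_int L2R_mult by auto
  then show "integrable lborel (\<lambda>x. (f x + g x)\<^sup>2)" by (simp add: power2_sum algebra_simps)
qed

lemma L2R_diff: "L2R f \<Longrightarrow> L2R g \<Longrightarrow> L2R (\<lambda>x. f x - g x)"
  using L2R_add[of f "\<lambda>x. -1 * g x"] L2R_cmult[of g "-1"] by simp

lemma integrable_indicator_Icc: "integrable lborel (\<lambda>x. indicator {a..b::real} x :: real)"
  by (intro integrable_real_indicator) (auto simp: emeasure_lborel_Icc_eq)

lemma L2R_loc_int: assumes "L2R f" shows "loc_int f"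
  unfolding loc_int_def
proof (intro conjI allI)
  fix a b :: real
  have [measurable]: "f \<in> borel_measurable borel" using assms L2R_borel by blast
  show "integrable lborel (\<lambda>x. indicator {a..b} x * f x)"
  proof (rule Bochner_Integration.integrable_bound)
    show "integrable lborel (\<lambda>x. (f x)\<^sup>2 + indicator {a..b} x)"
      by (intro Bochner_Integration.integrable_add L2R_int assms integrable_indicator_Icc)
    have "\<bar>f x\<bar> \<le> (f x)\<^sup>2 + 1" for x
      using sum_squares_bound[of "\<bar>f x\<bar>" 1] zero_le_power2[of "f x"] by simp
    then show "AE x in lborel. norm (indicator {a..b} x * f x) \<le> norm ((f x)\<^sup>2 + indicator {a..b} x)"
      by (auto simp: indicator_def)
  qed measurable
qed (use assms L2R_borel in blast)

lemma L2R_cong_AE: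
  assumes "L2R f" "g \<in> borel_measurable borel" "AE x in lborel. f x = g x" shows "L2R g"
proof -
  have "integrable lborel (\<lambda>x. (f x)\<^sup>2) \<longleftrightarrow> integrable lborel (\<lambda>x. (g x)\<^sup>2)"
    using assms L2R_borel[OF assms(1)] by (intro integrable_cong_AE) (auto elim: eventually_mono)
  then show ?thesis using assms by (simp add: L2R_def)
qed

lemma test1_L2R: assumes "test1 f" shows "L2R f"
proof -
  have "test1 (\<lambda>x. f x * f x)" using test1_mult_smooth[OF assms] assms test1_iff by blast
  then show ?thesis using test1_borel[OF assms] test1_integrable
    by (fastforce simp: L2R_def power2_eq_square)
qed

lemma inner_L2_add_left: "L2R f \<Longrightarrow> L2R g \<Longrightarrow> L2R h \<Longrightarrow> inner_L2 (\<lambda>x. f x + g x) h = inner_L2 f h + inner_L2 g h"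
  unfolding inner_L2_def by (simp add: distrib_right L2R_mult)

lemma inner_L2_cmult_left: "inner_L2 (\<lambda>x. c * f x) h = c * inner_L2 f h"
  unfolding inner_L2_def by (simp add: mult.assoc)

lemma inner_L2_diff_left: "L2R f \<Longrightarrow> L2R g \<Longrightarrow> L2R h \<Longrightarrow> inner_L2 (\<lambda>x. f x - g x) h = inner_L2 f h - inner_L2 g h"
  unfolding inner_L2_def by (simp add: left_diff_distrib L2R_mult)

lemma normsq_add: "L2R f \<Longrightarrow> L2R g \<Longrightarrow> normsq (\<lambda>x. f x + g x) = normsq f + 2 * inner_L2 f g + normsq g"
  unfolding normsq_def inner_L2_def by (simp add: power2_sum L2R_mult L2R_int mult.assoc)

lemma normsq_diff: "L2R f \<Longrightarrow> L2R g \<Longrightarrow> normsq (\<lambda>x. f x - g x) = normsq f - 2 * inner_L2 f g + normsq g"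
  unfolding normsq_def inner_L2_def by (simp add: power2_diff L2R_mult L2R_int mult.assoc)

lemma normsq_cmult: "normsq (\<lambda>x. c * f x) = c\<^sup>2 * normsq f"
  unfolding normsq_def by (simp add: power_mult_distrib)

lemma normsq_add_le: "L2R f \<Longrightarrow> L2R g \<Longrightarrow> normsq (\<lambda>x. f x + g x) \<le> 2 * normsq f + 2 * normsq g"
  using normsq_add[of f g] normsq_diff[of f g] normsq_nonneg[of "\<lambda>x. f x - g x"] by linarith

lemma normsq_eq_0_iff: "L2R f \<Longrightarrow> normsq f = 0 \<longleftrightarrow> (AE x in lborel. f x = 0)"
  unfolding normsq_def by (subst integral_nonneg_eq_0_iff_AE) (auto simp: L2R_int)

lemma inner_L2_Cauchy_Schwarz: assumes "L2R f" "L2R g" shows "(inner_L2 f g)\<^sup>2 \<le> normsq f * normsq g"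
proof (cases "normsq g = 0")
  case True
  then have "AE x in lborel. f x * g x = 0" using assms normsq_eq_0_iff by (auto elim: eventually_mono)
  then have "inner_L2 f g = 0" unfolding inner_L2_def by (rule integral_eq_zero_AE)
  then show ?thesis using normsq_nonneg True by simp
next
  case False
  define t where "t = inner_L2 f g / normsq g"
  have "0 \<le> normsq (\<lambda>x. f x - t * g x)" by (rule normsq_nonneg)
  also have "\<dots> = normsq f - 2 * inner_L2 f (\<lambda>x. t * g x) + normsq (\<lambda>x. t * g x)"
    by (intro normsq_diff assms L2R_cmult)
  also have "\<dots> = normsq f - 2 * t * inner_L2 f g + t\<^sup>2 * normsq g"
    by (simp add: normsq_cmult inner_L2_commute[of f] inner_L2_cmult_left)
  also have "\<dots> = normsq f - (inner_L2 f g)\<^sup>2 / normsq g"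
    using False by (simp add: t_def field_simps power2_eq_square)
  finally show ?thesis using False normsq_nonneg[of g] by (simp add: field_simps)
qed

lemma inner_L2_abs_le: assumes "L2R f" "L2R g" shows "\<bar>inner_L2 f g\<bar> \<le> sqrt (normsq f) * sqrt (normsq g)"
  using inner_L2_Cauchy_Schwarz[OF assms] by (simp add: real_le_rsqrt real_sqrt_mult[symmetric])

lemma inner_L2_tendsto:
  assumes "\<And>n. L2R (f n)" "L2R g" "L2R h" "(\<lambda>n. normsq (\<lambda>x. f n x - g x)) \<longlonglongrightarrow> 0"
  shows "(\<lambda>n. inner_L2 (f n) h) \<longlonglongrightarrow> inner_L2 g h"
proof -
  have "(\<lambda>n. sqrt (normsq (\<lambda>x. f n x - g x)) * sqrt (normsq h)) \<longlonglongrightarrow> sqrt 0 * sqrt (normsq h)"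
    by (intro tendsto_intros assms)
  then have "(\<lambda>n. inner_L2 (f n) h - inner_L2 g h) \<longlonglongrightarrow> 0"
  proof (rule Lim_null_comparison[rotated, OF tendsto_eq_rhs])
    show "\<forall>\<^sub>F n in sequentially. norm (inner_L2 (f n) h - inner_L2 g h) \<le> sqrt (normsq (\<lambda>x. f n x - g x)) * sqrt (normsq h)"
      using inner_L2_abs_le[OF L2R_diff[OF assms(1,2)] assms(3)] inner_L2_diff_left[OF assms(1,2,3)] by simp
  qed simp
  then show ?thesis by (rule LIM_zero_cancel)
qed

lemma L2R_indicator_Icc: "L2R (\<lambda>x. indicator {a..b::real} x)"
  by (auto simp: L2R_def power2_eq_square indicator_inter_arith[symmetric] integrable_indicator_Icc)

lemma L2R_indicator_mult: "L2R f \<Longrightarrow> L2R (\<lambda>x. indicator {a..b::real} x * f x)"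
  by (rule L2R_bounded_mult[of _ _ 1]) (auto simp: indicator_def)

section \<open>Local L^2 norms and pointwise bounds\<close>

definition normsq_on :: "(real \<Rightarrow> real) \<Rightarrow> real \<Rightarrow> real \<Rightarrow> real" where
  "normsq_on f a b = normsq (\<lambda>x. indicator {a..b} x * f x)"

lemma normsq_on_le: assumes "L2R f" shows "normsq_on f a b \<le> normsq f"
  unfolding normsq_def normsq_on_def
  by (intro integral_mono L2R_int L2R_indicator_mult assms) (auto simp: indicator_def)

lemma normsq_on_mono: assumes "L2R f" "c \<le> a" "b \<le> d" shows "normsq_on f a b \<le> normsq_on f c d"
  unfolding normsq_def normsq_on_def using assms
  by (intro integral_mono L2R_int L2R_indicator_mult) (auto simp: indicator_def)

text \<open>Cauchy-Schwarz against the indicator of [a, b]. This is the source of the Hoelder-1/2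
  estimates used for equicontinuity and for pointwise bounds.\<close>

lemma prim_diff_sq_le:
  assumes "L2R f" "a \<le> b" shows "(prim f b - prim f a)\<^sup>2 \<le> (b - a) * normsq_on f a b"
proof -
  have "prim f b - prim f a = inner_L2 (\<lambda>x. indicator {a..b} x) (\<lambda>x. indicator {a..b} x * f x)"
    unfolding prim_diff[OF L2R_loc_int[OF assms(1)] assms(2)] inner_L2_def
    by (intro Bochner_Integration.integral_cong) (auto simp: indicator_def)
  moreover have "normsq (\<lambda>x. indicator {a..b} x) = b - a"
    using assms(2) unfolding normsq_def by (simp add: power2_eq_square indicator_inter_arith[symmetric])
  ultimately show ?thesis
    using inner_L2_Cauchy_Schwarz[OF L2R_indicator_Icc[of a b] L2R_indicator_mult[OF assms(1), of a b]]
    by (simp add: normsq_on_def)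
qed

text \<open>A local Sobolev inequality: f(x) is compared with f(y) for y in [x, x + 1], and the
  result is averaged over y. Keeping the norms on the window instead of the line later yields decay
  at infinity as well.\<close>

lemma sup_sq_le:
  assumes f: "L2R f" and f1: "L2R f1" and rep: "\<And>x. f x = c + prim f1 x"
  shows "(f x)\<^sup>2 \<le> 2 * normsq_on f x (x + 1) + 2 * normsq_on f1 x (x + 1)"
proof -
  have le: "(f x)\<^sup>2 \<le> 2 * (f y)\<^sup>2 + 2 * normsq_on f1 x (x + 1)" if "x \<le> y" "y \<le> x + 1" for y
  proof -
    have "(f y - f x)\<^sup>2 \<le> (y - x) * normsq_on f1 x y" using prim_diff_sq_le[OF f1 that(1)] rep by simp
    also have "\<dots> \<le> 1 * normsq_on f1 x (x + 1)"
      using that by (intro mult_mono normsq_on_mono f1) (auto simp: normsq_on_def normsq_nonneg)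
    finally have "(f y - f x)\<^sup>2 \<le> normsq_on f1 x (x + 1)" by simp
    moreover have "(f x)\<^sup>2 \<le> 2 * (f y)\<^sup>2 + 2 * (f y - f x)\<^sup>2"
      using zero_le_power2[of "2 * f y - f x"] by (simp add: power2_eq_square algebra_simps)
    ultimately show ?thesis by linarith
  qed
  have "(\<integral>y. (f x)\<^sup>2 * indicator {x..x+1} y \<partial>lborel)
     \<le> (\<integral>y. 2 * (indicator {x..x+1} y * f y)\<^sup>2 + 2 * normsq_on f1 x (x + 1) * indicator {x..x+1} y \<partial>lborel)"
    using le by (intro integral_mono Bochner_Integration.integrable_add integrable_mult_right
         L2R_int L2R_indicator_mult f integrable_mult_right integrable_indicator_Icc) (auto simp: indicator_def)
  also have "\<dots> = (\<integral>y. 2 * (indicator {x..x+1} y * f y)\<^sup>2 \<partial>lborel) + (\<integral>y. 2 * normsq_on f1 x (x + 1) * indicator {x..x+1} y \<partial>lborel)"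
    by (intro Bochner_Integration.integral_add integrable_mult_right
         L2R_int L2R_indicator_mult f integrable_indicator_Icc)
  finally show ?thesis by (simp add: normsq_on_def normsq_def)
qed

text \<open>Riesz-Fischer: a rapidly Cauchy subsequence converges almost everywhere, and Fatou's
  lemma upgrades this to convergence of the whole sequence in norm. Completeness is what turns a
  Cauchy minimising sequence into a minimiser.\<close>

lemma L2_complete:
  fixes f :: "nat \<Rightarrow> real \<Rightarrow> real"
  assumes f: "\<And>n. L2R (f n)"
    and Cauchy: "\<And>e. e > 0 \<Longrightarrow> \<exists>N. \<forall>m\<ge>N. \<forall>n\<ge>N. normsq (\<lambda>x. f m x - f n x) < e"
  obtains g where "L2R g" "(\<lambda>n. normsq (\<lambda>x. f n x - g x)) \<longlonglongrightarrow> 0"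
proof -
  have [measurable]: "\<And>n. f n \<in> borel_measurable borel" using f L2R_borel by blast
  have "\<exists>N. \<forall>k. (\<forall>m\<ge>N k. \<forall>n\<ge>N k. normsq (\<lambda>x. f m x - f n x) < (1/4)^k)"
    by (intro choice allI Cauchy) simp
  then obtain N where N: "\<And>k m n. m \<ge> N k \<Longrightarrow> n \<ge> N k \<Longrightarrow> normsq (\<lambda>x. f m x - f n x) < (1/4)^k" by blast
  \<comment> \<open>Summing the \<open>N i\<close> makes \<open>r\<close> monotone and at least
    \<open>N k\<close>; the extra \<open>k\<close> gives \<open>r k \<ge> k\<close>, so that tails
    of the sequence contain tails of the subsequence.\<close>
  define r where "r k = (\<Sum>i\<le>k. N i) + k" for k
  have rN: "N k \<le> r k" for k unfolding r_def by (simp add: trans_le_add1 member_le_sum)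
  have rmono: "r k \<le> r (Suc k)" for k unfolding r_def by simp
  have rk: "k \<le> r k" for k by (simp add: r_def)
  define g where "g k x = f (r (Suc k)) x - f (r k) x" for k x
  have g2: "L2R (g k)" for k unfolding g_def by (intro L2R_diff f)
  have [measurable]: "\<And>n. g n \<in> borel_measurable borel" using g2 L2R_borel by blast
  have gn: "normsq (g k) < (1/4)^k" for k
    unfolding g_def using N[of k "r (Suc k)" "r k"] rN[of k] rmono[of k] by auto
  have "(\<integral>\<^sup>+x. (\<Sum>k. ennreal (2^k * (g k x)\<^sup>2)) \<partial>lborel) = (\<Sum>k. \<integral>\<^sup>+x. ennreal (2^k * (g k x)\<^sup>2) \<partial>lborel)"
    by (intro nn_integral_suminf) auto
  also have "\<dots> = (\<Sum>k. ennreal (2^k * normsq (g k)))"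
  proof (intro suminf_cong)
    fix k
    have "(\<integral>\<^sup>+x. ennreal (2^k * (g k x)\<^sup>2) \<partial>lborel) = ennreal (\<integral>x. 2^k * (g k x)\<^sup>2 \<partial>lborel)"
      by (intro nn_integral_eq_integral integrable_mult_right L2R_int g2) auto
    then show "(\<integral>\<^sup>+x. ennreal (2^k * (g k x)\<^sup>2) \<partial>lborel) = ennreal (2^k * normsq (g k))" by (simp add: normsq_def)
  qed
  also have "\<dots> \<le> (\<Sum>k. ennreal ((1/2)^k))"
  proof (intro suminf_le ennreal_leI)
    fix k
    have "2^k * normsq (g k) \<le> 2^k * (1/4)^k" using gn[of k] by simp
    also have "\<dots> = (1/2 :: real)^k" by (simp add: power_mult_distrib[symmetric])
    finally show "2^k * normsq (g k) \<le> (1/2)^k" .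
  qed auto
  also have "\<dots> < \<infinity>"
    by (subst suminf_ennreal2) (auto simp: summable_geometric_iff)
  finally have "(\<integral>\<^sup>+x. (\<Sum>k. ennreal (2^k * (g k x)\<^sup>2)) \<partial>lborel) \<noteq> \<infinity>" by simp
  then have "AE x in lborel. (\<Sum>k. ennreal (2^k * (g k x)\<^sup>2)) \<noteq> \<infinity>"
    by (intro nn_integral_PInf_AE) auto
  then have conv: "AE x in lborel. convergent (\<lambda>k. f (r k) x)"
  proof eventually_elim
    case (elim x)
    have s: "summable (\<lambda>k. 2^k * (g k x)\<^sup>2)"
      using elim by (intro summable_suminf_not_top) auto
    \<comment> \<open>The weights 2^k convert control of squares into absolute convergence, since
      |g| \<le> 2^k g^2 + 2^(-k); against gaps below 4^(-k) they still leave a convergent series of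
      integrals.\<close>
    have "summable (\<lambda>k. 2^k * (g k x)\<^sup>2 + (1/2)^k)"
      by (intro summable_add s) (auto simp: summable_geometric_iff)
    then have "summable (\<lambda>k. g k x)"
    proof (rule summable_comparison_test[rotated])
      have "\<bar>g k x\<bar> \<le> 2^k * (g k x)\<^sup>2 + (1/2)^k" for k
      proof -
        have "0 \<le> (2^k * \<bar>g k x\<bar> - 1)\<^sup>2" by simp
        then have "2^k * (2 * \<bar>g k x\<bar>) \<le> 2^k * (2^k * (g k x)\<^sup>2 + (1/2)^k)"
          by (simp add: power2_eq_square algebra_simps power_one_over)
        then have "2 * \<bar>g k x\<bar> \<le> 2^k * (g k x)\<^sup>2 + (1/2)^k" by simp
        then show ?thesis using abs_ge_zero[of "g k x"] by linarith
      qed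
      then show "\<exists>N. \<forall>n\<ge>N. norm (g n x) \<le> 2^n * (g n x)\<^sup>2 + (1/2)^n" by simp
    qed
    then have "convergent (\<lambda>n. \<Sum>k<n. g k x)" by (simp add: summable_iff_convergent)
    moreover have "(\<Sum>k<n. g k x) = f (r n) x - f (r 0) x" for n
      unfolding g_def by (rule sum_lessThan_telescope)
    ultimately have "convergent (\<lambda>n. f (r n) x - f (r 0) x)" by simp
    from convergent_add[OF this convergent_const[of "f (r 0) x"]] show ?case by simp
  qed
  define G where "G x = lim (\<lambda>k. f (r k) x)" for x
  have [measurable]: "G \<in> borel_measurable borel" unfolding G_def by measurable
  have lim: "AE x in lborel. (\<lambda>k. f (r k) x) \<longlonglongrightarrow> G x"
    using conv by eventually_elim (simp add: G_def convergent_LIMSEQ_iff)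
  \<comment> \<open>Fatou along the subsequence: a bound on \<open>f m - f n\<close> for all large
    \<open>n\<close> passes to \<open>f m - G\<close>. With \<open>e\<close> and \<open>M\<close>
    free, the same fact gives both membership of \<open>G\<close> in L^2 and convergence.\<close>
  have bound: "integrable lborel (\<lambda>x. (f m x - G x)\<^sup>2) \<and> normsq (\<lambda>x. f m x - G x) \<le> e"
    if "e \<ge> 0" and e: "\<forall>n\<ge>M. normsq (\<lambda>x. f m x - f n x) \<le> e" for m M e
  proof -
    have "(\<integral>\<^sup>+x. ennreal ((f m x - G x)\<^sup>2) \<partial>lborel) = (\<integral>\<^sup>+x. liminf (\<lambda>k. ennreal ((f m x - f (r k) x)\<^sup>2)) \<partial>lborel)"
    proof (intro nn_integral_cong_AE)
      show "AE x in lborel. ennreal ((f m x - G x)\<^sup>2) = liminf (\<lambda>k. ennreal ((f m x - f (r k) x)\<^sup>2))"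
        using lim
      proof eventually_elim
        case (elim x)
        have "(\<lambda>k. ennreal ((f m x - f (r k) x)\<^sup>2)) \<longlonglongrightarrow> ennreal ((f m x - G x)\<^sup>2)"
          by (intro tendsto_intros elim)
        then show ?case by (rule lim_imp_Liminf[symmetric, rotated]) simp
      qed
    qed
    also have "\<dots> \<le> liminf (\<lambda>k. \<integral>\<^sup>+x. ennreal ((f m x - f (r k) x)\<^sup>2) \<partial>lborel)"
      by (intro nn_integral_liminf) auto
    also have "\<dots> = liminf (\<lambda>k. ennreal (normsq (\<lambda>x. f m x - f (r k) x)))"
      unfolding normsq_def by (simp add: nn_integral_eq_integral L2R_int L2R_diff f)
    also have "\<dots> \<le> liminf (\<lambda>k. ennreal e)"
    proof (intro Liminf_mono eventually_sequentiallyI[of M] ennreal_leI)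
      fix k assume "M \<le> k" then have "M \<le> r k" using rk[of k] by simp
      then show "normsq (\<lambda>x. f m x - f (r k) x) \<le> e" using e by blast
    qed
    also have "\<dots> = ennreal e" by (simp add: Liminf_const)
    finally have le: "(\<integral>\<^sup>+x. ennreal ((f m x - G x)\<^sup>2) \<partial>lborel) \<le> ennreal e" .
    then have i: "integrable lborel (\<lambda>x. (f m x - G x)\<^sup>2)"
      by (intro integrableI_bounded) (auto simp: le_less_trans)
    then show ?thesis using le \<open>e \<ge> 0\<close> by (simp add: normsq_def nn_integral_eq_integral)
  qed
  obtain N0 where N0: "\<forall>m\<ge>N0. \<forall>n\<ge>N0. normsq (\<lambda>x. f m x - f n x) < 1" using Cauchy[of 1] by auto
  have "L2R (\<lambda>x. f N0 x - G x)" using bound[of 1 N0 N0] N0 by (auto simp: L2R_def less_imp_le)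
  from L2R_diff[OF f this, of N0] have G2: "L2R G" by simp
  have "(\<lambda>n. normsq (\<lambda>x. f n x - G x)) \<longlonglongrightarrow> 0"
  proof (rule LIMSEQ_I)
    fix e :: real assume "e > 0"
    then obtain M where M: "\<forall>m\<ge>M. \<forall>n\<ge>M. normsq (\<lambda>x. f m x - f n x) < e/2" using Cauchy[of "e/2"] by auto
    have "normsq (\<lambda>x. f m x - G x) \<le> e/2" if "m \<ge> M" for m
      using bound[of "e/2" M m] M that \<open>e > 0\<close> by (auto simp: less_imp_le)
    then have "norm (normsq (\<lambda>x. f m x - G x) - 0) < e" if "m \<ge> M" for m
      using that \<open>e > 0\<close> normsq_nonneg[of "\<lambda>x. f m x - G x"] by fastforce
    then show "\<exists>no. \<forall>n\<ge>no. norm (normsq (\<lambda>x. f n x - G x) - 0) < e" by blast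
  qed
  then show thesis using G2 that by blast
qed

section \<open>Stability of weak derivatives\<close>

lemma weak_deriv_limit:
  assumes "\<And>n. L2R (f n)" "\<And>n. L2R (f1 n)" "L2R g" "L2R g1" "\<And>n. weak_deriv (f n) (f1 n)"
    and "(\<lambda>n. normsq (\<lambda>x. f n x - g x)) \<longlonglongrightarrow> 0" "(\<lambda>n. normsq (\<lambda>x. f1 n x - g1 x)) \<longlonglongrightarrow> 0"
  shows "weak_deriv g g1"
  unfolding weak_deriv_def
proof (intro allI impI)
  fix \<phi> assume \<phi>: "test1 \<phi>"
  have "(\<lambda>n. inner_L2 (f n) (deriv \<phi>)) \<longlonglongrightarrow> inner_L2 g (deriv \<phi>)"
    by (intro inner_L2_tendsto assms test1_L2R test1_deriv \<phi>)
  moreover have "(\<lambda>n. - inner_L2 (f1 n) \<phi>) \<longlonglongrightarrow> - inner_L2 g1 \<phi>"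
    by (intro tendsto_intros inner_L2_tendsto assms test1_L2R \<phi>)
  moreover have "inner_L2 (f n) (deriv \<phi>) = - inner_L2 (f1 n) \<phi>" for n
    using assms(5) \<phi> unfolding weak_deriv_def inner_L2_def by blast
  ultimately show "(\<integral>x. g x * deriv \<phi> x \<partial>lborel) = - (\<integral>x. g1 x * \<phi> x \<partial>lborel)"
    using LIMSEQ_unique unfolding inner_L2_def by force
qed

lemma weak_deriv_lincomb:
  assumes "L2R f" "L2R f1" "L2R g" "L2R g1" "weak_deriv f f1" "weak_deriv g g1"
  shows "weak_deriv (\<lambda>x. f x + c * g x) (\<lambda>x. f1 x + c * g1 x)"
  unfolding weak_deriv_def
proof (intro allI impI)
  fix \<phi> assume \<phi>: "test1 \<phi>"
  then have "inner_L2 f (deriv \<phi>) = - inner_L2 f1 \<phi>" "inner_L2 g (deriv \<phi>) = - inner_L2 g1 \<phi>"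
    using assms unfolding weak_deriv_def inner_L2_def by blast+
  then have "inner_L2 (\<lambda>x. f x + c * g x) (deriv \<phi>) = - inner_L2 (\<lambda>x. f1 x + c * g1 x) \<phi>"
    using assms \<phi> by (simp add: inner_L2_add_left inner_L2_cmult_left L2R_cmult test1_L2R test1_deriv algebra_simps)
  then show "(\<integral>x. (f x + c * g x) * deriv \<phi> x \<partial>lborel) = - (\<integral>x. (f1 x + c * g1 x) * \<phi> x \<partial>lborel)"
    by (simp add: inner_L2_def)
qed

lemma weak_deriv_cong_AE:
  assumes "weak_deriv f f1" "AE x in lborel. f x = g x" "AE x in lborel. f1 x = g1 x"
    "f \<in> borel_measurable borel" "g \<in> borel_measurable borel" "f1 \<in> borel_measurable borel" "g1 \<in> borel_measurable borel"
  shows "weak_deriv g g1"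
  unfolding weak_deriv_def
proof (intro allI impI)
  fix \<phi> assume \<phi>: "test1 \<phi>"
  have "(\<integral>x. g x * deriv \<phi> x \<partial>lborel) = (\<integral>x. f x * deriv \<phi> x \<partial>lborel)"
    using assms test1_borel[OF \<phi>] test1_borel[OF test1_deriv[OF \<phi>]]
    by (intro integral_cong_AE) (auto elim: eventually_mono)
  moreover have "(\<integral>x. g1 x * \<phi> x \<partial>lborel) = (\<integral>x. f1 x * \<phi> x \<partial>lborel)"
    using assms test1_borel[OF \<phi>] by (intro integral_cong_AE) (auto elim: eventually_mono)
  ultimately show "(\<integral>x. g x * deriv \<phi> x \<partial>lborel) = - (\<integral>x. g1 x * \<phi> x \<partial>lborel)"
    using assms(1) \<phi> unfolding weak_deriv_def by simp
qed

lemma H1R_D: assumes "H1R f f1" shows "L2R f" "L2R f1" "weak_deriv f f1"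
  using assms by (auto simp: H1R_def)

text \<open>Members of H^1 are fixed only up to null sets; the representative
  \<open>c + prim f1\<close> is continuous and is the one to which pointwise bounds and
  Arzela-Ascoli apply.\<close>

lemma H1R_rep:
  assumes "H1R f f1"
  obtains F c where "\<And>x. F x = c + prim f1 x" "AE x in lborel. f x = F x" "H1R F f1" "continuous_on UNIV F"
proof -
  note H = H1R_D[OF assms]
  obtain c where c: "AE x in lborel. f x = c + prim f1 x"
    using weak_deriv_imp_prim[OF L2R_loc_int[OF H(1)] L2R_loc_int[OF H(2)] H(3)] by blast
  define F where "F = (\<lambda>x. c + prim f1 x)"
  have F: "continuous_on UNIV F" unfolding F_def
    by (intro continuous_intros prim_continuous L2R_loc_int H)
  have "F \<in> borel_measurable borel" using F by (rule borel_measurable_continuous_onI)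
  moreover have ae: "AE x in lborel. f x = F x" using c by (simp add: F_def)
  ultimately have "H1R F f1" using H L2R_cong_AE[OF H(1)] weak_deriv_cong_AE[OF H(3) ae _ L2R_borel[OF H(1)]]
    L2R_borel[OF H(2)] by (auto simp: H1R_def)
  then show thesis using that[of F c] ae F by (simp add: F_def)
qed

lemma H1R_lincomb: "H1R f f1 \<Longrightarrow> H1R g g1 \<Longrightarrow> H1R (\<lambda>x. f x + c * g x) (\<lambda>x. f1 x + c * g1 x)"
  by (simp add: H1R_def L2R_add L2R_cmult weak_deriv_lincomb)

lemma H2R_lincomb: "H2R f f1 f2 \<Longrightarrow> H2R g g1 g2 \<Longrightarrow>
    H2R (\<lambda>x. f x + c * g x) (\<lambda>x. f1 x + c * g1 x) (\<lambda>x. f2 x + c * g2 x)"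
  by (simp add: H2R_def H1R_lincomb)

lemma DERIV_continuous_eq_prim:
  assumes "\<And>x. (f has_real_derivative f1 x) (at x)" "continuous_on UNIV f1"
  obtains c where "f = (\<lambda>x. c + prim f1 x)"
proof -
  have "((\<lambda>x. f x - prim f1 x) has_real_derivative 0) (at x)" for x
    using assms(1) prim_DERIV[OF assms(2)] by (auto intro!: derivative_eq_intros)
  then have "f x - prim f1 x = f 0 - prim f1 0" for x using DERIV_isconst_all by blast
  then have "f = (\<lambda>x. (f 0 - prim f1 0) + prim f1 x)" by (auto simp: algebra_simps)
  then show thesis using that by blast
qed

lemma weak_deriv_prim: assumes "loc_int f" shows "weak_deriv (\<lambda>x. c + prim f x) f"
  unfolding weak_deriv_def
proof (intro allI impI)
  fix \<phi> assume \<phi>: "test1 \<phi>"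
  have z: "(\<integral>x. deriv \<phi> x \<partial>lborel) = 0" by (rule integral_deriv_test1[OF \<phi>])
  have "(\<integral>x. (c + prim f x) * deriv \<phi> x \<partial>lborel) = (\<integral>x. c * deriv \<phi> x + prim f x * deriv \<phi> x \<partial>lborel)"
    by (simp add: distrib_right)
  also have "\<dots> = (\<integral>x. c * deriv \<phi> x \<partial>lborel) + (\<integral>x. prim f x * deriv \<phi> x \<partial>lborel)"
    by (intro Bochner_Integration.integral_add integrable_mult_right test1_integrable test1_deriv \<phi>
        loc_int_mult_test1 prim_loc_int assms)
  finally show "(\<integral>x. (c + prim f x) * deriv \<phi> x \<partial>lborel) = - (\<integral>x. f x * \<phi> x \<partial>lborel)"
    using z integral_prim_test1[OF assms \<phi>] by simp
qed

lemma weak_deriv_DERIV: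
  assumes "\<And>x. (f has_real_derivative f1 x) (at x)" "continuous_on UNIV f1"
  shows "weak_deriv f f1"
  using DERIV_continuous_eq_prim[OF assms] weak_deriv_prim[OF loc_int_continuous[OF assms(2)]] by metis

lemma test1_H2R: assumes "test1 \<phi>" shows "H2R \<phi> (deriv \<phi>) (deriv (deriv \<phi>))"
proof -
  have "H1R \<phi> (deriv \<phi>)" if "test1 \<phi>" for \<phi>
    using that test1_L2R test1_deriv[OF that] test1_iff smooth1_DERIV smooth1_continuous
    by (auto simp: H1R_def intro!: weak_deriv_DERIV)
  then show ?thesis using assms test1_deriv by (auto simp: H2R_def)
qed

section \<open>Minimisers of the quadratic form\<close>

definition wprod :: "(real \<Rightarrow> real) \<Rightarrow> (real \<Rightarrow> real) \<Rightarrow> (real \<Rightarrow> real) \<Rightarrow> real" where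
  "wprod w f g = (\<integral>x. w x * f x * g x \<partial>lborel)"

definition bdd_meas :: "(real \<Rightarrow> real) \<Rightarrow> bool" where
  "bdd_meas w \<longleftrightarrow> w \<in> borel_measurable borel \<and> (\<exists>C. \<forall>x. \<bar>w x\<bar> \<le> C)"

lemma bdd_meas_L2R: "bdd_meas w \<Longrightarrow> L2R f \<Longrightarrow> L2R (\<lambda>x. w x * f x)"
  unfolding bdd_meas_def using L2R_bounded_mult by blast

lemma bdd_meas_const: "bdd_meas (\<lambda>x. c)"
  unfolding bdd_meas_def by auto

lemma bdd_meas_integrable: "bdd_meas w \<Longrightarrow> L2R f \<Longrightarrow> L2R g \<Longrightarrow> integrable lborel (\<lambda>x. w x * f x * g x)"
  using L2R_mult[OF bdd_meas_L2R] by blast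

lemma wprod_expand:
  assumes "bdd_meas w" "L2R f" "L2R g"
  shows "wprod w (\<lambda>x. f x + t * g x) (\<lambda>x. f x + t * g x) = wprod w f f + 2 * t * wprod w f g + t\<^sup>2 * wprod w g g"
proof -
  note i = bdd_meas_integrable[OF assms(1)]
  have "wprod w (\<lambda>x. f x + t * g x) (\<lambda>x. f x + t * g x)
    = (\<integral>x. w x * f x * f x + 2 * t * (w x * f x * g x) + t\<^sup>2 * (w x * g x * g x) \<partial>lborel)"
    unfolding wprod_def by (intro Bochner_Integration.integral_cong) (auto simp: power2_eq_square algebra_simps)
  also have "\<dots> = wprod w f f + 2 * t * wprod w f g + t\<^sup>2 * wprod w g g"
    unfolding wprod_def using i[OF assms(2,2)] i[OF assms(2,3)] i[OF assms(3,3)] by simp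
  finally show ?thesis .
qed

lemma wprod_le: assumes "bdd_meas w" "L2R f" "\<And>x. w x \<le> C" shows "wprod w f f \<le> C * normsq f"
proof -
  have "w x * f x * f x \<le> C * (f x)\<^sup>2" for x
    using mult_right_mono[OF assms(3) zero_le_power2[of "f x"], of x] by (simp add: power2_eq_square mult.assoc)
  then have "wprod w f f \<le> (\<integral>x. C * (f x)\<^sup>2 \<partial>lborel)"
    unfolding wprod_def by (intro integral_mono bdd_meas_integrable assms integrable_mult_right L2R_int) auto
  then show ?thesis by (simp add: normsq_def)
qed

lemma wprod_uminus: "wprod (\<lambda>x. - w x) f g = - wprod w f g"
  unfolding wprod_def by simp

lemma bdd_meas_uminus: "bdd_meas w \<Longrightarrow> bdd_meas (\<lambda>x. - w x)"
  unfolding bdd_meas_def by auto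

lemma wprod_ge: assumes "bdd_meas w" "L2R f" "\<And>x. C \<le> w x" shows "C * normsq f \<le> wprod w f f"
  using wprod_le[OF bdd_meas_uminus[OF assms(1)] assms(2), of "-C"] assms(3) by (simp add: wprod_uminus)

lemma wprod_cong_AE:
  assumes "w \<in> borel_measurable borel" "f \<in> borel_measurable borel" "g \<in> borel_measurable borel"
    "f' \<in> borel_measurable borel" "g' \<in> borel_measurable borel" "AE x in lborel. f x = f' x" "AE x in lborel. g x = g' x"
  shows "wprod w f g = wprod w f' g'"
  unfolding wprod_def using assms(1-5)
  by (intro integral_cong_AE) (use assms(6,7) in \<open>auto elim: eventually_elim2\<close>)

lemma normsq_shift_bound: "L2R f \<Longrightarrow> L2R g \<Longrightarrow> normsq g \<le> 2 * normsq (\<lambda>x. k * f x + g x) + 2 * k\<^sup>2 * normsq f"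
  using normsq_add_le[OF L2R_add[OF L2R_cmult[of f k], of g] L2R_cmult[of f "-k"]] normsq_cmult[of "-k" f] by simp

text \<open>The abstract type of the form: \<open>a\<close> and \<open>b\<close> are bounded below
  by positive constants and \<open>p\<close> lives in [-R, R]. The weight \<open>c\<close> of the
  second derivative may be 0, as happens for the horizontal field; control of the second derivative
  comes from the viscous term with factor \<open>e\<close> > 0.\<close>

locale quad_form =
  fixes a b p :: "real \<Rightarrow> real" and c e k a0 b0 R :: real
  assumes a: "bdd_meas a" "\<And>x. a0 \<le> a x" "0 < a0"
    and b: "bdd_meas b" "\<And>x. b0 \<le> b x" "0 < b0"
    and p: "bdd_meas p" "\<And>x. \<bar>x\<bar> > R \<Longrightarrow> p x = 0" and R: "0 < R"
    and c: "0 \<le> c" and e: "0 < e"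
begin

definition B :: "(real \<Rightarrow> real) \<Rightarrow> (real \<Rightarrow> real) \<Rightarrow> (real \<Rightarrow> real) \<Rightarrow> (real \<Rightarrow> real) \<Rightarrow> (real \<Rightarrow> real) \<Rightarrow> (real \<Rightarrow> real) \<Rightarrow> real" where
  "B u u1 u2 v v1 v2 = wprod a u v + wprod b u1 v1 + c * wprod (\<lambda>x. 1) u2 v2
     + e * wprod (\<lambda>x. 1) (\<lambda>x. k\<^sup>2 * u x + u2 x) (\<lambda>x. k\<^sup>2 * v x + v2 x) - wprod p u v"

abbreviation B1 where "B1 u u1 u2 \<equiv> B u u1 u2 u u1 u2"

lemma B_expand:
  assumes "L2R u" "L2R u1" "L2R u2" "L2R v" "L2R v1" "L2R v2"
  shows "B1 (\<lambda>x. u x + t * v x) (\<lambda>x. u1 x + t * v1 x) (\<lambda>x. u2 x + t * v2 x)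
      = B1 u u1 u2 + 2 * t * B u u1 u2 v v1 v2 + t\<^sup>2 * B1 v v1 v2"
proof -
  define U V where "U = (\<lambda>x. k\<^sup>2 * u x + u2 x)" and "V = (\<lambda>x. k\<^sup>2 * v x + v2 x)"
  have UV: "L2R U" "L2R V" unfolding U_def V_def by (intro L2R_add L2R_cmult assms)+
  have eq: "(\<lambda>x. k\<^sup>2 * (u x + t * v x) + (u2 x + t * v2 x)) = (\<lambda>x. U x + t * V x)"
    by (auto simp: U_def V_def algebra_simps)
  show ?thesis unfolding B_def eq U_def[symmetric] V_def[symmetric]
      wprod_expand[OF a(1) assms(1,4)] wprod_expand[OF b(1) assms(2,5)] wprod_expand[OF p(1) assms(1,4)]
      wprod_expand[OF bdd_meas_const assms(3,6)] wprod_expand[OF bdd_meas_const UV]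
    by algebra
qed

lemma B_parallelogram:
  assumes "L2R u" "L2R u1" "L2R u2" "L2R v" "L2R v1" "L2R v2"
  shows "B1 (\<lambda>x. u x + v x) (\<lambda>x. u1 x + v1 x) (\<lambda>x. u2 x + v2 x)
       + B1 (\<lambda>x. u x - v x) (\<lambda>x. u1 x - v1 x) (\<lambda>x. u2 x - v2 x) = 2 * B1 u u1 u2 + 2 * B1 v v1 v2"
  using B_expand[OF assms, of 1] B_expand[OF assms, of "-1"] by simp

text \<open>Without the potential term every summand is nonnegative and so bounded by the total:
  \<open>a0\<close> controls u, \<open>b0\<close> controls u', and \<open>e\<close> controls k^2 u +
  u''. The triangle inequality then recovers u'' from the last and the first.\<close>

lemma coercive:
  obtains \<kappa> where "\<kappa> > 0" "\<And>u u1 u2. L2R u \<Longrightarrow> L2R u1 \<Longrightarrow> L2R u2 \<Longrightarrow>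
    normsq u + normsq u1 + normsq u2 \<le> \<kappa> * (B1 u u1 u2 + wprod p u u)"
proof
  define \<kappa> where "\<kappa> = 1 / a0 + 1 / b0 + 2 / e + 2 * (k\<^sup>2)\<^sup>2 / a0"
  show "\<kappa> > 0" unfolding \<kappa>_def using a b e by (intro add_pos_nonneg add_pos_pos) auto
  fix u u1 u2 assume L: "L2R u" "L2R u1" "L2R u2"
  define Q where "Q = B1 u u1 u2 + wprod p u u"
  have w1: "wprod (\<lambda>x. 1) f f = normsq f" for f by (simp add: wprod_def normsq_def power2_eq_square)
  have Q: "Q = wprod a u u + wprod b u1 u1 + c * normsq u2 + e * normsq (\<lambda>x. k\<^sup>2 * u x + u2 x)"
    by (simp add: Q_def B_def w1)
  have au: "a0 * normsq u \<le> wprod a u u" by (intro wprod_ge a L)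
  have bu: "b0 * normsq u1 \<le> wprod b u1 u1" by (intro wprod_ge b L)
  have pos: "0 \<le> a0 * normsq u" "0 \<le> b0 * normsq u1" "0 \<le> c * normsq u2" "0 \<le> e * normsq (\<lambda>x. k\<^sup>2 * u x + u2 x)"
    using a b c e normsq_nonneg by (auto intro!: mult_nonneg_nonneg)
  have 1: "normsq u \<le> Q / a0" using au bu pos a(3) Q by (simp add: field_simps)
  have 2: "normsq u1 \<le> Q / b0" using au bu pos b(3) Q by (simp add: field_simps)
  have 3: "normsq (\<lambda>x. k\<^sup>2 * u x + u2 x) \<le> Q / e" using au bu pos e Q by (simp add: field_simps)
  have "normsq u2 \<le> 2 * normsq (\<lambda>x. k\<^sup>2 * u x + u2 x) + 2 * (k\<^sup>2)\<^sup>2 * normsq u"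
    by (intro normsq_shift_bound L)
  also have "\<dots> \<le> 2 * (Q / e) + 2 * (k\<^sup>2)\<^sup>2 * (Q / a0)"
    using 1 3 by (intro add_mono mult_left_mono) auto
  finally have "normsq u + normsq u1 + normsq u2 \<le> Q / a0 + Q / b0 + (2 * (Q / e) + 2 * (k\<^sup>2)\<^sup>2 * (Q / a0))"
    using 1 2 by linarith
  also have "\<dots> = \<kappa> * Q" by (simp add: \<kappa>_def algebra_simps)
  finally show "normsq u + normsq u1 + normsq u2 \<le> \<kappa> * (B1 u u1 u2 + wprod p u u)" by (simp add: Q_def)
qed

lemma bounded_form:
  obtains C where "C > 0" "\<And>u u1 u2. L2R u \<Longrightarrow> L2R u1 \<Longrightarrow> L2R u2 \<Longrightarrow>
    B1 u u1 u2 \<le> C * (normsq u + normsq u1 + normsq u2)"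
proof -
  obtain Ca Cb Cp where C: "\<And>x. \<bar>a x\<bar> \<le> Ca" "\<And>x. \<bar>b x\<bar> \<le> Cb" "\<And>x. \<bar>p x\<bar> \<le> Cp"
    using a b p unfolding bdd_meas_def by blast
  have growth_bd: "0 \<le> Ca" "0 \<le> Cb" "0 \<le> Cp" using C[of 0] by auto
  define C where "C = 1 + Ca + Cb + c + e * (2 * (k\<^sup>2)\<^sup>2 + 2) + Cp"
  have e0: "0 \<le> e * (2 * (k\<^sup>2)\<^sup>2 + 2)" using e by simp
  have "C > 0" unfolding C_def using growth_bd c e0 by simp
  moreover have "B1 u u1 u2 \<le> C * (normsq u + normsq u1 + normsq u2)" if L: "L2R u" "L2R u1" "L2R u2" for u u1 u2
  proof -
    define N where "N = normsq u + normsq u1 + normsq u2"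
    have N: "normsq u \<le> N" "normsq u1 \<le> N" "normsq u2 \<le> N" "0 \<le> N"
      unfolding N_def using normsq_nonneg[of u] normsq_nonneg[of u1] normsq_nonneg[of u2] by auto
    have w1: "wprod (\<lambda>x. 1) f f = normsq f" for f by (simp add: wprod_def normsq_def power2_eq_square)
    have C': "a x \<le> Ca" "b x \<le> Cb" for x using C(1,2)[of x] by linarith+
    have "wprod a u u \<le> Ca * normsq u" using C' by (intro wprod_le a L) auto
    also have "\<dots> \<le> Ca * N" using N growth_bd by (intro mult_left_mono) auto
    finally have 1: "wprod a u u \<le> Ca * N" .
    have "wprod b u1 u1 \<le> Cb * normsq u1" using C' by (intro wprod_le b L) auto
    also have "\<dots> \<le> Cb * N" using N growth_bd by (intro mult_left_mono) auto
    finally have 2: "wprod b u1 u1 \<le> Cb * N" .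
    have 3: "c * normsq u2 \<le> c * N" using N c by (intro mult_left_mono) auto
    have "normsq (\<lambda>x. k\<^sup>2 * u x + u2 x) \<le> 2 * normsq (\<lambda>x. k\<^sup>2 * u x) + 2 * normsq u2"
      by (intro normsq_add_le L L2R_cmult)
    also have "\<dots> = 2 * (k\<^sup>2)\<^sup>2 * normsq u + 2 * normsq u2" by (simp add: normsq_cmult)
    also have "\<dots> \<le> 2 * (k\<^sup>2)\<^sup>2 * N + 2 * N" using N by (intro add_mono mult_left_mono) auto
    finally have 4: "e * normsq (\<lambda>x. k\<^sup>2 * u x + u2 x) \<le> e * ((2 * (k\<^sup>2)\<^sup>2 + 2) * N)"
      using e by (intro mult_left_mono) (auto simp: algebra_simps)
    have "-p x \<le> Cp" for x using C(3)[of x] by (simp add: abs_le_iff)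
    then have "wprod (\<lambda>x. - p x) u u \<le> Cp * normsq u" by (intro wprod_le bdd_meas_uminus p L)
    also have "\<dots> \<le> Cp * N" using N growth_bd by (intro mult_left_mono) auto
    finally have 5: "- wprod p u u \<le> Cp * N" by (simp add: wprod_uminus)
    have "B1 u u1 u2 \<le> Ca * N + Cb * N + c * N + e * ((2 * (k\<^sup>2)\<^sup>2 + 2) * N) + Cp * N + 1 * N"
      unfolding B_def w1 using 1 2 3 4 5 N(4) by linarith
    also have "\<dots> = C * N" by (simp add: C_def algebra_simps)
    finally show ?thesis by (simp add: N_def)
  qed
  ultimately show thesis using that by blast
qed

text \<open>Here the compact support of \<open>p\<close> enters: the potential term only sees
  [-R, R], so uniform smallness there makes it small whatever happens at infinity.\<close>

lemma wprod_p_le_sup: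
  assumes "L2R f" and s: "AE x in lborel. \<bar>x\<bar> \<le> R \<longrightarrow> \<bar>f x\<bar> \<le> s" and "\<And>x. \<bar>p x\<bar> \<le> Cp"
  shows "wprod p f f \<le> Cp * s\<^sup>2 * (2 * R)"
proof -
  have Cp: "0 \<le> Cp" using assms(3)[of 0] by simp
  have "wprod p f f \<le> (\<integral>x. Cp * s\<^sup>2 * indicator {-R..R} x \<partial>lborel)"
    unfolding wprod_def
  proof (intro integral_mono_AE)
    show "integrable lborel (\<lambda>x. p x * f x * f x)" by (intro bdd_meas_integrable p assms)
    show "integrable lborel (\<lambda>x. Cp * s\<^sup>2 * indicator {-R..R} x)"
      by (intro integrable_mult_right integrable_indicator_Icc)
    show "AE x in lborel. p x * f x * f x \<le> Cp * s\<^sup>2 * indicator {-R..R} x"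
      using s
    proof eventually_elim
      case (elim x)
      show ?case
      proof (cases "\<bar>x\<bar> \<le> R")
        case True
        then have "(f x)\<^sup>2 \<le> s\<^sup>2" using elim by (simp add: abs_le_square_iff[symmetric] order_trans[OF _ abs_ge_self])
        have "p x * f x * f x \<le> Cp * (f x)\<^sup>2" using assms(3)[of x]
          by (simp add: power2_eq_square mult.assoc mult_right_mono)
        also have "\<dots> \<le> Cp * s\<^sup>2" using \<open>(f x)\<^sup>2 \<le> s\<^sup>2\<close> Cp by (rule mult_left_mono)
        finally show ?thesis using True by (auto simp: indicator_def)
      qed (auto simp: p indicator_def)
    qed
  qed
  also have "\<dots> = Cp * s\<^sup>2 * (2 * R)" using R by simp
  finally show ?thesis .
qed

text \<open>Only u and u' are bounded a priori; the second derivatives are recovered from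
  coercivity. The bound \<open>K\<close> gives equicontinuity, while the lower bound \<delta> passes
  to the limit and excludes the zero function. Both stand in for the normalisation of the admissible
  set, so the limit need not be shown to be admissible.\<close>

lemma minimiser_exists:
  assumes nonneg: "\<And>u u1 u2. H2R u u1 u2 \<Longrightarrow> 0 \<le> B1 u u1 u2"
    and H2: "\<And>n. H2R (u n) (u1 n) (u2 n)"
    and bd: "\<And>n. normsq (u n) + normsq (u1 n) \<le> K"
    and lower: "\<And>n. \<delta> \<le> normsq (u n) + normsq (u1 n)" and \<delta>: "\<delta> > 0"
    and lim: "(\<lambda>n. B1 (u n) (u1 n) (u2 n)) \<longlonglongrightarrow> 0"
  obtains v v1 v2 where "H2R v v1 v2" "B1 v v1 v2 = 0" "normsq v + normsq v1 > 0"
proof -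
  have L: "L2R (u n)" "L2R (u1 n)" "L2R (u2 n)" for n using H2[of n] by (auto simp: H2R_def H1R_def)
  have K0: "0 \<le> K" using bd[of 0] normsq_nonneg[of "u 0"] normsq_nonneg[of "u1 0"] by linarith
  have "\<exists>F. (\<exists>c. \<forall>x. F x = c + prim (u1 n) x) \<and> (AE x in lborel. u n x = F x) \<and> H1R F (u1 n)" for n
    using H1R_rep[of "u n" "u1 n"] H2[of n] unfolding H2R_def by metis
  then have "\<exists>F. \<forall>n. (\<exists>c. \<forall>x. F n x = c + prim (u1 n) x) \<and> (AE x in lborel. u n x = F n x) \<and> H1R (F n) (u1 n)"
    by (intro choice) blast
  then obtain F where F: "\<And>n. \<exists>c. \<forall>x. F n x = c + prim (u1 n) x" "\<And>n. AE x in lborel. u n x = F n x"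
    "\<And>n. H1R (F n) (u1 n)" by blast
  have FL: "L2R (F n)" for n using F(3) H1R_def by blast
  have nF: "normsq (F n) = normsq (u n)" for n
    unfolding normsq_def using F(2)[of n] L2R_borel[OF FL[of n]] L2R_borel[OF L(1)[of n]]
    by (intro integral_cong_AE) (auto elim: eventually_mono)
  have bound: "\<bar>F n x\<bar> \<le> sqrt (2 * K)" for n x
  proof -
    obtain c where c: "\<And>x. F n x = c + prim (u1 n) x" using F(1) by blast
    have "(F n x)\<^sup>2 \<le> 2 * normsq_on (F n) x (x + 1) + 2 * normsq_on (u1 n) x (x + 1)"
      by (rule sup_sq_le[OF FL L(2) c])
    also have "\<dots> \<le> 2 * normsq (F n) + 2 * normsq (u1 n)"
      using normsq_on_le[OF FL] normsq_on_le[OF L(2)] by (intro add_mono mult_left_mono) auto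
    also have "\<dots> \<le> 2 * K" using bd[of n] nF by simp
    finally show ?thesis by (simp add: real_le_rsqrt)
  qed
  have Hoelder: "\<bar>F n x - F n y\<bar> \<le> sqrt (\<bar>x - y\<bar> * K)" for n x y
  proof -
    obtain c where c: "\<And>x. F n x = c + prim (u1 n) x" using F(1) by blast
    have *: "(F n x - F n y)\<^sup>2 \<le> \<bar>x - y\<bar> * K" if "x \<le> y" for x y
    proof -
      have "(F n x - F n y)\<^sup>2 = (prim (u1 n) y - prim (u1 n) x)\<^sup>2" using c by (simp add: power2_commute)
      also have "\<dots> \<le> (y - x) * normsq_on (u1 n) x y" by (rule prim_diff_sq_le[OF L(2) that])
      also have "\<dots> \<le> (y - x) * K"
        using that normsq_on_le[OF L(2)[of n], of x y] bd[of n] normsq_nonneg[of "u n"] by (intro mult_left_mono) linarith+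
      finally show ?thesis using that by simp
    qed
    have "(F n x - F n y)\<^sup>2 \<le> \<bar>x - y\<bar> * K"
      using *[of x y] *[of y x] by (cases "x \<le> y") (auto simp: power2_commute abs_minus_commute)
    then show ?thesis by (simp add: real_le_rsqrt)
  qed
  obtain g r where r: "strict_mono (r :: nat \<Rightarrow> nat)"
    and unif: "\<And>e. 0 < e \<Longrightarrow> \<exists>N. \<forall>n x. n \<ge> N \<and> x \<in> {-R..R} \<longrightarrow> norm (F (r n) x - g x) < e"
  proof (rule Arzela_Ascoli[of "{-R..R}" F "sqrt (2 * K)"])
    fix x e :: real assume "x \<in> {-R..R}" "0 < e"
    \<comment> \<open>The modulus of continuity at distance d is sqrt (d K); adding 1 avoids a
      division by zero and makes the bound strict.\<close>
    define d where "d = e\<^sup>2 / (K + 1)"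
    have "d > 0" unfolding d_def using \<open>0 < e\<close> K0 by simp
    moreover have "norm (F n x - F n y) < e" if "norm (x - y) < d" for n y
    proof -
      have "\<bar>x - y\<bar> * K \<le> \<bar>x - y\<bar> * (K + 1)" by (intro mult_left_mono) auto
      also have "\<dots> < d * (K + 1)" using that K0 by (intro mult_strict_right_mono) auto
      also have "\<dots> = e\<^sup>2" using K0 by (simp add: d_def)
      finally have "sqrt (\<bar>x - y\<bar> * K) < e" using \<open>0 < e\<close> by (simp add: real_less_lsqrt K0)
      then show ?thesis using Hoelder[of n x y] by simp
    qed
    ultimately show "\<exists>d>0. \<forall>n y. y \<in> {-R..R} \<and> norm (x - y) < d \<longrightarrow> norm (F n x - F n y) < e" by blast
  qed (use bound in auto)
  obtain \<kappa> where \<kappa>: "\<kappa> > 0" "\<And>u u1 u2. L2R u \<Longrightarrow> L2R u1 \<Longrightarrow> L2R u2 \<Longrightarrow>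
    normsq u + normsq u1 + normsq u2 \<le> \<kappa> * (B1 u u1 u2 + wprod p u u)" using coercive by blast
  obtain C where C: "C > 0" "\<And>u u1 u2. L2R u \<Longrightarrow> L2R u1 \<Longrightarrow> L2R u2 \<Longrightarrow>
    B1 u u1 u2 \<le> C * (normsq u + normsq u1 + normsq u2)" using bounded_form by blast
  obtain Cp where Cp: "\<And>x. \<bar>p x\<bar> \<le> Cp" using p unfolding bdd_meas_def by blast
  then have Cp0: "0 \<le> Cp" by (meson abs_ge_zero order_trans)
  define w w1 w2 where "w n = u (r n)" and "w1 n = u1 (r n)" and "w2 n = u2 (r n)" for n
  have wL: "L2R (w n)" "L2R (w1 n)" "L2R (w2 n)" for n using L by (auto simp: w_def w1_def w2_def)
  have wH: "H2R (w n) (w1 n) (w2 n)" for n using H2 by (simp add: w_def w1_def w2_def)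
  have wlim: "(\<lambda>n. B1 (w n) (w1 n) (w2 n)) \<longlonglongrightarrow> 0"
    using LIMSEQ_subseq_LIMSEQ[OF lim r] by (simp add: o_def w_def w1_def w2_def)
  have HC: "H2R (\<lambda>x. u x + v x) (\<lambda>x. u1 x + v1 x) (\<lambda>x. u2 x + v2 x)"
    "H2R (\<lambda>x. u x - v x) (\<lambda>x. u1 x - v1 x) (\<lambda>x. u2 x - v2 x)"
    if "H2R u u1 u2" "H2R v v1 v2" for u u1 u2 v v1 v2
    using H2R_lincomb[OF that, of 1] H2R_lincomb[OF that, of "-1"] by auto
  have Cauchy: "\<exists>N. \<forall>m\<ge>N. \<forall>n\<ge>N. normsq (\<lambda>x. w m x - w n x) + normsq (\<lambda>x. w1 m x - w1 n x) + normsq (\<lambda>x. w2 m x - w2 n x) < d"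
    if "d > 0" for d
  proof -
    \<comment> \<open>The tolerance \<open>d\<close> is split in half: with this \<open>s\<close>
      the potential term contributes at most d/2 after multiplication by \<kappa>, and the two
      values of \<open>B1\<close>, each below d/(8 \<kappa>) and counted twice, contribute the other
      half. \<open>Cp + 1\<close> keeps the denominator positive.\<close>
    define s where "s = sqrt (d / (2 * \<kappa> * (Cp + 1) * (2 * R)))"
    have s0: "s > 0" and s2: "\<kappa> * ((Cp + 1) * s\<^sup>2 * (2 * R)) = d / 2"
      using \<open>d > 0\<close> \<kappa>(1) Cp0 R by (auto simp: s_def)
    obtain N1 where N1: "\<And>n x. n \<ge> N1 \<Longrightarrow> x \<in> {-R..R} \<Longrightarrow> norm (F (r n) x - g x) < s / 2"
      using unif[of "s/2"] s0 by auto
    obtain N2 where N2: "\<And>n. n \<ge> N2 \<Longrightarrow> B1 (w n) (w1 n) (w2 n) < d / (8 * \<kappa>)"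
      using LIMSEQ_D[OF wlim, of "d / (8 * \<kappa>)"] \<open>d > 0\<close> \<kappa>(1) by force
    have "normsq (\<lambda>x. w m x - w n x) + normsq (\<lambda>x. w1 m x - w1 n x) + normsq (\<lambda>x. w2 m x - w2 n x) < d"
      if mn: "m \<ge> max N1 N2" "n \<ge> max N1 N2" for m n
    proof -
      let ?d = "\<lambda>x. w m x - w n x" let ?d1 = "\<lambda>x. w1 m x - w1 n x" let ?d2 = "\<lambda>x. w2 m x - w2 n x"
      have "wprod p ?d ?d \<le> Cp * s\<^sup>2 * (2 * R)"
      proof (intro wprod_p_le_sup L2R_diff wL Cp)
        have "AE x in lborel. u (r m) x = F (r m) x" "AE x in lborel. u (r n) x = F (r n) x" using F(2) by auto
        then show "AE x in lborel. \<bar>x\<bar> \<le> R \<longrightarrow> \<bar>w m x - w n x\<bar> \<le> s"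
        proof eventually_elim
          case (elim x)
          show ?case
          proof
            assume "\<bar>x\<bar> \<le> R"
            then have "x \<in> {-R..R}" by auto
            then have "\<bar>F (r m) x - g x\<bar> < s / 2" "\<bar>F (r n) x - g x\<bar> < s / 2"
              using N1[of m x] N1[of n x] mn by (simp_all del: atLeastAtMost_iff)
            then show "\<bar>w m x - w n x\<bar> \<le> s" using elim unfolding w_def by linarith
          qed
        qed
      qed
      also have "\<dots> \<le> (Cp + 1) * s\<^sup>2 * (2 * R)" using R by (intro mult_right_mono) auto
      finally have 1: "wprod p ?d ?d \<le> (Cp + 1) * s\<^sup>2 * (2 * R)" .
      have "0 \<le> B1 (\<lambda>x. w m x + w n x) (\<lambda>x. w1 m x + w1 n x) (\<lambda>x. w2 m x + w2 n x)"
        by (intro nonneg HC wH)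
      then have 2: "B1 ?d ?d1 ?d2 \<le> 2 * B1 (w m) (w1 m) (w2 m) + 2 * B1 (w n) (w1 n) (w2 n)"
        using B_parallelogram[OF wL(1,2,3)[of m] wL(1,2,3)[of n]] by linarith
      have "normsq ?d + normsq ?d1 + normsq ?d2 \<le> \<kappa> * (B1 ?d ?d1 ?d2 + wprod p ?d ?d)"
        by (intro \<kappa>(2) L2R_diff wL)
      also have "\<dots> < \<kappa> * (2 * (d / (8 * \<kappa>)) + 2 * (d / (8 * \<kappa>)) + (Cp + 1) * s\<^sup>2 * (2 * R))"
        using 1 2 N2[of m] N2[of n] mn \<kappa>(1) by (intro mult_strict_left_mono) auto
      also have "\<dots> = d" using s2 \<kappa>(1) by (simp add: distrib_left)
      finally show ?thesis .
    qed
    then show ?thesis by blast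
  qed
  have Cauchy': "\<exists>N. \<forall>m\<ge>N. \<forall>n\<ge>N. normsq (\<lambda>x. w m x - w n x) < d" "\<exists>N. \<forall>m\<ge>N. \<forall>n\<ge>N. normsq (\<lambda>x. w1 m x - w1 n x) < d"
     "\<exists>N. \<forall>m\<ge>N. \<forall>n\<ge>N. normsq (\<lambda>x. w2 m x - w2 n x) < d" if d: "d > 0" for d
  proof -
    obtain N where N: "\<And>m n. m \<ge> N \<Longrightarrow> n \<ge> N \<Longrightarrow> normsq (\<lambda>x. w m x - w n x) + normsq (\<lambda>x. w1 m x - w1 n x) + normsq (\<lambda>x. w2 m x - w2 n x) < d"
      using Cauchy[OF d] by blast
    have le: "normsq f \<le> normsq f + normsq g + normsq h" "normsq g \<le> normsq f + normsq g + normsq h" "normsq h \<le> normsq f + normsq g + normsq h" for f g h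
      using normsq_nonneg[of f] normsq_nonneg[of g] normsq_nonneg[of h] by auto
    show "\<exists>N. \<forall>m\<ge>N. \<forall>n\<ge>N. normsq (\<lambda>x. w m x - w n x) < d" using le_less_trans[OF le(1) N] by blast
    show "\<exists>N. \<forall>m\<ge>N. \<forall>n\<ge>N. normsq (\<lambda>x. w1 m x - w1 n x) < d" using le_less_trans[OF le(2) N] by blast
    show "\<exists>N. \<forall>m\<ge>N. \<forall>n\<ge>N. normsq (\<lambda>x. w2 m x - w2 n x) < d" using le_less_trans[OF le(3) N] by blast
  qed
  obtain v where v: "L2R v" "(\<lambda>n. normsq (\<lambda>x. w n x - v x)) \<longlonglongrightarrow> 0" using L2_complete[OF wL(1) Cauchy'(1)] by blast
  obtain v1 where v1: "L2R v1" "(\<lambda>n. normsq (\<lambda>x. w1 n x - v1 x)) \<longlonglongrightarrow> 0" using L2_complete[OF wL(2) Cauchy'(2)] by blast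
  obtain v2 where v2: "L2R v2" "(\<lambda>n. normsq (\<lambda>x. w2 n x - v2 x)) \<longlonglongrightarrow> 0" using L2_complete[OF wL(3) Cauchy'(3)] by blast
  have wd: "weak_deriv (w n) (w1 n)" "weak_deriv (w1 n) (w2 n)" for n using wH[of n] by (auto simp: H2R_def H1R_def)
  have vH: "H2R v v1 v2"
    using weak_deriv_limit[OF wL(1) wL(2) v(1) v1(1) wd(1) v(2) v1(2)]
      weak_deriv_limit[OF wL(2) wL(3) v1(1) v2(1) wd(2) v1(2) v2(2)] v v1 v2
    by (auto simp: H2R_def H1R_def)
  \<comment> \<open>Writing v = w - (w - v), the parallelogram law bounds \<open>B1\<close> at v by
    twice its values at w and at w - v; with the upper bound of the form by the H^2 norm this
    replaces a continuity argument.\<close>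
  have le1: "B1 v v1 v2 \<le> 2 * B1 (w n) (w1 n) (w2 n)
     + 2 * (C * (normsq (\<lambda>x. w n x - v x) + normsq (\<lambda>x. w1 n x - v1 x) + normsq (\<lambda>x. w2 n x - v2 x)))" for n
  proof -
    let ?d = "\<lambda>x. w n x - v x" let ?d1 = "\<lambda>x. w1 n x - v1 x" let ?d2 = "\<lambda>x. w2 n x - v2 x"
    have dL: "L2R ?d" "L2R ?d1" "L2R ?d2" by (intro L2R_diff wL v v1 v2)+
    have "H2R (\<lambda>x. w n x + ?d x) (\<lambda>x. w1 n x + ?d1 x) (\<lambda>x. w2 n x + ?d2 x)"
      by (intro HC wH vH)
    from nonneg[OF this] have "B1 (\<lambda>x. w n x - ?d x) (\<lambda>x. w1 n x - ?d1 x) (\<lambda>x. w2 n x - ?d2 x)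
         \<le> 2 * B1 (w n) (w1 n) (w2 n) + 2 * B1 ?d ?d1 ?d2"
      using B_parallelogram[OF wL(1,2,3)[of n] dL] by linarith
    also have "\<dots> \<le> 2 * B1 (w n) (w1 n) (w2 n) + 2 * (C * (normsq ?d + normsq ?d1 + normsq ?d2))"
      using C(2)[OF dL] by simp
    finally show ?thesis by simp
  qed
  have "(\<lambda>n. 2 * B1 (w n) (w1 n) (w2 n)
     + 2 * (C * (normsq (\<lambda>x. w n x - v x) + normsq (\<lambda>x. w1 n x - v1 x) + normsq (\<lambda>x. w2 n x - v2 x)))) \<longlonglongrightarrow> 2 * 0 + 2 * (C * (0 + 0 + 0))"
    by (intro tendsto_intros wlim v v1 v2)
  then have "B1 v v1 v2 \<le> 2 * 0 + 2 * (C * (0 + 0 + 0))"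
    by (rule LIMSEQ_le_const) (use le1 in blast)
  then have "B1 v v1 v2 = 0" using nonneg[OF vH] by simp
  \<comment> \<open>The lower bound \<delta> survives in the same way, from w = v + (w - v).\<close>
  moreover have le2: "\<delta> \<le> 2 * (normsq v + normsq v1) + 2 * (normsq (\<lambda>x. w n x - v x) + normsq (\<lambda>x. w1 n x - v1 x))" for n
    using normsq_add_le[OF v(1) L2R_diff[OF wL(1)[of n] v(1)]] normsq_add_le[OF v1(1) L2R_diff[OF wL(2)[of n] v1(1)]]
      lower[of "r n"] by (simp add: w_def w1_def)
  have "(\<lambda>n. 2 * (normsq v + normsq v1) + 2 * (normsq (\<lambda>x. w n x - v x) + normsq (\<lambda>x. w1 n x - v1 x))) \<longlonglongrightarrow> 2 * (normsq v + normsq v1) + 2 * (0 + 0)"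
    by (intro tendsto_intros v v1)
  then have "\<delta> \<le> 2 * (normsq v + normsq v1) + 2 * (0 + 0)"
    by (rule LIMSEQ_le_const) (use le2 in blast)
  then have "normsq v + normsq v1 > 0" using \<delta> by simp
  ultimately show thesis using vH that by blast
qed

text \<open>Since \<open>v\<close> is a zero of a nonnegative quadratic form, the polynomial 2 t
  \<beta> + t^2 \<gamma> is nonnegative for all t, which forces its linear coefficient to
  vanish.\<close>

lemma Euler_Lagrange:
  assumes nonneg: "\<And>u u1 u2. H2R u u1 u2 \<Longrightarrow> 0 \<le> B1 u u1 u2"
    and v: "H2R v v1 v2" "B1 v v1 v2 = 0" and h: "H2R h h1 h2"
  shows "B v v1 v2 h h1 h2 = 0"
proof -
  define \<beta> \<gamma> where "\<beta> = B v v1 v2 h h1 h2" and "\<gamma> = B1 h h1 h2"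
  have "\<gamma> \<ge> 0" using nonneg[OF h] by (simp add: \<gamma>_def)
  have L: "L2R v" "L2R v1" "L2R v2" "L2R h" "L2R h1" "L2R h2" using v h by (auto simp: H2R_def H1R_def)
  have "0 \<le> 2 * t * \<beta> + t\<^sup>2 * \<gamma>" for t
    using nonneg[OF H2R_lincomb[OF v(1) h, of t]] B_expand[OF L, of t] v(2) by (simp add: \<beta>_def \<gamma>_def)
  \<comment> \<open>Nearly the minimiser t = - \<beta>/\<gamma> of the polynomial; adding 1 covers
    \<gamma> = 0.\<close>
  from this[of "- \<beta> / (\<gamma> + 1)"] have "0 \<le> - 2 * \<beta>\<^sup>2 / (\<gamma> + 1) + \<beta>\<^sup>2 * \<gamma> / (\<gamma> + 1)\<^sup>2"
    by (simp add: power2_eq_square)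
  also have "\<dots> = - (\<beta>\<^sup>2 * (\<gamma> + 2)) / (\<gamma> + 1)\<^sup>2"
    using \<open>\<gamma> \<ge> 0\<close> by (simp add: divide_simps) (simp add: power2_eq_square algebra_simps)
  finally have "\<beta>\<^sup>2 * (\<gamma> + 2) \<le> 0" using \<open>\<gamma> \<ge> 0\<close> by (auto simp: divide_le_0_iff)
  then have "\<beta> = 0" using \<open>\<gamma> \<ge> 0\<close> by (simp add: mult_le_0_iff)
  then show ?thesis by (simp add: \<beta>_def)
qed

end

section \<open>Regularity and decay\<close>

text \<open>Tonelli: a point y lies in the windows [x, x + h] of exactly those x with y - h \<le> x
  \<le> y, a set of length h. Pointwise estimates on windows thereby become estimates in L^2 on the
  line.\<close>

lemma window_integral:
  assumes f: "L2R f" and h: "0 \<le> h"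
  shows "integrable lborel (\<lambda>x. normsq_on f x (x + h))" "(\<integral>x. normsq_on f x (x + h) \<partial>lborel) = h * normsq f"
proof -
  have fm[measurable]: "f \<in> borel_measurable borel" using f L2R_borel by blast
  have li: "loc_int (\<lambda>x. (f x)\<^sup>2)"
    unfolding loc_int_def
  proof (intro conjI allI)
    show "integrable lborel (\<lambda>x. indicator {a..b} x * (f x)\<^sup>2)" for a b
      by (rule Bochner_Integration.integrable_bound[OF L2R_int[OF f]]) (auto simp: indicator_def)
  qed measurable
  have "normsq_on f x (x + h) = prim (\<lambda>x. (f x)\<^sup>2) (x + h) - prim (\<lambda>x. (f x)\<^sup>2) x" for x
    unfolding prim_diff[OF li, of x "x + h", simplified, OF h] normsq_on_def normsq_def
    by (intro Bochner_Integration.integral_cong) (auto simp: indicator_def)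
  moreover have "continuous_on UNIV (\<lambda>x. prim (\<lambda>x. (f x)\<^sup>2) (x + h) - prim (\<lambda>x. (f x)\<^sup>2) x)"
    by (intro continuous_on_diff prim_continuous li continuous_on_compose2[OF prim_continuous[OF li]] continuous_intros) auto
  ultimately have m[measurable]: "(\<lambda>x. normsq_on f x (x + h)) \<in> borel_measurable borel"
    using borel_measurable_continuous_onI by simp
  define G where "G x y = ennreal ((f y)\<^sup>2) * indicator {x..x+h} y" for x y
  have Gm: "(\<lambda>(x, y). G x y) \<in> borel_measurable (lborel \<Otimes>\<^sub>M lborel)"
  proof -
    have "{p :: real \<times> real. fst p \<le> snd p \<and> snd p \<le> fst p + h} \<in> sets (borel \<Otimes>\<^sub>M borel)"
      unfolding borel_prod by (intro borel_closed closed_Collect_conj closed_Collect_le continuous_intros)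
    then have "(\<lambda>p. indicator {p :: real \<times> real. fst p \<le> snd p \<and> snd p \<le> fst p + h} p :: ennreal) \<in> borel_measurable (borel \<Otimes>\<^sub>M borel)"
      by (intro borel_measurable_indicator)
    moreover have "(\<lambda>(x, y). G x y) = (\<lambda>p. ennreal ((f (snd p))\<^sup>2) * indicator {p :: real \<times> real. fst p \<le> snd p \<and> snd p \<le> fst p + h} p)"
      by (auto simp: G_def indicator_def)
    ultimately show ?thesis by simp
  qed
  have "(\<integral>\<^sup>+x. ennreal (normsq_on f x (x + h)) \<partial>lborel) = (\<integral>\<^sup>+x. (\<integral>\<^sup>+y. G x y \<partial>lborel) \<partial>lborel)"
  proof (intro nn_integral_cong)
    fix x
    have "ennreal (normsq_on f x (x + h)) = (\<integral>\<^sup>+y. ennreal ((indicator {x..x+h} y * f y)\<^sup>2) \<partial>lborel)"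
      unfolding normsq_on_def normsq_def by (intro nn_integral_eq_integral[symmetric] L2R_int L2R_indicator_mult f) auto
    also have "\<dots> = (\<integral>\<^sup>+y. G x y \<partial>lborel)"
      by (intro nn_integral_cong) (auto simp: G_def indicator_def)
    finally show "ennreal (normsq_on f x (x + h)) = (\<integral>\<^sup>+y. G x y \<partial>lborel)" .
  qed
  also have "\<dots> = (\<integral>\<^sup>+y. (\<integral>\<^sup>+x. G x y \<partial>lborel) \<partial>lborel)"
    using lborel_pair.Fubini'[OF Gm] by simp
  also have "\<dots> = (\<integral>\<^sup>+y. ennreal ((f y)\<^sup>2) * ennreal h \<partial>lborel)"
  proof (intro nn_integral_cong)
    fix y
    have "(\<integral>\<^sup>+x. G x y \<partial>lborel) = (\<integral>\<^sup>+x. ennreal ((f y)\<^sup>2) * indicator {y-h..y} x \<partial>lborel)"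
      by (intro nn_integral_cong) (auto simp: G_def indicator_def)
    also have "\<dots> = ennreal ((f y)\<^sup>2) * ennreal h" using h by (simp add: nn_integral_cmult_indicator)
    finally show "(\<integral>\<^sup>+x. G x y \<partial>lborel) = ennreal ((f y)\<^sup>2) * ennreal h" .
  qed
  also have "\<dots> = (\<integral>\<^sup>+y. ennreal (h * (f y)\<^sup>2) \<partial>lborel)"
    using h by (intro nn_integral_cong) (simp add: ennreal_mult[symmetric] mult.commute)
  also have "\<dots> = ennreal (h * normsq f)"
    unfolding normsq_def using h by (subst nn_integral_eq_integral) (auto simp: L2R_int f)
  finally have E: "(\<integral>\<^sup>+x. ennreal (normsq_on f x (x + h)) \<partial>lborel) = ennreal (h * normsq f)" .
  have "has_bochner_integral lborel (\<lambda>x. normsq_on f x (x + h)) (h * normsq f)"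
  proof (rule has_bochner_integral_nn_integral)
    show "AE x in lborel. 0 \<le> normsq_on f x (x + h)" by (simp add: normsq_on_def normsq_nonneg)
    show "0 \<le> h * normsq f" using h normsq_nonneg by simp
  qed (use E m in auto)
  then show "integrable lborel (\<lambda>x. normsq_on f x (x + h))" "(\<integral>x. normsq_on f x (x + h) \<partial>lborel) = h * normsq f"
    by (auto simp: has_bochner_integral_iff)
qed

lemma L2R_shift:
  assumes "L2R f" shows "L2R (\<lambda>x. f (x + h))" "normsq (\<lambda>x. f (x + h)) = normsq f"
proof -
  have m: "f \<in> borel_measurable borel" using assms L2R_borel by blast
  have "integrable lborel (\<lambda>x. (f (h + 1 * x))\<^sup>2)"
    using lborel_integrable_real_affine[of "\<lambda>x. (f x)\<^sup>2" 1 h] L2R_int[OF assms] by simp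
  then show "L2R (\<lambda>x. f (x + h))" using m by (simp add: L2R_def add.commute)
  show "normsq (\<lambda>x. f (x + h)) = normsq f"
    using lborel_integral_real_affine[of 1 "\<lambda>x. (f x)\<^sup>2" h] by (simp add: normsq_def add.commute)
qed

text \<open>The mean value theorem finds a point of [x, x + 1] where f1 equals f(x + 1) - f(x), and
  f2 controls the variation of f1 over the window; integrating over x gives the claim. It is needed
  because the differential equation controls the second and the fourth derivative but not directly
  the third.\<close>

lemma L2R_interpolation:
  assumes "L2R f" "L2R f2" "\<And>x. (f has_real_derivative f1 x) (at x)" "\<And>x. (f1 has_real_derivative f2 x) (at x)"
    "continuous_on UNIV f2"
  shows "L2R f1"
  unfolding L2R_def
proof
  have "continuous_on UNIV f1" using assms(4) by (meson DERIV_isCont continuous_at_imp_continuous_on)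
  then show m: "f1 \<in> borel_measurable lborel" using borel_measurable_continuous_onI by simp
  obtain c where c: "f1 = (\<lambda>x. c + prim f2 x)" using DERIV_continuous_eq_prim[OF assms(4,5)] by blast
  have "(f1 x)\<^sup>2 \<le> 4 * (f (x + 1))\<^sup>2 + 4 * (f x)\<^sup>2 + 2 * normsq_on f2 x (x + 1)" for x
  proof -
    obtain y where y: "x < y" "y < x + 1" "f (x + 1) - f x = (x + 1 - x) * f1 y"
      using MVT2[of x "x+1" f f1] assms(3) by auto
    have "(f1 y - f1 x)\<^sup>2 \<le> (y - x) * normsq_on f2 x y" using prim_diff_sq_le[OF assms(2), of x y] y(1) c by simp
    also have "\<dots> \<le> 1 * normsq_on f2 x (x + 1)"
      using y by (intro mult_mono normsq_on_mono assms) (auto simp: normsq_on_def normsq_nonneg)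
    finally have 1: "(f1 y - f1 x)\<^sup>2 \<le> normsq_on f2 x (x + 1)" by simp
    have 2: "(f1 x)\<^sup>2 \<le> 2 * (f1 y)\<^sup>2 + 2 * (f1 y - f1 x)\<^sup>2"
      using zero_le_power2[of "2 * f1 y - f1 x"] by (simp add: power2_eq_square algebra_simps)
    have 3: "(f1 y)\<^sup>2 \<le> 2 * (f (x + 1))\<^sup>2 + 2 * (f x)\<^sup>2"
      using y(3) zero_le_power2[of "f (x + 1) + f x"] by (simp add: power2_eq_square algebra_simps)
    show ?thesis using 1 2 3 by linarith
  qed
  moreover have "integrable lborel (\<lambda>x. 4 * (f (x + 1))\<^sup>2 + 4 * (f x)\<^sup>2 + 2 * normsq_on f2 x (x + 1))"
    by (intro Bochner_Integration.integrable_add integrable_mult_right L2R_int L2R_shift assms window_integral) auto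
  ultimately show "integrable lborel (\<lambda>x. (f1 x)\<^sup>2)"
    using m by (elim Bochner_Integration.integrable_bound) (auto simp: abs_of_nonneg normsq_on_def normsq_nonneg)
qed

lemma normsq_on_tendsto_0: assumes f: "L2R f" shows "((\<lambda>x. normsq_on f x (x + 1)) \<longlongrightarrow> 0) at_infinity"
proof -
  have fm[measurable]: "f \<in> borel_measurable borel" using f L2R_borel by blast
  have "(\<lambda>n::nat. \<integral>x. indicator (- {-real n..real n}) x * (f x)\<^sup>2 \<partial>lborel) \<longlonglongrightarrow> (\<integral>x. 0 \<partial>(lborel::real measure))"
  proof (rule integral_dominated_convergence[where w = "\<lambda>x. (f x)\<^sup>2"])
    show "AE x in lborel. (\<lambda>n::nat. indicator (- {-real n..real n}) x * (f x)\<^sup>2) \<longlonglongrightarrow> 0"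
    proof (intro AE_I2 tendsto_eventually)
      fix x :: real
      obtain N where "\<bar>x\<bar> < real N" using reals_Archimedean2 by blast
      then show "\<forall>\<^sub>F n in sequentially. indicator (- {-real n..real n}) x * (f x)\<^sup>2 = 0"
        by (intro eventually_sequentiallyI[of N]) (auto simp: indicator_def)
    qed
  qed (auto simp: L2R_int f indicator_def)
  then have lim: "(\<lambda>n::nat. \<integral>x. indicator (- {-real n..real n}) x * (f x)\<^sup>2 \<partial>lborel) \<longlonglongrightarrow> 0" by simp
  show ?thesis
    unfolding Lim_at_infinity
  proof (intro allI impI)
    fix e :: real assume "e > 0"
    then obtain n where n: "(\<integral>x. indicator (- {-real n..real n}) x * (f x)\<^sup>2 \<partial>lborel) < e"
      using LIMSEQ_D[OF lim, of e] by fastforce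
    \<comment> \<open>The margin 2 keeps the whole window [x, x + 1] outside [-n, n] also for
      negative x.\<close>
    have "dist (normsq_on f x (x + 1)) 0 < e" if "real n + 2 \<le> norm x" for x
    proof -
      have "normsq_on f x (x + 1) \<le> (\<integral>x. indicator (- {-real n..real n}) x * (f x)\<^sup>2 \<partial>lborel)"
        unfolding normsq_on_def normsq_def
      proof (intro integral_mono L2R_int L2R_indicator_mult f)
        show "integrable lborel (\<lambda>x. indicator (- {-real n..real n}) x * (f x)\<^sup>2)"
          by (rule Bochner_Integration.integrable_bound[OF L2R_int[OF f]]) (auto simp: indicator_def)
        show "(indicator {x..x+1} y * f y)\<^sup>2 \<le> indicator (- {-real n..real n}) y * (f y)\<^sup>2" for y
          using that by (auto simp: indicator_def)
      qed
      then show ?thesis using n by (simp add: normsq_on_def normsq_nonneg)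
    qed
    then show "\<exists>b. \<forall>x. b \<le> norm x \<longrightarrow> dist (normsq_on f x (x + 1)) 0 < e" by blast
  qed
qed

lemma L2R_tendsto_0:
  assumes "L2R f" "L2R f1" "\<And>x. (f has_real_derivative f1 x) (at x)" "continuous_on UNIV f1"
  shows "(f \<longlongrightarrow> 0) at_infinity"
proof -
  obtain c where c: "f = (\<lambda>x. c + prim f1 x)" using DERIV_continuous_eq_prim[OF assms(3,4)] by blast
  have "f x = c + prim f1 x" for x by (rule fun_cong[OF c])
  from sup_sq_le[OF assms(1,2) this]
  have le: "(f x)\<^sup>2 \<le> 2 * normsq_on f x (x + 1) + 2 * normsq_on f1 x (x + 1)" for x .
  have "((\<lambda>x. 2 * normsq_on f x (x + 1) + 2 * normsq_on f1 x (x + 1)) \<longlongrightarrow> 2 * 0 + 2 * 0) at_infinity"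
    by (intro tendsto_intros normsq_on_tendsto_0 assms)
  then have lim: "((\<lambda>x. 2 * normsq_on f x (x + 1) + 2 * normsq_on f1 x (x + 1)) \<longlongrightarrow> 0) at_infinity" by simp
  have "((\<lambda>x. (f x)\<^sup>2) \<longlongrightarrow> 0) at_infinity"
    by (rule Lim_null_comparison[OF always_eventually lim]) (simp add: le)
  then have "((\<lambda>x. sqrt ((f x)\<^sup>2)) \<longlongrightarrow> sqrt 0) at_infinity" by (rule tendsto_real_sqrt)
  then show ?thesis by (simp add: tendsto_rabs_zero_iff)
qed

text \<open>The class of functions constant near \<open>\<infinity>\<close> and near \<open>-\<infinity>\<close>, possibly with different values.\<close>

definition asymp_const :: "(real \<Rightarrow> real) \<Rightarrow> bool" where
  "asymp_const w \<longleftrightarrow> smooth1 w \<and> test1 (deriv w)"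

lemma asymp_const_bdd_meas: assumes "asymp_const w" shows "bdd_meas w"
proof -
  have s: "smooth1 w" and t: "test1 (deriv w)" using assms by (auto simp: asymp_const_def)
  obtain R where R: "R > 0" "\<And>x. \<bar>x\<bar> \<ge> R \<Longrightarrow> deriv w x = 0" using test1_support[OF t] by metis
  have c: "continuous_on A w" for A using s by (rule smooth1_continuous)
  have right: "w x = w R" if "x > R" for x
  proof (rule DERIV_isconst_end[OF that c])
    fix y assume "R < y" "y < x"
    then show "(w has_real_derivative 0) (at y)" using smooth1_DERIV[OF s, of y] R(2)[of y] by simp
  qed
  have left: "w x = w (-R)" if "x < -R" for x
  proof (rule DERIV_isconst_end[OF that c, symmetric])
    fix y assume "x < y" "y < -R"
    then show "(w has_real_derivative 0) (at y)" using smooth1_DERIV[OF s, of y] R(2)[of y] by simp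
  qed
  have "bounded (w ` {-R..R})" by (intro compact_imp_bounded compact_continuous_image c) auto
  then obtain C where C: "\<forall>x\<in>{-R..R}. \<bar>w x\<bar> \<le> C" unfolding bounded_iff by auto
  have "\<bar>w x\<bar> \<le> C" for x
  proof -
    consider "x > R" | "x < -R" | "x \<in> {-R..R}" by force
    then show ?thesis using right[of x] left[of x] C R(1) by cases auto
  qed
  then show ?thesis using borel_measurable_continuous_onI[OF c] unfolding bdd_meas_def by blast
qed

lemma test1_imp_ebc: "test1 w \<Longrightarrow> asymp_const w"
  using test1_deriv test1_iff by (auto simp: asymp_const_def)

lemma asymp_const_deriv: "asymp_const w \<Longrightarrow> asymp_const (deriv w)"
  using test1_imp_ebc by (auto simp: asymp_const_def)

lemma asymp_const_const: "asymp_const (\<lambda>x. c)"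
  by (auto simp: asymp_const_def test1_iff)

lemma asymp_const_add: assumes "asymp_const v" "asymp_const w" shows "asymp_const (\<lambda>x. v x + w x)"
proof -
  have "((\<lambda>x. v x + w x) has_real_derivative deriv v x + deriv w x) (at x)" for x
    using assms smooth1_DERIV by (auto simp: asymp_const_def intro!: derivative_eq_intros)
  then have "deriv (\<lambda>x. v x + w x) = (\<lambda>x. deriv v x + deriv w x)" by (auto intro: DERIV_imp_deriv)
  then show ?thesis using assms by (auto simp: asymp_const_def smooth1_add test1_add)
qed

lemma asymp_const_mult: assumes "asymp_const v" "asymp_const w" shows "asymp_const (\<lambda>x. v x * w x)"
proof -
  have "((\<lambda>x. v x * w x) has_real_derivative w x * deriv v x + v x * deriv w x) (at x)" for x
    using assms smooth1_DERIV[of v x] smooth1_DERIV[of w x] by (auto simp: asymp_const_def intro!: derivative_eq_intros)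
  then have "deriv (\<lambda>x. v x * w x) = (\<lambda>x. w x * deriv v x + v x * deriv w x)" by (auto intro: DERIV_imp_deriv)
  then show ?thesis using assms by (auto simp: asymp_const_def smooth1_mult test1_add test1_mult_smooth)
qed

lemma asymp_const_cmult: "asymp_const w \<Longrightarrow> asymp_const (\<lambda>x. c * w x)"
  by (rule asymp_const_mult[OF asymp_const_const])

lemma prim_cong_AE:
  assumes "loc_int f" "loc_int g" "AE x in lborel. f x = g x" shows "prim f = prim g"
proof
  fix x
  have i: "(\<integral>x. indicator {a..b} x * f x \<partial>lborel) = (\<integral>x. indicator {a..b} x * g x \<partial>lborel)" for a b
    using assms(3) loc_int_borel[OF assms(1)] loc_int_borel[OF assms(2)]
    by (intro integral_cong_AE) (auto elim: eventually_mono)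
  show "prim f x = prim g x"
    by (simp only: prim_def loc_int_HK(2)[OF assms(1)] loc_int_HK(2)[OF assms(2)] i)
qed

locale smooth_quad_form = quad_form +
  assumes sa: "asymp_const a" and sb: "asymp_const b" and sp: "asymp_const p"
begin

text \<open>\<open>q0\<close>, \<open>q1\<close> and \<open>q2\<close> come from solving (c + e)
  V'''' + 2 e k^2 V'' - (b V')' + (a + e k^4 - p) V = 0, the Euler-Lagrange equation of
  \<open>B\<close>, for V''''.\<close>

definition q0 :: "real \<Rightarrow> real" where "q0 x = - (a x + e * (k\<^sup>2)\<^sup>2 - p x) / (c + e)"
definition q1 :: "real \<Rightarrow> real" where "q1 x = deriv b x / (c + e)"
definition q2 :: "real \<Rightarrow> real" where "q2 x = (b x - 2 * e * k\<^sup>2) / (c + e)"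

lemma asymp_const_q: "asymp_const q0" "asymp_const q1" "asymp_const q2"
proof -
  have "asymp_const (\<lambda>x. (- 1 / (c + e)) * (a x + e * (k\<^sup>2)\<^sup>2 + (-1) * p x))"
    by (intro asymp_const_cmult asymp_const_add sa sp asymp_const_const)
  moreover have "q0 = (\<lambda>x. (- 1 / (c + e)) * (a x + e * (k\<^sup>2)\<^sup>2 + (-1) * p x))"
    by (rule ext) (simp add: q0_def divide_inverse algebra_simps)
  ultimately show "asymp_const q0" by simp
  have "asymp_const (\<lambda>x. (1 / (c + e)) * deriv b x)" by (intro asymp_const_cmult asymp_const_deriv sb)
  then show "asymp_const q1" by (simp add: q1_def[abs_def])
  have "asymp_const (\<lambda>x. (1 / (c + e)) * (b x + - (2 * e * k\<^sup>2)))" by (intro asymp_const_cmult asymp_const_add sb asymp_const_const)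
  then show "asymp_const q2" by (simp add: q2_def[abs_def])
qed

text \<open>In the weak equation all lower order terms are integrated until they act on \<phi>''.
  What multiplies \<phi>'' is then affine almost everywhere, so v'' agrees with a differentiable
  function; from there the equation holds classically, and its bounded coefficients keep all
  derivatives in L^2.\<close>

lemma smooth_solution:
  assumes v: "H2R v v1 v2" and ne: "normsq v + normsq v1 > 0"
    and EL: "\<And>\<phi>. test1 \<phi> \<Longrightarrow> B v v1 v2 \<phi> (deriv \<phi>) (deriv (deriv \<phi>)) = 0"
  obtains V where "smooth1 V" "\<And>n. L2R ((deriv ^^ n) V)" "\<exists>x. V x \<noteq> 0"
    "\<And>x. (deriv ^^ 4) V x = q0 x * V x + q1 x * deriv V x + q2 x * deriv (deriv V) x"
proof -
  have L: "L2R v" "L2R v1" "L2R v2" and H: "H1R v v1" "H1R v1 v2" using v by (auto simp: H2R_def H1R_def)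
  have ce: "c + e > 0" using c e by simp
  obtain V0 c0 where V0: "\<And>x. V0 x = c0 + prim v1 x" "AE x in lborel. v x = V0 x" "H1R V0 v1" using H1R_rep[OF H(1)] by metis
  obtain V1 c1 where V1: "\<And>x. V1 x = c1 + prim v2 x" "AE x in lborel. v1 x = V1 x" "H1R V1 v2" "continuous_on UNIV V1"
    using H1R_rep[OF H(2)] by metis
  have LV: "L2R V0" "L2R V1" using V0 V1 by (auto simp: H1R_def)
  have "prim v1 = prim V1" by (intro prim_cong_AE L2R_loc_int L LV V1)
  then have V0': "V0 = (\<lambda>x. c0 + prim V1 x)" using V0(1) by auto
  have D0: "(V0 has_real_derivative V1 x) (at x)" for x
    unfolding V0' using prim_DERIV[OF V1(4)] by (auto intro!: derivative_eq_intros)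
  then have cV0: "continuous_on UNIV V0" by (meson DERIV_isCont continuous_at_imp_continuous_on)
  have cw: "continuous_on UNIV w" if "asymp_const w" for w using that smooth1_continuous by (auto simp: asymp_const_def)
  \<comment> \<open>\<open>G\<close> collects the factors of \<phi> and \<open>F\<close> those of
    \<phi>'; the mixed term v'' \<phi> is read as - V1 \<phi>' and so enters \<open>F\<close>. Then
    F - prim G acts on \<phi>' and, after another primitive, on \<phi>''.\<close>
  define G where "G = (\<lambda>x. (a x + e * (k\<^sup>2)\<^sup>2 - p x) * V0 x)"
  define F where "F = (\<lambda>x. (b x - e * k\<^sup>2) * V1 x)"
  have cG: "continuous_on UNIV G" and cF: "continuous_on UNIV F"
    unfolding G_def F_def by (intro continuous_intros cV0 V1 cw sa sb sp)+
  define P where "P = (\<lambda>x. F x - prim G x)"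
  have cP: "continuous_on UNIV P" unfolding P_def
    by (intro continuous_intros cF prim_continuous loc_int_continuous cG)
  define h where "h = (\<lambda>x. (c + e) * v2 x + e * k\<^sup>2 * V0 x - prim P x)"
  have lih: "loc_int h" unfolding h_def
    by (intro loc_int_diff loc_int_add loc_int_cmult prim_loc_int loc_int_continuous cP cV0 L2R_loc_int L)
  have "(\<integral>x. h x * deriv (deriv \<phi>) x \<partial>lborel) = 0" if \<phi>: "test1 \<phi>" for \<phi>
  proof -
    note t1 = test1_deriv[OF \<phi>] note t2 = test1_deriv[OF t1]
    have T: "L2R \<phi>" "L2R (deriv \<phi>)" "L2R (deriv (deriv \<phi>))" using \<phi> t1 t2 test1_L2R by blast+
    note bdd_rho = L2R_borel[OF L(1)] L2R_borel[OF L(2)] L2R_borel[OF LV(1)] L2R_borel[OF LV(2)] L2R_borel[OF T(1)] L2R_borel[OF T(2)]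
    have wa: "wprod a v \<phi> = wprod a V0 \<phi>" and wp: "wprod p v \<phi> = wprod p V0 \<phi>" and wb: "wprod b v1 (deriv \<phi>) = wprod b V1 (deriv \<phi>)"
      using a(1) b(1) p(1) bdd_rho V0(2) V1(2) unfolding bdd_meas_def by (auto intro!: wprod_cong_AE)
    have i1: "wprod (\<lambda>x. 1) (\<lambda>x. k\<^sup>2 * v x + v2 x) (\<lambda>x. k\<^sup>2 * \<phi> x + deriv (deriv \<phi>) x)
       = (k\<^sup>2)\<^sup>2 * inner_L2 v \<phi> + k\<^sup>2 * inner_L2 v (deriv (deriv \<phi>)) + k\<^sup>2 * inner_L2 v2 \<phi> + inner_L2 v2 (deriv (deriv \<phi>))"
    proof -
      have "wprod (\<lambda>x. 1) (\<lambda>x. k\<^sup>2 * v x + v2 x) (\<lambda>x. k\<^sup>2 * \<phi> x + deriv (deriv \<phi>) x)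
        = (\<integral>x. (k\<^sup>2)\<^sup>2 * (v x * \<phi> x) + k\<^sup>2 * (v x * deriv (deriv \<phi>) x) + k\<^sup>2 * (v2 x * \<phi> x) + v2 x * deriv (deriv \<phi>) x \<partial>lborel)"
        unfolding wprod_def by (intro Bochner_Integration.integral_cong) (auto simp: power2_eq_square algebra_simps)
      then show ?thesis unfolding inner_L2_def by (simp add: L2R_mult L T)
    qed
    have ipc: "inner_L2 v f = inner_L2 V0 f" if "L2R f" for f
      unfolding inner_L2_def using V0(2) bdd_rho L2R_borel[OF that]
      by (intro integral_cong_AE) (auto elim: eventually_mono)
    have iv2: "inner_L2 v2 \<phi> = - inner_L2 V1 (deriv \<phi>)"
      using V1(3) \<phi> unfolding H1R_def weak_deriv_def inner_L2_def by simp
    have E: "wprod a V0 \<phi> + wprod b V1 (deriv \<phi>) + c * inner_L2 v2 (deriv (deriv \<phi>))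
       + e * ((k\<^sup>2)\<^sup>2 * inner_L2 V0 \<phi> + k\<^sup>2 * inner_L2 V0 (deriv (deriv \<phi>)) - k\<^sup>2 * inner_L2 V1 (deriv \<phi>) + inner_L2 v2 (deriv (deriv \<phi>)))
       - wprod p V0 \<phi> = 0"
    proof -
      have "wprod (\<lambda>x. 1) v2 (deriv (deriv \<phi>)) = inner_L2 v2 (deriv (deriv \<phi>))" by (simp add: wprod_def inner_L2_def)
      then show ?thesis using EL[OF \<phi>] unfolding B_def i1 wa wp wb ipc[OF T(1)] ipc[OF T(3)] iv2 by simp
    qed
    have iG: "inner_L2 G \<phi> = wprod a V0 \<phi> + e * (k\<^sup>2)\<^sup>2 * inner_L2 V0 \<phi> - wprod p V0 \<phi>"
    proof -
      have "inner_L2 G \<phi> = (\<integral>x. a x * V0 x * \<phi> x + e * (k\<^sup>2)\<^sup>2 * (V0 x * \<phi> x) - p x * V0 x * \<phi> x \<partial>lborel)"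
        unfolding inner_L2_def G_def by (intro Bochner_Integration.integral_cong) (auto simp: algebra_simps)
      then show ?thesis unfolding inner_L2_def wprod_def
        by (simp add: bdd_meas_integrable a p LV T L2R_mult)
    qed
    have iF: "inner_L2 F (deriv \<phi>) = wprod b V1 (deriv \<phi>) - e * k\<^sup>2 * inner_L2 V1 (deriv \<phi>)"
    proof -
      have "inner_L2 F (deriv \<phi>) = (\<integral>x. b x * V1 x * deriv \<phi> x - e * k\<^sup>2 * (V1 x * deriv \<phi> x) \<partial>lborel)"
        unfolding inner_L2_def F_def by (intro Bochner_Integration.integral_cong) (auto simp: algebra_simps)
      then show ?thesis unfolding inner_L2_def wprod_def
        by (simp add: bdd_meas_integrable b LV T L2R_mult)
    qed
    have iP: "inner_L2 (prim P) (deriv (deriv \<phi>)) = - (inner_L2 F (deriv \<phi>) + inner_L2 G \<phi>)"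
    proof -
      have "inner_L2 (prim P) (deriv (deriv \<phi>)) = - inner_L2 P (deriv \<phi>)"
        unfolding inner_L2_def by (rule integral_prim_test1[OF loc_int_continuous[OF cP] t1])
      also have "inner_L2 P (deriv \<phi>) = (\<integral>x. F x * deriv \<phi> x - prim G x * deriv \<phi> x \<partial>lborel)"
        by (simp add: inner_L2_def P_def left_diff_distrib)
      also have "\<dots> = inner_L2 F (deriv \<phi>) - inner_L2 (prim G) (deriv \<phi>)"
        unfolding inner_L2_def by (intro Bochner_Integration.integral_diff loc_int_mult_test1 t1 prim_loc_int loc_int_continuous cF cG)
      also have "inner_L2 (prim G) (deriv \<phi>) = - inner_L2 G \<phi>"
        unfolding inner_L2_def by (rule integral_prim_test1[OF loc_int_continuous[OF cG] \<phi>])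
      finally show ?thesis by simp
    qed
    have "inner_L2 h (deriv (deriv \<phi>)) = (\<integral>x. (c + e) * (v2 x * deriv (deriv \<phi>) x) + e * k\<^sup>2 * (V0 x * deriv (deriv \<phi>) x) - prim P x * deriv (deriv \<phi>) x \<partial>lborel)"
      unfolding inner_L2_def h_def by (intro Bochner_Integration.integral_cong) (auto simp: algebra_simps)
    also have "\<dots> = (c + e) * inner_L2 v2 (deriv (deriv \<phi>)) + e * k\<^sup>2 * inner_L2 V0 (deriv (deriv \<phi>)) - inner_L2 (prim P) (deriv (deriv \<phi>))"
      unfolding inner_L2_def using loc_int_mult_test1[OF prim_loc_int[OF loc_int_continuous[OF cP]] t2]
      by (simp add: L2R_mult L LV T)
    also have "\<dots> = 0" unfolding iP iF iG using E by (simp add: algebra_simps)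
    finally show ?thesis by (simp add: inner_L2_def)
  qed
  from weak_deriv2_zero_imp_affine[OF lih this] obtain \<alpha> \<beta> where ab: "AE x in lborel. h x = \<alpha> + \<beta> * x" by metis
  \<comment> \<open>The undetermined affine function is smooth and therefore harmless: it has
    disappeared from \<open>V4\<close> after two derivatives.\<close>
  define V2 where "V2 = (\<lambda>x. (\<alpha> + \<beta> * x - e * k\<^sup>2 * V0 x + prim P x) / (c + e))"
  have ae2: "AE x in lborel. v2 x = V2 x"
    using ab
  proof eventually_elim
    case (elim x)
    then have "v2 x * (c + e) = \<alpha> + \<beta> * x - e * k\<^sup>2 * V0 x + prim P x" by (simp add: h_def algebra_simps)
    then show ?case using ce by (simp add: V2_def eq_divide_eq)
  qed
  define V3 where "V3 = (\<lambda>x. (\<beta> - e * k\<^sup>2 * V1 x + P x) / (c + e))"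
  have D2: "(V2 has_real_derivative V3 x) (at x)" for x
    unfolding V2_def V3_def using prim_DERIV[OF cP, of x] D0[of x] ce
    by (auto intro!: derivative_eq_intros)
  then have cV2: "continuous_on UNIV V2" by (meson DERIV_isCont continuous_at_imp_continuous_on)
  then have LV2: "L2R V2" using L2R_cong_AE[OF L(3) borel_measurable_continuous_onI ae2] by blast
  have "prim v2 = prim V2" by (intro prim_cong_AE L2R_loc_int L LV2 ae2)
  then have V1': "V1 = (\<lambda>x. c1 + prim V2 x)" using V1(1) by auto
  have D1: "(V1 has_real_derivative V2 x) (at x)" for x
    unfolding V1' using prim_DERIV[OF cV2] by (auto intro!: derivative_eq_intros)
  define V4 where "V4 = (\<lambda>x. q0 x * V0 x + q1 x * V1 x + q2 x * V2 x)"
  have D3: "(V3 has_real_derivative V4 x) (at x)" for x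
  proof -
    have Db: "(b has_real_derivative deriv b x) (at x)" using sb smooth1_DERIV by (auto simp: asymp_const_def)
    have "(V3 has_real_derivative (- e * k\<^sup>2 * V2 x + ((deriv b x) * V1 x + (b x - e * k\<^sup>2) * V2 x - G x)) / (c + e)) (at x)"
    proof -
      have "(P has_real_derivative (deriv b x) * V1 x + (b x - e * k\<^sup>2) * V2 x - G x) (at x)"
        unfolding P_def F_def using prim_DERIV[OF cG, of x] D1[of x] Db
        by (auto intro!: derivative_eq_intros simp: algebra_simps)
      from DERIV_cdivide[OF DERIV_add[OF DERIV_diff[OF DERIV_const DERIV_cmult[OF D1[of x]]] this]]
      show ?thesis unfolding V3_def by simp
    qed
    moreover have "(- e * k\<^sup>2 * V2 x + ((deriv b x) * V1 x + (b x - e * k\<^sup>2) * V2 x - G x)) / (c + e) = V4 x"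
      unfolding V4_def q0_def q1_def q2_def G_def by (simp add: divide_inverse algebra_simps)
    ultimately show ?thesis by simp
  qed
  have cV4: "continuous_on UNIV V4" unfolding V4_def by (intro continuous_intros cw asymp_const_q cV0 V1 cV2)
  have LV4: "L2R V4" unfolding V4_def by (intro L2R_add bdd_meas_L2R asymp_const_bdd_meas asymp_const_q LV LV2)
  have LV3: "L2R V3" by (rule L2R_interpolation[OF LV2 LV4 D2 D3 cV4])
  \<comment> \<open>The equation rewrites V'''' through lower derivatives, so combinations of V,
    ..., V''' with asymptotically constant coefficients are closed under differentiation, and all of
    them lie in L^2.\<close>
  define S where "S = {f. \<exists>w0 w1 w2 w3. asymp_const w0 \<and> asymp_const w1 \<and> asymp_const w2 \<and> asymp_const w3 \<and>
     f = (\<lambda>x. w0 x * V0 x + w1 x * V1 x + w2 x * V2 x + w3 x * V3 x)}"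
  have SI: "(\<lambda>x. w0 x * V0 x + w1 x * V1 x + w2 x * V2 x + w3 x * V3 x) \<in> S"
    if "asymp_const w0" "asymp_const w1" "asymp_const w2" "asymp_const w3" for w0 w1 w2 w3
    unfolding S_def mem_Collect_eq
    by (rule exI[of _ w0], rule exI[of _ w1], rule exI[of _ w2], rule exI[of _ w3]) (simp add: that)
  have SD: "\<exists>f'. f' \<in> S \<and> (\<forall>x. (f has_real_derivative f' x) (at x))" if fS: "f \<in> S" for f
  proof -
    obtain w0 w1 w2 w3 where w: "asymp_const w0" "asymp_const w1" "asymp_const w2" "asymp_const w3"
      and f: "f = (\<lambda>x. w0 x * V0 x + w1 x * V1 x + w2 x * V2 x + w3 x * V3 x)"
    proof -
      assume *: "\<And>w0 w1 w2 w3. asymp_const w0 \<Longrightarrow> asymp_const w1 \<Longrightarrow> asymp_const w2 \<Longrightarrow> asymp_const w3 \<Longrightarrow>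
        f = (\<lambda>x. w0 x * V0 x + w1 x * V1 x + w2 x * V2 x + w3 x * V3 x) \<Longrightarrow> thesis"
      show thesis using fS unfolding S_def mem_Collect_eq by (elim exE conjE) (rule *)
    qed
    define f' where "f' = (\<lambda>x. (deriv w0 x + w3 x * q0 x) * V0 x + (w0 x + deriv w1 x + w3 x * q1 x) * V1 x
       + (w1 x + deriv w2 x + w3 x * q2 x) * V2 x + (w2 x + deriv w3 x) * V3 x)"
    have "asymp_const (\<lambda>x. deriv w0 x + w3 x * q0 x)" "asymp_const (\<lambda>x. w0 x + deriv w1 x + w3 x * q1 x)"
      "asymp_const (\<lambda>x. w1 x + deriv w2 x + w3 x * q2 x)" "asymp_const (\<lambda>x. w2 x + deriv w3 x)"
      by (intro asymp_const_add asymp_const_mult asymp_const_deriv w asymp_const_q)+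
    then have "f' \<in> S" unfolding f'_def by (rule SI)
    moreover have "(f has_real_derivative f' x) (at x)" for x
    proof -
      have dw: "(w0 has_real_derivative deriv w0 x) (at x)" "(w1 has_real_derivative deriv w1 x) (at x)"
        "(w2 has_real_derivative deriv w2 x) (at x)" "(w3 has_real_derivative deriv w3 x) (at x)"
        using w smooth1_DERIV by (auto simp: asymp_const_def)
      have "(f has_real_derivative (w0 x * V1 x + deriv w0 x * V0 x) + (w1 x * V2 x + deriv w1 x * V1 x)
         + (w2 x * V3 x + deriv w2 x * V2 x) + (w3 x * V4 x + deriv w3 x * V3 x)) (at x)"
        unfolding f using dw D0[of x] D1[of x] D2[of x] D3[of x]
        by (auto intro!: derivative_eq_intros)
      then show ?thesis by (simp add: f'_def V4_def algebra_simps)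
    qed
    ultimately show ?thesis by blast
  qed
  have V0S: "V0 \<in> S"
    using SI[OF asymp_const_const[of 1] asymp_const_const[of 0] asymp_const_const[of 0] asymp_const_const[of 0]] by simp
  have sm: "smooth1 V0" using smooth1_coinduct[of "\<lambda>f. f \<in> S", OF V0S] SD by blast
  have "(deriv ^^ n) V0 \<in> S" for n
  proof (induction n)
    case (Suc n)
    then obtain f' where "f' \<in> S" "\<forall>x. ((deriv ^^ n) V0 has_real_derivative f' x) (at x)" using SD by blast
    moreover then have "deriv ((deriv ^^ n) V0) = f'" by (auto intro: DERIV_imp_deriv)
    ultimately show ?case by simp
  qed (simp add: V0S)
  moreover have "L2R f" if "f \<in> S" for f
    using that unfolding S_def by (auto intro!: L2R_add bdd_meas_L2R asymp_const_bdd_meas LV LV2 LV3)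
  ultimately have Ln: "L2R ((deriv ^^ n) V0)" for n by blast
  have d: "deriv V0 = V1" "deriv V1 = V2" "deriv V2 = V3" "deriv V3 = V4"
    by (intro ext DERIV_imp_deriv D0 D1 D2 D3)+
  have "\<exists>x. V0 x \<noteq> 0"
  proof (rule ccontr)
    assume "\<not> ?thesis"
    then have z: "V0 = (\<lambda>x. 0)" by auto
    then have "V1 = (\<lambda>x. 0)" using d(1) by auto
    then have "normsq v = 0" "normsq v1 = 0" using z V0(2) V1(2) normsq_eq_0_iff L by auto
    then show False using ne by simp
  qed
  moreover have "(deriv ^^ 4) V0 x = q0 x * V0 x + q1 x * deriv V0 x + q2 x * deriv (deriv V0) x" for x
    by (simp add: numeral_eq_Suc d V4_def)
  ultimately show thesis using that sm Ln by blast
qed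

end

section \<open>Steklov averages\<close>

lemma weak_deriv_shift: assumes "weak_deriv f f1" shows "weak_deriv (\<lambda>x. f (x + h)) (\<lambda>x. f1 (x + h))"
  unfolding weak_deriv_def
proof (intro allI impI)
  fix \<phi> assume \<phi>: "test1 \<phi>"
  define \<eta> where "\<eta> = (\<lambda>x. \<phi> (1 * x + - h))"
  obtain R where R: "\<And>x. \<bar>x\<bar> > R \<Longrightarrow> \<phi> x = 0" using \<phi> test1_iff by blast
  have "\<eta> x = 0" if "\<bar>x\<bar> > R + \<bar>h\<bar>" for x unfolding \<eta>_def using that by (intro R) linarith
  then have \<eta>: "test1 \<eta>" using \<phi> smooth1_affine[of \<phi> 1 "-h"] unfolding test1_iff \<eta>_def by blast
  have "(\<eta> has_real_derivative deriv \<phi> (x - h)) (at x)" for x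
  proof -
    have "(\<phi> has_real_derivative deriv \<phi> (x - h)) (at (x - h))" using \<phi> smooth1_DERIV test1_iff by blast
    then have "((\<lambda>x. \<phi> (x - h)) has_real_derivative deriv \<phi> (x - h) * 1) (at x)"
      by (rule DERIV_chain2) (auto intro!: derivative_eq_intros)
    then show ?thesis by (simp add: \<eta>_def)
  qed
  then have d: "deriv \<eta> x = deriv \<phi> (x - h)" for x by (rule DERIV_imp_deriv)
  have "(\<integral>x. f (x + h) * deriv \<phi> x \<partial>lborel) = (\<integral>x. f x * deriv \<eta> x \<partial>lborel)"
    using lborel_integral_real_affine[of 1 "\<lambda>x. f x * deriv \<eta> x" h] by (simp add: d add.commute)
  also have "\<dots> = - (\<integral>x. f1 x * \<eta> x \<partial>lborel)" using assms \<eta> unfolding weak_deriv_def by blast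
  also have "(\<integral>x. f1 x * \<eta> x \<partial>lborel) = (\<integral>x. f1 (x + h) * \<phi> x \<partial>lborel)"
    using lborel_integral_real_affine[of 1 "\<lambda>x. f1 x * \<eta> x" h] by (simp add: \<eta>_def add.commute)
  finally show "(\<integral>x. f (x + h) * deriv \<phi> x \<partial>lborel) = - (\<integral>x. f1 (x + h) * \<phi> x \<partial>lborel)" .
qed

lemma H1R_shift: "H1R f f1 \<Longrightarrow> H1R (\<lambda>x. f (x + h)) (\<lambda>x. f1 (x + h))"
  by (simp add: H1R_def L2R_shift weak_deriv_shift)

lemma L2R_0: "L2R (\<lambda>x. 0)"
  by (simp add: L2R_def)

lemma H1R_cmult: "H1R f f1 \<Longrightarrow> H1R (\<lambda>x. c * f x) (\<lambda>x. c * f1 x)"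
  using H1R_lincomb[of "\<lambda>x. 0" "\<lambda>x. 0" f f1 c] by (simp add: H1R_def L2R_0 weak_deriv_def)

lemma H2R_cmult: "H2R f f1 f2 \<Longrightarrow> H2R (\<lambda>x. c * f x) (\<lambda>x. c * f1 x) (\<lambda>x. c * f2 x)"
  by (simp add: H2R_def H1R_cmult)

text \<open>The mean of \<open>f\<close> over [x, x + h], written as a difference quotient of the
  primitive: it gains one derivative, and for \<open>f\<close> in H^1 its derivative is the mean of
  the derivative.\<close>

definition steklov :: "real \<Rightarrow> (real \<Rightarrow> real) \<Rightarrow> real \<Rightarrow> real" where
  "steklov h f x = (prim f (x + h) - prim f x) / h"

text \<open>Cauchy-Schwarz bounds the square of a mean by the mean of the square; integrating over x
  with \<open>window_integral\<close> gives back the full norm. The constant 1 matters, since strict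
  inequalities have to survive averaging.\<close>

lemma steklov_L2:
  assumes f: "L2R f" and h: "0 < h"
  shows "L2R (steklov h f)" "normsq (steklov h f) \<le> normsq f"
proof -
  note coeff_p = prim_continuous[OF L2R_loc_int[OF f]]
  have "continuous_on UNIV (steklov h f)" unfolding steklov_def
    using h by (intro continuous_intros coeff_p continuous_on_compose2[OF coeff_p]) auto
  then have m: "steklov h f \<in> borel_measurable borel" by (rule borel_measurable_continuous_onI)
  have le: "(steklov h f x)\<^sup>2 \<le> normsq_on f x (x + h) / h" for x
  proof -
    have "(steklov h f x)\<^sup>2 = (prim f (x + h) - prim f x)\<^sup>2 / h\<^sup>2" by (simp add: steklov_def power_divide)
    also have "\<dots> \<le> ((x + h - x) * normsq_on f x (x + h)) / h\<^sup>2"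
      using h by (intro divide_right_mono prim_diff_sq_le f) auto
    also have "\<dots> = normsq_on f x (x + h) / h" using h by (simp add: power2_eq_square)
    finally show ?thesis .
  qed
  have i: "integrable lborel (\<lambda>x. normsq_on f x (x + h) / h)" using window_integral(1)[OF f] h by simp
  have "integrable lborel (\<lambda>x. (steklov h f x)\<^sup>2)"
  proof (rule Bochner_Integration.integrable_bound[OF i])
    show "AE x in lborel. norm ((steklov h f x)\<^sup>2) \<le> norm (normsq_on f x (x + h) / h)"
      using le by (intro AE_I2) (smt (verit) real_norm_def zero_le_power2)
  qed (use m in simp)
  then show L: "L2R (steklov h f)" using m by (simp add: L2R_def)
  have "normsq (steklov h f) \<le> (\<integral>x. normsq_on f x (x + h) / h \<partial>lborel)"
    unfolding normsq_def by (intro integral_mono L2R_int L i le)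
  also have "\<dots> = normsq f" using window_integral(2)[OF f, of h] h by simp
  finally show "normsq (steklov h f) \<le> normsq f" .
qed

text \<open>Averages do not increase either norm on the left, and the potential term converges
  because \<open>p\<close> has compact support and the averages are uniformly bounded; hence the
  strict inequality persists for small h. Applied to the H^1 functions behind \<open>Mc\<close> and
  \<open>S_hor\<close>, it yields competitors in H^2.\<close>

lemma H2R_of_H1R_form:
  assumes u: "H1R u u1" and c: "0 \<le> c0" "0 \<le> c1"
    and p: "bdd_meas p" "\<And>x. \<bar>x\<bar> > R \<Longrightarrow> p x = 0"
    and lt: "c0 * normsq u + c1 * normsq u1 < wprod p u u"
  obtains w w1 w2 where "H2R w w1 w2" "c0 * normsq w + c1 * normsq w1 < wprod p w w"
proof -
  obtain U c where U: "\<And>x. U x = c + prim u1 x" "AE x in lborel. u x = U x" "H1R U u1" "continuous_on UNIV U"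
    using H1R_rep[OF u] by metis
  have L: "L2R U" "L2R u1" "L2R u" using U u by (auto simp: H1R_def)
  have pm: "p \<in> borel_measurable borel" using p by (simp add: bdd_meas_def)
  have "normsq u = normsq U" unfolding normsq_def using U(2) L2R_borel L
    by (intro integral_cong_AE) (auto elim: eventually_mono)
  moreover have "wprod p u u = wprod p U U" by (intro wprod_cong_AE U L2R_borel L pm)
  ultimately have lt': "c0 * normsq U + c1 * normsq u1 < wprod p U U" using lt by simp
  define h where "h n = inverse (real (Suc n))" for n
  have h0: "h n > 0" for n by (simp add: h_def)
  define W where "W n = steklov (h n) U" for n
  define W1 where "W1 n = steklov (h n) u1" for n
  define W2 where "W2 n = (\<lambda>x. (1 / h n) * (u1 (x + h n) - u1 x))" for n
  have W1eq: "W1 n x = (1 / h n) * (U (x + h n) - U x)" for n x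
    using U(1) by (simp add: W1_def steklov_def)
  have DW: "(W n has_real_derivative W1 n x) (at x)" for n x
  proof -
    note D = prim_DERIV[OF U(4)]
    have "((\<lambda>x. prim U (x + h n)) has_real_derivative U (x + h n) * 1) (at x)"
      by (rule DERIV_chain2[OF D]) (auto intro!: derivative_eq_intros)
    from DERIV_cdivide[OF DERIV_diff[OF this D]]
    show ?thesis unfolding W_def W1eq steklov_def by simp
  qed
  have cW1: "continuous_on UNIV (W1 n)" for n
    unfolding W1eq by (intro continuous_intros U continuous_on_compose2[OF U(4)]) auto
  have LW: "L2R (W n)" "L2R (W1 n)" for n unfolding W_def W1_def by (intro steklov_L2 L h0)+
  have inc: "H1R (\<lambda>x. U (x + h n) + (-1) * U x) (\<lambda>x. u1 (x + h n) + (-1) * u1 x)" for n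
    by (intro H1R_lincomb H1R_shift U)
  have "H1R (W1 n) (W2 n)" for n
    using H1R_cmult[OF inc, of "1 / h n" n] by (simp add: W1eq[abs_def] W2_def)
  then have H2: "H2R (W n) (W1 n) (W2 n)" for n
    using LW weak_deriv_DERIV[OF DW cW1] by (simp add: H2R_def H1R_def)
  \<comment> \<open>The mean equals a value \<open>U y\<close> with y in the window, and the Hoelder
    bound compares it with \<open>U x\<close>.\<close>
  have close: "\<bar>W n x - U x\<bar> \<le> sqrt (h n * normsq u1)" for n x
  proof -
    obtain y where y: "x < y" "y < x + h n" "prim U (x + h n) - prim U x = (x + h n - x) * U y"
      using MVT2[of x "x + h n" "prim U" U] prim_DERIV[OF U(4)] h0[of n] by auto
    then have "W n x = U y" using h0[of n] by (simp add: W_def steklov_def)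
    moreover have "(U y - U x)\<^sup>2 \<le> h n * normsq u1"
    proof -
      have "(U y - U x)\<^sup>2 = (prim u1 y - prim u1 x)\<^sup>2" using U(1) by simp
      also have "\<dots> \<le> (y - x) * normsq_on u1 x y" using y by (intro prim_diff_sq_le L) auto
      also have "\<dots> \<le> h n * normsq u1" using y normsq_on_le[OF L(2)] normsq_nonneg[of u1]
        by (intro mult_mono) (auto simp: normsq_on_def normsq_nonneg)
      finally show ?thesis .
    qed
    ultimately show ?thesis by (simp add: real_le_rsqrt)
  qed
  have hlim: "h \<longlonglongrightarrow> 0" unfolding h_def by (rule LIMSEQ_inverse_real_of_nat)
  have Wlim: "(\<lambda>n. W n x) \<longlonglongrightarrow> U x" for x
  proof -
    have "(\<lambda>n. sqrt (h n * normsq u1)) \<longlonglongrightarrow> sqrt (0 * normsq u1)" by (intro tendsto_intros hlim)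
    then have l: "(\<lambda>n. sqrt (h n * normsq u1)) \<longlonglongrightarrow> 0" by simp
    have "(\<lambda>n. W n x - U x) \<longlonglongrightarrow> 0"
      by (rule Lim_null_comparison[OF always_eventually l]) (simp add: close)
    then show ?thesis by (rule LIM_zero_cancel)
  qed
  obtain Cp where Cp: "\<And>x. \<bar>p x\<bar> \<le> Cp" using p(1) unfolding bdd_meas_def by blast
  \<comment> \<open>A bound for all averages at once: the sup bound of \<open>U\<close> plus the
    largest possible deviation, using \<open>h n \<le> 1\<close>.\<close>
  define S where "S = sqrt (2 * normsq U + 2 * normsq u1) + sqrt (normsq u1)"
  have Ub: "\<bar>U x\<bar> \<le> sqrt (2 * normsq U + 2 * normsq u1)" for x
  proof -
    have "(U x)\<^sup>2 \<le> 2 * normsq_on U x (x + 1) + 2 * normsq_on u1 x (x + 1)" by (rule sup_sq_le[OF L(1,2) U(1)])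
    also have "\<dots> \<le> 2 * normsq U + 2 * normsq u1" using normsq_on_le L by (intro add_mono mult_left_mono) auto
    finally show ?thesis by (simp add: real_le_rsqrt)
  qed
  have Wb: "\<bar>W n x\<bar> \<le> S" for n x
  proof -
    have "h n * normsq u1 \<le> 1 * normsq u1" by (intro mult_right_mono normsq_nonneg) (simp add: h_def inverse_le_1_iff)
    then have "sqrt (h n * normsq u1) \<le> sqrt (normsq u1)" by simp
    then show ?thesis using close[of n x] Ub[of x] unfolding S_def by linarith
  qed
  have "(\<lambda>n. wprod p (W n) (W n)) \<longlonglongrightarrow> wprod p U U"
    unfolding wprod_def
  proof (rule integral_dominated_convergence[where w = "\<lambda>x. Cp * S\<^sup>2 * indicator {-R..R} x"])
    show "(\<lambda>x. p x * U x * U x) \<in> borel_measurable lborel" using pm L2R_borel[OF L(1)] by simp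
    show "(\<lambda>x. p x * W n x * W n x) \<in> borel_measurable lborel" for n using pm L2R_borel[OF LW(1)] by simp
    show "integrable lborel (\<lambda>x. Cp * S\<^sup>2 * indicator {-R..R} x)"
      by (intro integrable_mult_right integrable_indicator_Icc)
    show "AE x in lborel. (\<lambda>n. p x * W n x * W n x) \<longlonglongrightarrow> p x * U x * U x"
      by (intro AE_I2 tendsto_intros Wlim)
    have "\<bar>p x * W n x * W n x\<bar> \<le> Cp * S\<^sup>2 * indicator {-R..R} x" for n x
    proof (cases "\<bar>x\<bar> > R")
      case False
      have "\<bar>p x * W n x * W n x\<bar> = \<bar>p x\<bar> * (\<bar>W n x\<bar> * \<bar>W n x\<bar>)" by (simp add: abs_mult)
      also have "\<dots> \<le> Cp * (S * S)"
        using Cp[of x] Wb[of n x] by (intro mult_mono) auto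
      finally show ?thesis using False by (auto simp: power2_eq_square indicator_def)
    qed (auto simp: p indicator_def)
    then show "AE x in lborel. norm (p x * W n x * W n x) \<le> Cp * S\<^sup>2 * indicator {-R..R} x" for n by simp
  qed
  from order_tendstoD(1)[OF this lt'] obtain n where n: "c0 * normsq U + c1 * normsq u1 < wprod p (W n) (W n)"
    by (auto dest: eventually_happens)
  have "c0 * normsq (W n) + c1 * normsq (W1 n) \<le> c0 * normsq U + c1 * normsq u1"
    unfolding W_def W1_def using c by (intro add_mono mult_left_mono steklov_L2 L h0) auto
  then have "c0 * normsq (W n) + c1 * normsq (W1 n) < wprod p (W n) (W n)" using n by linarith
  then show thesis using that[OF H2] by blast
qed

section \<open>The growth rate\<close>

locale rt_setting =
  fixes L g \<mu> M :: real and vert :: bool and rho rho' :: "real \<Rightarrow> real"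
  assumes L_pos: "L > 0" and g_pos: "g > 0" and mu_pos: "\<mu> > 0"
    and rho_deriv: "\<And>x. (rho has_real_derivative rho' x) (at x)"
    and rho'_smooth: "\<And>n x. ((deriv ^^ n) rho') differentiable (at x)"
    and rho'_supp: "\<exists>R. \<forall>x. \<bar>x\<bar> > R \<longrightarrow> rho' x = 0"
    and rho_bdd: "bounded (range rho)"
    and rho_inf: "Inf (range rho) > 0"
    and rho'_pos: "\<exists>x30. rho' x30 > 0"
    and M_cond: "if vert then 0 < \<bar>M\<bar> \<and> ereal \<bar>M\<bar> < Mc g rho' else M \<noteq> 0"
begin

definition rho_min where "rho_min = Inf (range rho)"

lemma rho_min: "rho_min > 0" "rho_min \<le> rho x"
  using rho_inf rho_bdd by (auto simp: rho_min_def intro!: cINF_lower bounded_imp_bdd_below)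

lemma test1_rho': "test1 rho'"
  using rho'_smooth rho'_supp by (simp add: test1_def)

lemma deriv_rho: "deriv rho = rho'"
  using rho_deriv by (auto intro: DERIV_imp_deriv)

lemma asymp_const_rho: "asymp_const rho"
  using test1_rho' smooth1_antideriv[OF rho_deriv] by (simp add: asymp_const_def deriv_rho test1_iff)

definition rho'_max where "rho'_max = (SOME C. 0 < C \<and> (\<forall>x. \<bar>rho' x\<bar> \<le> C))"

lemma rho'_max: "0 < rho'_max" "\<bar>rho' x\<bar> \<le> rho'_max"
proof -
  have "\<exists>C. 0 < C \<and> (\<forall>x. \<bar>rho' x\<bar> \<le> C)" using test1_bounded[OF test1_rho'] by metis
  from someI_ex[OF this] show "0 < rho'_max" "\<bar>rho' x\<bar> \<le> rho'_max" unfolding rho'_max_def by auto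
qed

lemma bdd_rho: "bdd_meas rho" "bdd_meas rho'"
  using asymp_const_bdd_meas asymp_const_rho test1_imp_ebc test1_rho' by blast+

section \<open>The functionals as combinations of weighted norms\<close>

definition kinetic :: "real \<times> real \<Rightarrow> (real \<Rightarrow> real) \<Rightarrow> (real \<Rightarrow> real) \<Rightarrow> real" where
  "kinetic \<xi> u u1 = (norm \<xi>)\<^sup>2 * wprod rho u u + wprod rho u1 u1"

lemma kinetic_eq: assumes "L2R u" "L2R u1"
  shows "(\<integral>x. rho x * ((norm \<xi>)\<^sup>2 * (u x)\<^sup>2 + (u1 x)\<^sup>2) \<partial>lborel) = kinetic \<xi> u u1"
proof -
  have "(\<integral>x. rho x * ((norm \<xi>)\<^sup>2 * (u x)\<^sup>2 + (u1 x)\<^sup>2) \<partial>lborel)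
    = (\<integral>x. (norm \<xi>)\<^sup>2 * (rho x * u x * u x) + rho x * u1 x * u1 x \<partial>lborel)"
    by (simp add: power2_eq_square algebra_simps)
  then show ?thesis unfolding kinetic_def wprod_def using bdd_rho assms by (simp add: bdd_meas_integrable)
qed

lemma H2R_D: assumes "H2R u u1 u2" shows "L2R u" "L2R u1" "L2R u2"
  using assms by (auto simp: H2R_def H1R_def)

lemma wprod_g: "wprod (\<lambda>x. g * rho' x) u u = g * wprod rho' u u"
  by (simp add: wprod_def mult.assoc)

definition energy0 where "energy0 \<xi> u u1 u2 =
    (if vert then M\<^sup>2 * (normsq u1 + normsq u2 / (norm \<xi>)\<^sup>2) else M\<^sup>2 * (fst \<xi>)\<^sup>2 * (normsq u + normsq u1 / (norm \<xi>)\<^sup>2))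
     - g * wprod rho' u u"

lemma energy0_vert: "vert \<Longrightarrow> energy0 \<xi> u u1 u2 = M\<^sup>2 * (normsq u1 + normsq u2 / (norm \<xi>)\<^sup>2) - g * wprod rho' u u"
  and energy0_hor: "\<not> vert \<Longrightarrow> energy0 \<xi> u u1 u2 = M\<^sup>2 * (fst \<xi>)\<^sup>2 * (normsq u + normsq u1 / (norm \<xi>)\<^sup>2) - g * wprod rho' u u"
  unfolding energy0_def by (simp_all only: if_True if_False)

lemma E0_eq: assumes "H2R u u1 u2"
  shows "E0 vert g rho' M \<xi> u u1 u2 = energy0 \<xi> u u1 u2"
proof -
  note L = H2R_D[OF assms]
  note i = L2R_int[OF L(1)] L2R_int[OF L(2)] L2R_int[OF L(3)] bdd_meas_integrable[OF bdd_rho(2) L(1) L(1)]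
  show ?thesis
  proof (cases vert)
    case True
    have "(\<integral>x. M\<^sup>2 * ((u1 x)\<^sup>2 + (u2 x)\<^sup>2 / (norm \<xi>)\<^sup>2) - g * rho' x * (u x)\<^sup>2 \<partial>lborel)
      = (\<integral>x. M\<^sup>2 * ((u1 x)\<^sup>2 + (u2 x)\<^sup>2 / (norm \<xi>)\<^sup>2) - g * (rho' x * u x * u x) \<partial>lborel)"
      by (simp add: power2_eq_square mult.assoc)
    then show ?thesis unfolding energy0_vert[OF True] using True i by (simp add: E0_def normsq_def wprod_def)
  next
    case False
    have "(\<integral>x. M\<^sup>2 * (fst \<xi>)\<^sup>2 * ((u x)\<^sup>2 + (u1 x)\<^sup>2 / (norm \<xi>)\<^sup>2) - g * rho' x * (u x)\<^sup>2 \<partial>lborel)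
      = (\<integral>x. M\<^sup>2 * (fst \<xi>)\<^sup>2 * ((u x)\<^sup>2 + (u1 x)\<^sup>2 / (norm \<xi>)\<^sup>2) - g * (rho' x * u x * u x) \<partial>lborel)"
      by (simp add: power2_eq_square mult.assoc)
    then show ?thesis unfolding energy0_hor[OF False] using False i by (simp add: E0_def normsq_def wprod_def)
  qed
qed

definition energy1 where "energy1 \<xi> u u1 u2 =
   \<mu> * (4 * (norm \<xi>)\<^sup>2 * normsq u1 + normsq (\<lambda>x. (norm \<xi>)\<^sup>2 * u x + u2 x))" for \<xi> :: "real \<times> real"

lemma E1_eq: assumes "H2R u u1 u2" shows "E1 \<mu> \<xi> u u1 u2 = energy1 \<xi> u u1 u2"
proof -
  note L = H2R_D[OF assms]
  show ?thesis using L2R_int[OF L(2)] L2R_int[OF L2R_add[OF L2R_cmult[OF L(1)] L(3)], of "(norm \<xi>)\<^sup>2"]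
    by (simp add: E1_def energy1_def normsq_def)
qed

definition energy where "energy \<xi> s u u1 u2 = (norm \<xi>)\<^sup>2 * energy0 \<xi> u u1 u2 + s * energy1 \<xi> u u1 u2"

text \<open>A bound for - \<alpha>, hence for the square of the growth rate, that is independent of
  \<xi>: the destabilising term is at most g |\<xi>|^2 \<open>rho'_max\<close> times the squared
  norm of u, and the constraint contains |\<xi>|^2 times at least \<open>rho_min\<close> times the
  same quantity. It makes the supremum \<Lambda> finite.\<close>

definition growth_bd where "growth_bd = g * rho'_max / rho_min"

lemma growth_bd_pos: "growth_bd > 0"
  using g_pos rho'_max rho_min by (simp add: growth_bd_def)

lemma energy1_nonneg: "0 \<le> energy1 \<xi> u u1 u2"
  unfolding energy1_def using mu_pos normsq_nonneg by simp

lemma kinetic_ge: assumes "L2R u" "L2R u1" shows "rho_min * (norm \<xi>)\<^sup>2 * normsq u + rho_min * normsq u1 \<le> kinetic \<xi> u u1"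
proof -
  have "rho_min * normsq u \<le> wprod rho u u" "rho_min * normsq u1 \<le> wprod rho u1 u1" using bdd_rho rho_min assms by (auto intro!: wprod_ge)
  then have "(norm \<xi>)\<^sup>2 * (rho_min * normsq u) + rho_min * normsq u1 \<le> kinetic \<xi> u u1"
    unfolding kinetic_def by (intro add_mono mult_left_mono) auto
  then show ?thesis by (simp add: algebra_simps)
qed

lemma kinetic_nonneg: assumes "L2R u" "L2R u1" shows "0 \<le> kinetic \<xi> u u1"
proof -
  have "0 \<le> rho_min * (norm \<xi>)\<^sup>2 * normsq u + rho_min * normsq u1" using rho_min(1) normsq_nonneg by simp
  then show ?thesis using kinetic_ge[OF assms, of \<xi>] by linarith
qed

lemma energy0_ge: assumes "H2R u u1 u2" shows "- growth_bd * kinetic \<xi> u u1 \<le> (norm \<xi>)\<^sup>2 * energy0 \<xi> u u1 u2"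
proof -
  note L = H2R_D[OF assms]
  have "rho' x \<le> rho'_max" for x using rho'_max(2)[of x] by linarith
  then have 1: "wprod rho' u u \<le> rho'_max * normsq u" by (intro wprod_le bdd_rho L)
  have "(norm \<xi>)\<^sup>2 * (g * wprod rho' u u) \<le> (norm \<xi>)\<^sup>2 * (g * (rho'_max * normsq u))"
    using 1 g_pos by (intro mult_left_mono) auto
  also have "\<dots> = growth_bd * (rho_min * (norm \<xi>)\<^sup>2 * normsq u)" using rho_min(1) by (simp add: growth_bd_def)
  also have "\<dots> \<le> growth_bd * kinetic \<xi> u u1"
  proof -
    have "0 \<le> rho_min * normsq u1" using rho_min(1) normsq_nonneg by simp
    then show ?thesis using kinetic_ge[OF L(1,2), of \<xi>] growth_bd_pos by (intro mult_left_mono) linarith+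
  qed
  finally have "(norm \<xi>)\<^sup>2 * (g * wprod rho' u u) \<le> growth_bd * kinetic \<xi> u u1" .
  moreover have "0 \<le> (norm \<xi>)\<^sup>2 * (if vert then M\<^sup>2 * (normsq u1 + normsq u2 / (norm \<xi>)\<^sup>2) else M\<^sup>2 * (fst \<xi>)\<^sup>2 * (normsq u + normsq u1 / (norm \<xi>)\<^sup>2))"
    using normsq_nonneg by auto
  ultimately show ?thesis unfolding energy0_def right_diff_distrib by linarith
qed

lemma energy_ge: assumes "H2R u u1 u2" "0 \<le> s" shows "- growth_bd * kinetic \<xi> u u1 \<le> energy \<xi> s u u1 u2"
  using energy0_ge[OF assms(1), of \<xi>] mult_nonneg_nonneg[OF assms(2) energy1_nonneg, of \<xi> u u1 u2] unfolding energy_def by linarith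

lemma wprod_cmult: "wprod w (\<lambda>x. c * f x) (\<lambda>x. c * f x) = c\<^sup>2 * wprod w f f"
proof -
  have "wprod w (\<lambda>x. c * f x) (\<lambda>x. c * f x) = (\<integral>x. c\<^sup>2 * (w x * f x * f x) \<partial>lborel)"
    unfolding wprod_def by (simp add: power2_eq_square algebra_simps)
  then show ?thesis by (simp add: wprod_def)
qed

lemma kinetic_cmult: "kinetic \<xi> (\<lambda>x. c * u x) (\<lambda>x. c * u1 x) = c\<^sup>2 * kinetic \<xi> u u1"
  unfolding kinetic_def wprod_cmult by (simp add: algebra_simps)

lemma energy_cmult: "energy \<xi> s (\<lambda>x. c * u x) (\<lambda>x. c * u1 x) (\<lambda>x. c * u2 x) = c\<^sup>2 * energy \<xi> s u u1 u2"
proof -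
  have "normsq (\<lambda>x. (norm \<xi>)\<^sup>2 * (c * u x) + c * u2 x) = c\<^sup>2 * normsq (\<lambda>x. (norm \<xi>)\<^sup>2 * u x + u2 x)"
    using normsq_cmult[of c "\<lambda>x. (norm \<xi>)\<^sup>2 * u x + u2 x"] by (simp add: algebra_simps)
  then show ?thesis unfolding energy_def energy0_def energy1_def normsq_cmult wprod_cmult
    by (simp add: algebra_simps add_divide_distrib)
qed

section \<open>The infimum \<alpha> as a function of s\<close>

abbreviation alph where "alph \<xi> s \<equiv> alpha vert g \<mu> rho rho' M \<xi> s"

lemma alpha_eq: "alph \<xi> s = Inf ((\<lambda>(u, u1, u2). energy \<xi> s u u1 u2) ` Adm rho \<xi>)"
  unfolding alpha_def by (intro arg_cong[where f = Inf] image_cong) (auto simp: Adm_def E0_eq E1_eq energy_def)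

lemma Adm_iff: "(u, u1, u2) \<in> Adm rho \<xi> \<longleftrightarrow> H2R u u1 u2 \<and> kinetic \<xi> u u1 = 1"
proof -
  have "(u, u1, u2) \<in> Adm rho \<xi> \<longleftrightarrow> H2R u u1 u2 \<and> (\<integral>x. rho x * ((norm \<xi>)\<^sup>2 * (u x)\<^sup>2 + (u1 x)\<^sup>2) \<partial>lborel) = 1"
    by (simp add: Adm_def)
  then show ?thesis using H2R_D(1,2)[of u u1 u2] kinetic_eq[of u u1 \<xi>] by auto
qed

text \<open>An infimum over the empty set would carry no information; a test function of integral 1
  is scaled to satisfy the constraint.\<close>

lemma Adm_nonempty: assumes "\<xi> \<noteq> 0" shows "Adm rho \<xi> \<noteq> {}"
proof -
  obtain \<eta> where \<eta>: "test1 \<eta>" "(\<integral>x. \<eta> x \<partial>lborel) = 1" using test1_unit .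
  have H: "H2R \<eta> (deriv \<eta>) (deriv (deriv \<eta>))" by (rule test1_H2R[OF \<eta>(1)])
  note L = H2R_D[OF H]
  have "normsq \<eta> \<noteq> 0"
  proof
    assume "normsq \<eta> = 0"
    then have "AE x in lborel. \<eta> x = 0" using normsq_eq_0_iff L by blast
    then have "(\<integral>x. \<eta> x \<partial>lborel) = 0" by (rule integral_eq_zero_AE)
    then show False using \<eta> by simp
  qed
  then have "normsq \<eta> > 0" using normsq_nonneg[of \<eta>] by simp
  then have "0 < rho_min * (norm \<xi>)\<^sup>2 * normsq \<eta> + rho_min * normsq (deriv \<eta>)"
    using rho_min(1) assms normsq_nonneg by (intro add_pos_nonneg) auto
  then have kinetic: "kinetic \<xi> \<eta> (deriv \<eta>) > 0" using kinetic_ge[OF L(1,2), of \<xi>] by linarith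
  define c where "c = 1 / sqrt (kinetic \<xi> \<eta> (deriv \<eta>))"
  have "c\<^sup>2 * kinetic \<xi> \<eta> (deriv \<eta>) = 1" using kinetic by (simp add: c_def power_divide)
  then have "(\<lambda>x. c * \<eta> x, \<lambda>x. c * deriv \<eta> x, \<lambda>x. c * deriv (deriv \<eta>) x) \<in> Adm rho \<xi>"
    unfolding Adm_iff kinetic_cmult using H2R_cmult[OF H] by blast
  then show ?thesis by blast
qed

lemma Adm_bdd: assumes "0 \<le> s" shows "bdd_below ((\<lambda>(u, u1, u2). energy \<xi> s u u1 u2) ` Adm rho \<xi>)"
proof (rule bdd_belowI)
  fix y assume "y \<in> (\<lambda>(u, u1, u2). energy \<xi> s u u1 u2) ` Adm rho \<xi>"
  then obtain u u1 u2 where "(u, u1, u2) \<in> Adm rho \<xi>" "y = energy \<xi> s u u1 u2" by auto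
  then show "- growth_bd \<le> y" using energy_ge[of u u1 u2 s \<xi>] assms by (simp add: Adm_iff)
qed

lemma alpha_ge: assumes "\<xi> \<noteq> 0" "0 \<le> s" shows "- growth_bd \<le> alph \<xi> s"
  unfolding alpha_eq
proof (rule cINF_greatest[OF Adm_nonempty[OF assms(1)]])
  fix z assume "z \<in> Adm rho \<xi>"
  then show "- growth_bd \<le> (case z of (u, u1, u2) \<Rightarrow> energy \<xi> s u u1 u2)"
    using energy_ge[of _ _ _ s \<xi>] assms by (cases z) (fastforce simp: Adm_iff)
qed

lemma alpha_le_Adm: assumes "0 \<le> s" "(u, u1, u2) \<in> Adm rho \<xi>" shows "alph \<xi> s \<le> energy \<xi> s u u1 u2"
  unfolding alpha_eq using cINF_lower[OF Adm_bdd[OF assms(1)] assms(2)] by simp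

text \<open>Scaling to the constraint turns the infimum into a homogeneous inequality on all of H^2,
  which is the nonnegativity of \<open>B\<close> once l^2 = - \<alpha>. If the kinetic term
  vanishes, the general lower bound for the energy already gives 0.\<close>

lemma alpha_le: assumes "0 \<le> s" "H2R u u1 u2" shows "alph \<xi> s * kinetic \<xi> u u1 \<le> energy \<xi> s u u1 u2"
proof (cases "kinetic \<xi> u u1 = 0")
  case True then show ?thesis using energy_ge[OF assms(2,1), of \<xi>] by simp
next
  case False
  then have kinetic: "kinetic \<xi> u u1 > 0" using kinetic_nonneg H2R_D[OF assms(2)] by (metis less_eq_real_def)
  define c where "c = 1 / sqrt (kinetic \<xi> u u1)"
  have c2: "c\<^sup>2 = 1 / kinetic \<xi> u u1" using kinetic by (simp add: c_def power_divide)
  have "(\<lambda>x. c * u x, \<lambda>x. c * u1 x, \<lambda>x. c * u2 x) \<in> Adm rho \<xi>"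
    unfolding Adm_iff kinetic_cmult c2 using H2R_cmult[OF assms(2)] kinetic by simp
  from alpha_le_Adm[OF assms(1) this] have "alph \<xi> s \<le> energy \<xi> s u u1 u2 / kinetic \<xi> u u1"
    unfolding energy_cmult c2 by simp
  then show ?thesis using kinetic by (simp add: pos_le_divide_eq)
qed

lemma alpha_mono: assumes "\<xi> \<noteq> 0" "0 \<le> s" "s \<le> t" shows "alph \<xi> s \<le> alph \<xi> t"
  unfolding alpha_eq[of \<xi> t]
proof (rule cINF_greatest[OF Adm_nonempty[OF assms(1)]])
  fix z assume "z \<in> Adm rho \<xi>"
  then obtain u u1 u2 where z: "z = (u, u1, u2)" "(u, u1, u2) \<in> Adm rho \<xi>" by (cases z) auto
  have "alph \<xi> s \<le> energy \<xi> s u u1 u2" using alpha_le_Adm z assms by blast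
  also have "\<dots> \<le> energy \<xi> t u u1 u2" unfolding energy_def using assms(3) energy1_nonneg by (intro add_left_mono mult_right_mono)
  finally show "alph \<xi> s \<le> (case z of (u, u1, u2) \<Rightarrow> energy \<xi> t u u1 u2)" using z by simp
qed

text \<open>For each admissible function the energy is affine in s, so \<alpha> is an infimum of
  affine functions and hence concave; a finite concave function on an open interval is
  continuous.\<close>

lemma alpha_continuous: assumes "\<xi> \<noteq> 0" shows "continuous_on {0<..} (alph \<xi>)"
proof -
  have "convex_on {0<..} (\<lambda>s. - alph \<xi> s)"
    unfolding convex_on_def
  proof (intro conjI ballI allI impI)
    fix x y u v :: real assume a: "x \<in> {0<..}" "y \<in> {0<..}" "0 \<le> u" "0 \<le> v" "u + v = 1"
    have "u * alph \<xi> x + v * alph \<xi> y \<le> alph \<xi> (u * x + v * y)"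
      unfolding alpha_eq[of \<xi> "u * x + v * y"]
    proof (rule cINF_greatest[OF Adm_nonempty[OF assms]])
      fix z assume "z \<in> Adm rho \<xi>"
      then obtain w w1 w2 where z: "z = (w, w1, w2)" "(w, w1, w2) \<in> Adm rho \<xi>" by (cases z) auto
      have "u * alph \<xi> x + v * alph \<xi> y \<le> u * energy \<xi> x w w1 w2 + v * energy \<xi> y w w1 w2"
        using a z by (intro add_mono mult_left_mono alpha_le_Adm) auto
      also have "\<dots> = (u + v) * ((norm \<xi>)\<^sup>2 * energy0 \<xi> w w1 w2) + (u * x + v * y) * energy1 \<xi> w w1 w2"
        unfolding energy_def by (simp add: algebra_simps)
      also have "\<dots> = energy \<xi> (u * x + v * y) w w1 w2" using a by (simp add: energy_def)
      finally show "u * alph \<xi> x + v * alph \<xi> y \<le> (case z of (w, w1, w2) \<Rightarrow> energy \<xi> (u * x + v * y) w w1 w2)" using z by simp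
    qed
    then show "- alph \<xi> (u *\<^sub>R x + v *\<^sub>R y) \<le> u * - alph \<xi> x + v * - alph \<xi> y" by simp
  qed simp
  then have "continuous_on {0<..} (\<lambda>s. - alph \<xi> s)" by (rule convex_on_continuous[rotated]) simp
  from continuous_on_minus[OF this] show ?thesis by simp
qed

section \<open>The growth rate as a fixed point\<close>

abbreviation growth where "growth \<xi> \<equiv> lam vert g \<mu> rho rho' M \<xi>"

text \<open>The function s^2 + \<alpha>(\<xi>, s) is negative for some small s, thanks to the
  competitor with negative \<open>E0\<close>, and nonnegative for large s, since \<alpha> is bounded
  below; a zero exists by continuity. It is unique because s increases while sqrt(- \<alpha>) does
  not, so the \<open>THE\<close> in \<open>lam\<close> denotes it.\<close>

lemma lam_props:
  assumes \<xi>: "\<xi> \<noteq> 0" and u: "H2R u u1 u2" "energy0 \<xi> u u1 u2 < 0"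
  shows "0 < growth \<xi>" "(growth \<xi>)\<^sup>2 = - alph \<xi> (growth \<xi>)" "(growth \<xi>)\<^sup>2 \<le> growth_bd"
proof -
  define j e0 e1 where "j = kinetic \<xi> u u1" and "e0 = (norm \<xi>)\<^sup>2 * energy0 \<xi> u u1 u2" and "e1 = energy1 \<xi> u u1 u2"
  have e0: "e0 < 0" unfolding e0_def using u \<xi> by (intro mult_pos_neg) auto
  have e1: "0 \<le> e1" unfolding e1_def by (rule energy1_nonneg)
  have j: "j > 0"
  proof -
    have "0 < growth_bd * j" using energy0_ge[OF u(1), of \<xi>] e0 by (simp add: j_def e0_def)
    then show ?thesis using growth_bd_pos by (simp add: zero_less_mult_iff)
  qed
  \<comment> \<open>Small enough for s1 (j + e1) to use up at most half of - e0; the cap at 1 allows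
    s1^2 to be replaced by s1.\<close>
  define s1 where "s1 = min 1 (- e0 / (2 * (j + e1)))"
  have s1: "0 < s1" "s1 \<le> 1" "s1 * (j + e1) \<le> - e0 / 2"
  proof -
    have je: "0 < j + e1" using j e1 by simp
    have "0 < - e0 / (2 * (j + e1))" using e0 je by (intro divide_pos_pos) auto
    then show "0 < s1" "s1 \<le> 1" unfolding s1_def by auto
    have "s1 * (j + e1) \<le> - e0 / (2 * (j + e1)) * (j + e1)" unfolding s1_def using je by (intro mult_right_mono) auto
    moreover have "- e0 / (2 * d) * d = - e0 / 2" if "0 < d" for d using that by simp
    ultimately show "s1 * (j + e1) \<le> - e0 / 2" using je by metis
  qed
  have neg1: "s1\<^sup>2 + alph \<xi> s1 < 0"
  proof -
    have "alph \<xi> s1 * j \<le> e0 + s1 * e1" using alpha_le[OF _ u(1), of s1 \<xi>] s1 by (simp add: j_def e0_def e1_def energy_def)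
    moreover have "s1\<^sup>2 * j \<le> s1 * j" using s1 j by (simp add: power2_eq_square)
    ultimately have "(s1\<^sup>2 + alph \<xi> s1) * j \<le> e0 + s1 * (j + e1)" by (simp add: algebra_simps)
    also have "\<dots> < 0" using s1 e0 by linarith
    finally show ?thesis using j by (simp add: mult_less_0_iff)
  qed
  \<comment> \<open>Larger than 1, so that s2^2 \<ge> s2 > \<open>growth_bd\<close>, which outweighs
    the lower bound of \<alpha>.\<close>
  define s2 where "s2 = growth_bd + 1"
  have s2: "1 < s2" using growth_bd_pos by (simp add: s2_def)
  have pos2: "0 \<le> s2\<^sup>2 + alph \<xi> s2"
  proof -
    have "s2 * 1 \<le> s2 * s2" using s2 by (intro mult_left_mono) auto
    moreover have "- growth_bd \<le> alph \<xi> s2" using alpha_ge[OF \<xi>, of s2] s2 by simp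
    moreover have "growth_bd = s2 - 1" by (simp add: s2_def)
    ultimately show ?thesis unfolding power2_eq_square by linarith
  qed
  have "\<exists>s\<ge>s1. s \<le> s2 \<and> s\<^sup>2 + alph \<xi> s = 0"
  proof (rule IVT')
    show "continuous_on {s1..s2} (\<lambda>s. s\<^sup>2 + alph \<xi> s)"
      using s1 by (intro continuous_intros continuous_on_subset[OF alpha_continuous[OF \<xi>]]) auto
  qed (use neg1 pos2 s1 s2 in auto)
  then obtain s where s: "s1 \<le> s" "s\<^sup>2 + alph \<xi> s = 0" by blast
  have s0: "0 < s" using s s1 by simp
  have an: "alph \<xi> s < 0" using s(2) s0 by (smt (verit) zero_less_power)
  \<comment> \<open>\<open>Sfrak\<close> is a supremum, so strict inequality needs some t > s with
    \<alpha> < 0 on (0, t): negativity persists to the right of s by continuity, and monotonicity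
    carries it to all smaller arguments.\<close>
  have "isCont (alph \<xi>) s" using alpha_continuous[OF \<xi>] s0 by (simp add: continuous_on_eq_continuous_at)
  then have "((alph \<xi>) \<longlongrightarrow> alph \<xi> s) (at_right s)" unfolding isCont_def by (rule filterlim_mono) (auto simp: at_within_le_at)
  from order_tendstoD(2)[OF this an] have "eventually (\<lambda>t. alph \<xi> t < 0) (at_right s)" .
  then have "eventually (\<lambda>t. alph \<xi> t < 0 \<and> s < t) (at_right s)"
    using eventually_at_right_less by (rule eventually_conj)
  then obtain t where t: "s < t" "alph \<xi> t < 0" by (auto dest!: eventually_happens)
  have "ereal t \<le> Sfrak vert g \<mu> rho rho' M \<xi>"
    unfolding Sfrak_def
  proof (rule Sup_upper, intro CollectI exI[of _ t] conjI refl ballI)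
    show "0 < t" using t s0 by simp
    fix \<tau> assume "\<tau> \<in> {0<..<t}"
    then show "alph \<xi> \<tau> < 0" using alpha_mono[OF \<xi>, of \<tau> t] t by auto
  qed
  then have sS: "ereal s < Sfrak vert g \<mu> rho rho' M \<xi>" using t by (metis less_ereal.simps(1) order_less_le_trans)
  have sq: "s = sqrt (- alph \<xi> s)" using s s0 by (simp add: real_sqrt_unique eq_neg_iff_add_eq_0)
  have "growth \<xi> = s"
    unfolding lam_def
  proof (rule the_equality)
    show "0 < s \<and> ereal s < Sfrak vert g \<mu> rho rho' M \<xi> \<and> s = sqrt (- alph \<xi> s)" using s0 sS sq by blast
    fix r assume r: "0 < r \<and> ereal r < Sfrak vert g \<mu> rho rho' M \<xi> \<and> r = sqrt (- alph \<xi> r)"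
    have "r \<le> s \<or> s \<le> r" by auto
    then show "r = s"
    proof
      assume "r \<le> s"
      then have "alph \<xi> r \<le> alph \<xi> s" using alpha_mono \<xi> r by auto
      then have "sqrt (- alph \<xi> s) \<le> sqrt (- alph \<xi> r)" by simp
      then show ?thesis using r sq \<open>r \<le> s\<close> by linarith
    next
      assume "s \<le> r"
      then have "alph \<xi> s \<le> alph \<xi> r" using alpha_mono \<xi> s0 by auto
      then have "sqrt (- alph \<xi> r) \<le> sqrt (- alph \<xi> s)" by simp
      then show ?thesis using r sq \<open>s \<le> r\<close> by linarith
    qed
  qed
  then show "0 < growth \<xi>" "(growth \<xi>)\<^sup>2 = - alph \<xi> (growth \<xi>)" "(growth \<xi>)\<^sup>2 \<le> growth_bd"
    using s s0 alpha_ge[OF \<xi>, of s] by auto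
qed

section \<open>Negative energy at the frequencies of A^g\<close>

lemma H1_neg_imp_H2_neg:
  assumes u: "H1R u u1" and c: "0 \<le> c0" "0 \<le> c1" and lt: "c0 * normsq u + c1 * normsq u1 < g * wprod rho' u u"
  obtains w w1 w2 where "H2R w w1 w2" "c0 * normsq w + c1 * normsq w1 < g * wprod rho' w w"
proof -
  have "asymp_const (\<lambda>x. g * rho' x)" by (intro asymp_const_cmult test1_imp_ebc test1_rho')
  then have b: "bdd_meas (\<lambda>x. g * rho' x)" by (rule asymp_const_bdd_meas)
  obtain R where R: "\<And>x. \<bar>x\<bar> > R \<Longrightarrow> g * rho' x = 0" using rho'_supp by auto
  show thesis using H2R_of_H1R_form[OF u c b R, of R] lt that unfolding wprod_g by metis
qed

lemma wprod_rho'_eq: "(\<integral>x. g * rho' x * (u x)\<^sup>2 \<partial>lborel) = g * wprod rho' u u"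
  unfolding wprod_def by (simp add: power2_eq_square mult.assoc)

lemma xi_vc_set: assumes "H2R u u1 u2"
  shows "(\<integral>x. g * rho' x * (u x)\<^sup>2 - M\<^sup>2 * (u1 x)\<^sup>2 \<partial>lborel) = g * wprod rho' u u - M\<^sup>2 * normsq u1"
proof -
  note L = H2R_D[OF assms]
  have "(\<integral>x. g * rho' x * (u x)\<^sup>2 - M\<^sup>2 * (u1 x)\<^sup>2 \<partial>lborel) = (\<integral>x. g * (rho' x * u x * u x) - M\<^sup>2 * (u1 x)\<^sup>2 \<partial>lborel)"
    by (simp add: power2_eq_square mult.assoc)
  then show ?thesis unfolding wprod_def normsq_def using bdd_meas_integrable[OF bdd_rho(2) L(1,1)] L2R_int[OF L(2)] by simp
qed

lemma less_esqrt: assumes "ereal \<bar>x\<bar> < esqrt a" shows "ereal (x\<^sup>2) < a"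
  using assms by (cases a) (auto simp: esqrt_def real_less_rsqrt real_sqrt_abs[symmetric] simp del: real_sqrt_abs)

text \<open>The condition |M| < M_c provides an H^1 function, then by averaging an H^2 function,
  with positive denominator, so the set \<open>X\<close> under the infimum is nonempty. Since
  |\<xi>|^2 exceeds its infimum, some quotient in \<open>X\<close> lies below |\<xi>|^2, and
  clearing denominators gives \<open>E0\<close> < 0.\<close>

lemma unstable_vert:
  assumes vert and \<xi>: "\<xi> \<in> Ag vert g rho' M"
  shows "\<xi> \<noteq> 0 \<and> (\<exists>u u1 u2. H2R u u1 u2 \<and> energy0 \<xi> u u1 u2 < 0)"
proof -
  define X where "X = {M\<^sup>2 * (\<integral>x. (\<psi>2 x)\<^sup>2 \<partial>lborel) /
         (\<integral>x. g * rho' x * (\<psi> x)\<^sup>2 - M\<^sup>2 * (\<psi>1 x)\<^sup>2 \<partial>lborel)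
      | \<psi> \<psi>1 \<psi>2. H2R \<psi> \<psi>1 \<psi>2 \<and> (\<integral>x. g * rho' x * (\<psi> x)\<^sup>2 - M\<^sup>2 * (\<psi>1 x)\<^sup>2 \<partial>lborel) > 0}"
  have xv: "xi_vc g rho' M = sqrt (Inf X)" by (simp add: xi_vc_def X_def)
  have X0: "0 \<le> x" if "x \<in> X" for x using that unfolding X_def by (auto intro!: divide_nonneg_pos)
  have "ereal (M\<^sup>2) < Sup {ereal ((\<integral>x. g * rho' x * (\<psi> x)\<^sup>2 \<partial>lborel) / (\<integral>x. (\<psi>1 x)\<^sup>2 \<partial>lborel))
                      | \<psi> \<psi>1. H1R \<psi> \<psi>1 \<and> nonzeroR \<psi>}"
    using M_cond \<open>vert\<close> unfolding Mc_def by (intro less_esqrt) simp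
  then obtain \<psi> \<psi>1 where p: "H1R \<psi> \<psi>1" "M\<^sup>2 < g * wprod rho' \<psi> \<psi> / normsq \<psi>1"
    unfolding less_Sup_iff by (auto simp: wprod_rho'_eq normsq_def)
  have "normsq \<psi>1 \<noteq> 0" using p(2) by auto
  then have "normsq \<psi>1 > 0" using normsq_nonneg[of \<psi>1] by simp
  then have "0 * normsq \<psi> + M\<^sup>2 * normsq \<psi>1 < g * wprod rho' \<psi> \<psi>" using p(2) by (simp add: pos_less_divide_eq)
  then obtain w w1 w2 where w: "H2R w w1 w2" "0 * normsq w + M\<^sup>2 * normsq w1 < g * wprod rho' w w"
    using H1_neg_imp_H2_neg[OF p(1)] by (metis order_refl zero_le_power2)
  then have ne: "X \<noteq> {}" unfolding X_def using xi_vc_set[OF w(1)] by fastforce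
  have I0: "0 \<le> Inf X" using ne X0 by (rule cInf_greatest)
  have nx: "sqrt (Inf X) < norm \<xi>" using \<xi> \<open>vert\<close> by (simp add: Ag_def xv)
  then have "\<xi> \<noteq> 0" using I0 by (auto simp: not_less)
  have "Inf X < (norm \<xi>)\<^sup>2" using nx I0 by (metis norm_ge_zero not_less real_sqrt_le_iff real_sqrt_abs abs_of_nonneg)
  then obtain x where x: "x \<in> X" "x < (norm \<xi>)\<^sup>2" using ne by (meson cInf_lessD)
  then obtain u u1 u2 where u: "H2R u u1 u2" "0 < g * wprod rho' u u - M\<^sup>2 * normsq u1"
    "M\<^sup>2 * normsq u2 / (g * wprod rho' u u - M\<^sup>2 * normsq u1) < (norm \<xi>)\<^sup>2"
    unfolding X_def using xi_vc_set by (auto simp: normsq_def)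
  then have "M\<^sup>2 * normsq u2 < (norm \<xi>)\<^sup>2 * (g * wprod rho' u u - M\<^sup>2 * normsq u1)" by (simp add: pos_divide_less_eq)
  moreover have k: "0 < (norm \<xi>)\<^sup>2" using \<open>\<xi> \<noteq> 0\<close> by simp
  ultimately have "M\<^sup>2 * normsq u2 / (norm \<xi>)\<^sup>2 < g * wprod rho' u u - M\<^sup>2 * normsq u1" by (simp add: pos_divide_less_eq mult.commute)
  then have "energy0 \<xi> u u1 u2 < 0" unfolding energy0_vert[OF \<open>vert\<close>] by (simp add: distrib_left)
  then show ?thesis using u \<open>\<xi> \<noteq> 0\<close> by blast
qed

lemma unstable_test: obtains u u1 u2 where "H2R u u1 u2" "0 < g * wprod rho' u u" "nonzeroR u"
proof -
  obtain x0 where "rho' x0 > 0" using rho'_pos by blast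
  have "isCont rho' x0" using test1_rho' smooth1_DERIV[of rho' x0] test1_iff DERIV_isCont by blast
  then have "eventually (\<lambda>x. rho' x > 0) (at x0)"
    using \<open>rho' x0 > 0\<close> unfolding isCont_def by (rule order_tendstoD(1))
  then obtain d where d: "d > 0" "\<And>x. x \<noteq> x0 \<Longrightarrow> dist x x0 < d \<Longrightarrow> rho' x > 0" unfolding eventually_at by auto
  \<comment> \<open>One side of \<open>x0\<close> suffices, which avoids the centre of the punctured
    neighbourhood supplied by \<open>eventually_at\<close>.\<close>
  define \<phi> where "\<phi> = bump 1 x0 (x0 + d)"
  have t: "test1 \<phi>" by (simp add: \<phi>_def test1_bump)
  note H = test1_H2R[OF t] note L = H2R_D[OF H]
  have pos: "\<phi> x > 0" "rho' x > 0" if "x0 < x" "x < x0 + d" for x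
    using that d(2)[of x] bump_pos_iff[of 1 x0 "x0 + d" x] by (auto simp: \<phi>_def dist_real_def)
  have zero: "\<phi> x = 0" if "\<not> (x0 < x \<and> x < x0 + d)" for x
    unfolding \<phi>_def using that by (intro bump_outside) auto
  have nonneg: "0 \<le> rho' x * \<phi> x * \<phi> x" for x
    using pos[of x] zero[of x] by (cases "x0 < x \<and> x < x0 + d") auto
  have nz: "\<not> (AE x in lborel. \<phi> x = 0)" unfolding \<phi>_def by (rule bump_not_AE_zero) (use d(1) in auto)
  have "wprod rho' \<phi> \<phi> \<noteq> 0"
  proof
    assume "wprod rho' \<phi> \<phi> = 0"
    then have "AE x in lborel. rho' x * \<phi> x * \<phi> x = 0"
      using integral_nonneg_eq_0_iff_AE[OF bdd_meas_integrable[OF bdd_rho(2) L(1,1)]] nonneg by (simp add: wprod_def)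
    then have "AE x in lborel. \<phi> x = 0"
    proof eventually_elim
      case (elim x) then show ?case using pos(2)[of x] zero[of x] by (cases "x0 < x \<and> x < x0 + d") auto
    qed
    then show False using nz by blast
  qed
  moreover have "0 \<le> wprod rho' \<phi> \<phi>" unfolding wprod_def by (intro integral_nonneg_AE AE_I2 nonneg)
  ultimately have "0 < g * wprod rho' \<phi> \<phi>" using g_pos by simp
  then show thesis using that[OF H] nz by (simp add: nonzeroR_def)
qed

text \<open>For \<open>fst \<xi> = 0\<close> the magnetic energy vanishes and a bump where rho' > 0
  already has negative energy. Otherwise |\<xi>| < S gives an H^1 function whose quotient exceeds
  |\<xi>|^2; cleared of denominators this is the H^1 version of \<open>E0\<close> < 0, and averaging
  moves it to H^2.\<close>

lemma unstable_hor:
  assumes "\<not> vert" and \<xi>: "\<xi> \<in> Ag vert g rho' M"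
  shows "\<xi> \<noteq> 0 \<and> (\<exists>u u1 u2. H2R u u1 u2 \<and> energy0 \<xi> u u1 u2 < 0)"
proof -
  have x0: "\<xi> \<noteq> 0" using \<xi> assms(1) by (simp add: Ag_def)
  then have k: "0 < (norm \<xi>)\<^sup>2" by simp
  show ?thesis
  proof (cases "fst \<xi> = 0")
    case True
    obtain u u1 u2 where "H2R u u1 u2" "0 < g * wprod rho' u u" using unstable_test .
    then have "energy0 \<xi> u u1 u2 < 0" unfolding energy0_hor[OF assms(1)] using True by simp
    then show ?thesis using x0 \<open>H2R u u1 u2\<close> by blast
  next
    case False
    define X where "X = {((g * (norm \<xi>)\<^sup>2 * (\<integral>x. rho' x * (\<psi> x)\<^sup>2 \<partial>lborel) / (M * fst \<xi>)\<^sup>2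
                 - (\<integral>x. (\<psi>1 x)\<^sup>2 \<partial>lborel)) / (\<integral>x. (\<psi> x)\<^sup>2 \<partial>lborel))
             | \<psi> \<psi>1. H1R \<psi> \<psi>1 \<and> nonzeroR \<psi>}"
    have lt: "norm \<xi> < sqrt (Sup X)" using \<xi> assms(1) False by (simp add: Ag_def S_hor_def X_def)
    have "(norm \<xi>)\<^sup>2 < Sup X"
      using lt by (meson norm_ge_zero real_le_lsqrt not_le order_less_imp_le real_sqrt_less_iff linorder_not_less)
    moreover have "X \<noteq> {}"
    proof -
      obtain u u1 u2 where "H2R u u1 u2" "nonzeroR u" using unstable_test .
      then show ?thesis unfolding X_def H2R_def by blast
    qed
    ultimately obtain x where "x \<in> X" "(norm \<xi>)\<^sup>2 < x" by (meson less_cSupD)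
    then obtain \<psi> \<psi>1 where p: "H1R \<psi> \<psi>1" "nonzeroR \<psi>"
      "(norm \<xi>)\<^sup>2 < (g * (norm \<xi>)\<^sup>2 * wprod rho' \<psi> \<psi> / (M * fst \<xi>)\<^sup>2 - normsq \<psi>1) / normsq \<psi>"
      unfolding X_def by (auto simp: normsq_def wprod_def power2_eq_square mult.assoc)
    have "normsq \<psi> \<noteq> 0" using p(1,2) normsq_eq_0_iff by (auto simp: nonzeroR_def H1R_def)
    then have n: "0 < normsq \<psi>" using normsq_nonneg[of \<psi>] by simp
    define m where "m = (M * fst \<xi>)\<^sup>2"
    have m: "m > 0" using False assms(1) M_cond by (simp add: m_def)
    have "(norm \<xi>)\<^sup>2 * normsq \<psi> + normsq \<psi>1 < g * (norm \<xi>)\<^sup>2 * wprod rho' \<psi> \<psi> / m"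
      using p(3) n by (simp add: pos_less_divide_eq m_def[symmetric])
    then have "m * ((norm \<xi>)\<^sup>2 * normsq \<psi> + normsq \<psi>1) < g * (norm \<xi>)\<^sup>2 * wprod rho' \<psi> \<psi>"
      using m by (simp add: pos_less_divide_eq mult.commute)
    then have "(m * ((norm \<xi>)\<^sup>2 * normsq \<psi> + normsq \<psi>1)) / (norm \<xi>)\<^sup>2 < g * wprod rho' \<psi> \<psi>"
      using k by (simp add: pos_divide_less_eq algebra_simps)
    moreover have "(m * ((norm \<xi>)\<^sup>2 * normsq \<psi> + normsq \<psi>1)) / (norm \<xi>)\<^sup>2 = m * normsq \<psi> + m / (norm \<xi>)\<^sup>2 * normsq \<psi>1"
      using k x0 by (simp add: field_simps)
    ultimately have "m * normsq \<psi> + m / (norm \<xi>)\<^sup>2 * normsq \<psi>1 < g * wprod rho' \<psi> \<psi>" by simp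
    then obtain w w1 w2 where w: "H2R w w1 w2" "m * normsq w + m / (norm \<xi>)\<^sup>2 * normsq w1 < g * wprod rho' w w"
      using H1_neg_imp_H2_neg[OF p(1), of m "m / (norm \<xi>)\<^sup>2"] m k by (metis divide_nonneg_pos less_imp_le)
    then have "energy0 \<xi> w w1 w2 < 0" unfolding energy0_hor[OF assms(1)]
      by (simp add: m_def power_mult_distrib distrib_left)
    then show ?thesis using w x0 by blast
  qed
qed

lemma unstable: "\<xi> \<in> Ag vert g rho' M \<Longrightarrow> \<xi> \<noteq> 0 \<and> (\<exists>u u1 u2. H2R u u1 u2 \<and> energy0 \<xi> u u1 u2 < 0)"
  using unstable_vert unstable_hor by blast

text \<open>Vertically every sufficiently large |\<xi>| belongs to the set, so (0, n/L) with large n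
  serves; horizontally every nonzero \<xi> with first component 0 belongs to it, so (0, 1/L)
  serves.\<close>

lemma Ag_lattice_nonempty: "Ag vert g rho' M \<inter> lattice L \<noteq> {}"
proof (cases vert)
  case True
  obtain n :: nat where n: "L * \<bar>xi_vc g rho' M\<bar> < real n" using reals_Archimedean2 by blast
  define \<xi> where "\<xi> = (of_int 0 / L, of_int (int n) / L)"
  have "norm \<xi> = real n / L" using L_pos by (simp add: \<xi>_def norm_Pair)
  then have "xi_vc g rho' M < norm \<xi>" using n L_pos by (simp add: pos_less_divide_eq mult.commute) (smt (verit) mult_left_mono abs_ge_self)
  then have "\<xi> \<in> Ag vert g rho' M" using True by (simp add: Ag_def)
  moreover have "\<xi> \<in> lattice L" unfolding lattice_def \<xi>_def by blast
  ultimately show ?thesis by blast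
next
  case False
  define \<xi> where "\<xi> = (of_int 0 / L, of_int 1 / L)"
  have "\<xi> \<in> Ag vert g rho' M" using False L_pos by (simp add: Ag_def \<xi>_def zero_prod_def)
  moreover have "\<xi> \<in> lattice L" unfolding lattice_def \<xi>_def by blast
  ultimately show ?thesis by blast
qed

text \<open>The supremum is positive and finite, so two thirds of it lie strictly below it and some
  lattice frequency exceeds that value; any factor below 1 would do in place of 2/3.\<close>

lemma near_max_growth:
  obtains \<xi> where "\<xi> \<in> lattice L" "\<xi> \<noteq> 0" "0 < growth \<xi>" "(growth \<xi>)\<^sup>2 = - alph \<xi> (growth \<xi>)"
    "2 * Lambda vert g \<mu> rho rho' M L / 3 < growth \<xi>" "growth \<xi> \<le> Lambda vert g \<mu> rho rho' M L"
proof -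
  define S where "S = growth ` (Ag vert g rho' M \<inter> lattice L)"
  have S: "Lambda vert g \<mu> rho rho' M L = Sup S" by (simp add: Lambda_def S_def)
  have pr: "\<xi> \<noteq> 0" "0 < growth \<xi>" "(growth \<xi>)\<^sup>2 = - alph \<xi> (growth \<xi>)" "(growth \<xi>)\<^sup>2 \<le> growth_bd" if "\<xi> \<in> Ag vert g rho' M" for \<xi>
    using unstable[OF that] lam_props by blast+
  have ne: "S \<noteq> {}" using Ag_lattice_nonempty by (simp add: S_def)
  have "x \<le> sqrt growth_bd" if "x \<in> S" for x using that pr(4) by (auto simp: S_def intro!: real_le_rsqrt)
  then have bdd: "bdd_above S" by (meson bdd_aboveI)
  obtain x where x: "x \<in> S" using ne by blast
  have "0 < x" using x pr(2) by (auto simp: S_def)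
  also have "x \<le> Sup S" by (intro cSup_upper x bdd)
  finally have "2 * Sup S / 3 < Sup S" by simp
  then obtain y where y: "y \<in> S" "2 * Sup S / 3 < y" using less_cSupD[OF ne] by blast
  then obtain \<xi> where \<xi>: "\<xi> \<in> Ag vert g rho' M" "\<xi> \<in> lattice L" "y = growth \<xi>" by (auto simp: S_def)
  have "y \<le> Sup S" by (intro cSup_upper y bdd)
  then show thesis using that[of \<xi>] \<xi> pr[OF \<xi>(1)] y by (simp add: S)
qed

end

section \<open>The growing mode\<close>

context rt_setting
begin

text \<open>The magnetic energy is governed by two numbers, one of which vanishes for each direction
  of the field. In terms of them both directions share one form, one differential equation and one
  pressure profile.\<close>

definition mag_h :: "real \<times> real \<Rightarrow> real" where "mag_h \<xi> = (if vert then 0 else M\<^sup>2 * (fst \<xi>)\<^sup>2)"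
definition mag_v :: real where "mag_v = (if vert then M\<^sup>2 else 0)"

lemma mag_h_mv_nonneg: "0 \<le> mag_h \<xi>" "0 \<le> mag_v"
  by (simp_all add: mag_h_def mag_v_def)

lemma mag_h_mv_vert: "vert \<Longrightarrow> mag_h \<xi> = 0" "vert \<Longrightarrow> mag_v = M\<^sup>2"
  and mag_h_mv_hor: "\<not> vert \<Longrightarrow> mag_h \<xi> = M\<^sup>2 * (fst \<xi>)\<^sup>2" "\<not> vert \<Longrightarrow> mag_v = 0"
  unfolding mag_h_def mag_v_def by simp_all

text \<open>Weights of u^2, of u'^2 and of the subtracted potential in E(u, l) + l^2 times the
  constraint functional. \<open>coeff_b\<close> also carries the first viscous term 4 l \<mu>
  |\<xi>|^2, while the second viscous term becomes the \<open>e\<close> part of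
  \<open>B\<close>.\<close>

definition coeff_a :: "real \<times> real \<Rightarrow> real \<Rightarrow> real \<Rightarrow> real" where
  "coeff_a \<xi> l x = l\<^sup>2 * (norm \<xi>)\<^sup>2 * rho x + (norm \<xi>)\<^sup>2 * mag_h \<xi>"
definition coeff_b :: "real \<times> real \<Rightarrow> real \<Rightarrow> real \<Rightarrow> real" where
  "coeff_b \<xi> l x = l\<^sup>2 * rho x + (4 * l * \<mu> * (norm \<xi>)\<^sup>2 + (norm \<xi>)\<^sup>2 * mag_v + mag_h \<xi>)"
definition coeff_p :: "real \<times> real \<Rightarrow> real \<Rightarrow> real" where
  "coeff_p \<xi> x = g * (norm \<xi>)\<^sup>2 * rho' x"

lemma energy0_mh_mv: assumes "\<xi> \<noteq> 0"
  shows "(norm \<xi>)\<^sup>2 * energy0 \<xi> u u1 u2 = (norm \<xi>)\<^sup>2 * mag_h \<xi> * normsq u + (mag_h \<xi> + (norm \<xi>)\<^sup>2 * mag_v) * normsq u1 + mag_v * normsq u2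
     - g * (norm \<xi>)\<^sup>2 * wprod rho' u u"
proof -
  have k: "(norm \<xi>)\<^sup>2 \<noteq> 0" using assms by simp
  show ?thesis
  proof (cases vert)
    case True
    show ?thesis unfolding energy0_vert[OF True] mag_h_mv_vert[OF True] using k by (simp add: algebra_simps)
  next
    case False
    show ?thesis unfolding energy0_hor[OF False] mag_h_mv_hor[OF False] using k by (simp add: algebra_simps)
  qed
qed

lemma form_locale:
  assumes \<xi>: "\<xi> \<noteq> 0" and l: "0 < l"
  shows "\<exists>R. smooth_quad_form (coeff_a \<xi> l) (coeff_b \<xi> l) (coeff_p \<xi>) mag_v (l * \<mu>) (l\<^sup>2 * (norm \<xi>)\<^sup>2 * rho_min) (l\<^sup>2 * rho_min) R"
proof -
  have k: "0 < (norm \<xi>)\<^sup>2" using \<xi> by simp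
  obtain R where R: "\<And>x. \<bar>x\<bar> > R \<Longrightarrow> rho' x = 0" using rho'_supp by blast
  have ea: "asymp_const (coeff_a \<xi> l)" and eb: "asymp_const (coeff_b \<xi> l)" and ep: "asymp_const (coeff_p \<xi>)"
    unfolding coeff_a_def[abs_def] coeff_b_def[abs_def] coeff_p_def[abs_def]
    by (intro asymp_const_add asymp_const_cmult asymp_const_rho asymp_const_const test1_imp_ebc test1_rho')+
  have "smooth_quad_form (coeff_a \<xi> l) (coeff_b \<xi> l) (coeff_p \<xi>) mag_v (l * \<mu>) (l\<^sup>2 * (norm \<xi>)\<^sup>2 * rho_min) (l\<^sup>2 * rho_min) (max 1 R)"
  proof unfold_locales
    show "bdd_meas (coeff_a \<xi> l)" "bdd_meas (coeff_b \<xi> l)" "bdd_meas (coeff_p \<xi>)" using ea eb ep asymp_const_bdd_meas by blast+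
    fix x
    have "l\<^sup>2 * (norm \<xi>)\<^sup>2 * rho_min \<le> l\<^sup>2 * (norm \<xi>)\<^sup>2 * rho x" using rho_min(2) by (intro mult_left_mono) auto
    then show "l\<^sup>2 * (norm \<xi>)\<^sup>2 * rho_min \<le> coeff_a \<xi> l x"
      using mult_nonneg_nonneg[OF less_imp_le[OF k] mag_h_mv_nonneg(1)[of \<xi>]] unfolding coeff_a_def by linarith
    have "l\<^sup>2 * rho_min \<le> l\<^sup>2 * rho x" using rho_min(2) by (intro mult_left_mono) auto
    moreover have "0 \<le> 4 * l * \<mu> * (norm \<xi>)\<^sup>2 + (norm \<xi>)\<^sup>2 * mag_v + mag_h \<xi>"
      using l mu_pos mag_h_mv_nonneg by simp
    ultimately show "l\<^sup>2 * rho_min \<le> coeff_b \<xi> l x" unfolding coeff_b_def by linarith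
    show "\<bar>x\<bar> > max 1 R \<Longrightarrow> coeff_p \<xi> x = 0" using R by (simp add: coeff_p_def)
  qed (use ea eb ep l k rho_min mu_pos mag_h_mv_nonneg in auto)
  then show ?thesis by blast
qed

lemma rho_upper: obtains C where "0 < C" "\<And>x. rho x \<le> C"
proof -
  obtain C where C: "\<And>x. \<bar>rho x\<bar> \<le> C" using bdd_rho(1) unfolding bdd_meas_def by blast
  have le: "rho x \<le> C" for x using C[of x] by linarith
  then have "0 < C" using rho_min(1) rho_min(2)[of 0] by (meson less_le_trans)
  with le show thesis using that by blast
qed

text \<open>The abstract results are applied with c = \<open>mag_v\<close>, e = l \<mu> and k =
  |\<xi>|. Since l^2 = - \<alpha>(\<xi>, l), the form is the energy minus \<alpha> times the
  constraint functional, so it is nonnegative and a minimising sequence for \<alpha> drives it to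
  0.\<close>

lemma growing_mode:
  assumes \<xi>: "\<xi> \<noteq> 0" and l: "0 < l" "l\<^sup>2 = - alph \<xi> l"
  obtains V where "smooth1 V" "\<And>n. L2R ((deriv ^^ n) V)" "\<exists>x. V x \<noteq> 0"
    "\<And>x. (mag_v + l * \<mu>) * (deriv ^^ 4) V x + 2 * l * \<mu> * (norm \<xi>)\<^sup>2 * deriv (deriv V) x
       - l\<^sup>2 * rho' x * deriv V x - coeff_b \<xi> l x * deriv (deriv V) x
       + (coeff_a \<xi> l x + l * \<mu> * (norm \<xi>)^4 - coeff_p \<xi> x) * V x = 0"
proof -
  have k: "0 < (norm \<xi>)\<^sup>2" using \<xi> by simp
  obtain R where "smooth_quad_form (coeff_a \<xi> l) (coeff_b \<xi> l) (coeff_p \<xi>) mag_v (l * \<mu>) (l\<^sup>2 * (norm \<xi>)\<^sup>2 * rho_min) (l\<^sup>2 * rho_min) R"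
    using form_locale[OF \<xi> l(1)] by blast
  then interpret Q: smooth_quad_form "coeff_a \<xi> l" "coeff_b \<xi> l" "coeff_p \<xi>" mag_v "l * \<mu>" "norm \<xi>" "l\<^sup>2 * (norm \<xi>)\<^sup>2 * rho_min" "l\<^sup>2 * rho_min" R .
  have B: "Q.B1 u u1 u2 = energy \<xi> l u u1 u2 + l\<^sup>2 * kinetic \<xi> u u1" if L: "L2R u" "L2R u1" "L2R u2" for u u1 u2
  proof -
    have w1: "wprod (\<lambda>x. 1) f f = normsq f" for f by (simp add: wprod_def normsq_def power2_eq_square)
    have wlin: "wprod (\<lambda>x. c * w x + d) f f = c * wprod w f f + d * normsq f" if "bdd_meas w" "L2R f" for c d w f
    proof -
      have "wprod (\<lambda>x. c * w x + d) f f = (\<integral>x. c * (w x * f x * f x) + d * (f x)\<^sup>2 \<partial>lborel)"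
        unfolding wprod_def by (simp add: power2_eq_square algebra_simps)
      then show ?thesis unfolding wprod_def normsq_def using bdd_meas_integrable[OF that(1,2,2)] L2R_int[OF that(2)] by simp
    qed
    have a: "wprod (coeff_a \<xi> l) u u = l\<^sup>2 * (norm \<xi>)\<^sup>2 * wprod rho u u + (norm \<xi>)\<^sup>2 * mag_h \<xi> * normsq u"
      unfolding coeff_a_def[abs_def] by (rule wlin[OF bdd_rho(1) L(1)])
    have b: "wprod (coeff_b \<xi> l) u1 u1 = l\<^sup>2 * wprod rho u1 u1 + (4 * l * \<mu> * (norm \<xi>)\<^sup>2 + (norm \<xi>)\<^sup>2 * mag_v + mag_h \<xi>) * normsq u1"
      unfolding coeff_b_def[abs_def] by (rule wlin[OF bdd_rho(1) L(2)])
    have p: "wprod (coeff_p \<xi>) u u = g * (norm \<xi>)\<^sup>2 * wprod rho' u u"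
      using wlin[OF bdd_rho(2) L(1), of "g * (norm \<xi>)\<^sup>2" 0] unfolding coeff_p_def[abs_def] by simp
    show ?thesis unfolding Q.B_def w1 a b p energy_def energy0_mh_mv[OF \<xi>] energy1_def kinetic_def by (simp add: algebra_simps)
  qed
  have nonneg: "0 \<le> Q.B1 u u1 u2" if "H2R u u1 u2" for u u1 u2
    using alpha_le[OF _ that, of l \<xi>] l B[OF H2R_D[OF that]] by simp
  have "\<exists>z. z \<in> Adm rho \<xi> \<and> (case z of (u, u1, u2) \<Rightarrow> energy \<xi> l u u1 u2) < alph \<xi> l + inverse (real (Suc n))" for n
  proof -
    have "Inf ((\<lambda>(u, u1, u2). energy \<xi> l u u1 u2) ` Adm rho \<xi>) < alph \<xi> l + inverse (real (Suc n))"
      unfolding alpha_eq[symmetric] by simp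
    from cInf_lessD[OF _ this] Adm_nonempty[OF \<xi>] show ?thesis by auto
  qed
  then obtain z where z: "\<And>n. z n \<in> Adm rho \<xi>"
    "\<And>n. (case z n of (u, u1, u2) \<Rightarrow> energy \<xi> l u u1 u2) < alph \<xi> l + inverse (real (Suc n))" by metis
  define u u1 u2 where "u n = fst (z n)" and "u1 n = fst (snd (z n))" and "u2 n = snd (snd (z n))" for n
  have zu: "z n = (u n, u1 n, u2 n)" for n by (simp add: u_def u1_def u2_def)
  have H: "H2R (u n) (u1 n) (u2 n)" and J1: "kinetic \<xi> (u n) (u1 n) = 1" for n
    using z(1)[of n] unfolding zu Adm_iff by auto
  note L = H2R_D[OF H]
  have up: "Q.B1 (u n) (u1 n) (u2 n) \<le> inverse (real (Suc n))" for n
    using z(2)[of n] B[OF L] l(2) J1 unfolding zu by simp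
  have lim: "(\<lambda>n. Q.B1 (u n) (u1 n) (u2 n)) \<longlonglongrightarrow> 0"
  proof (rule tendsto_sandwich[OF _ _ tendsto_const LIMSEQ_inverse_real_of_nat])
    show "\<forall>\<^sub>F n in sequentially. 0 \<le> Q.B1 (u n) (u1 n) (u2 n)" using nonneg[OF H] by simp
    show "\<forall>\<^sub>F n in sequentially. Q.B1 (u n) (u1 n) (u2 n) \<le> inverse (real (Suc n))" using up by simp
  qed
  \<comment> \<open>On the constraint, the lower bound \<open>rho_min\<close> turns the value 1 into
    an upper bound for the H^1 norm; an upper bound of rho gives the lower bound that
    follows.\<close>
  have bd: "normsq (u n) + normsq (u1 n) \<le> 1 / (rho_min * (norm \<xi>)\<^sup>2) + 1 / rho_min" for n
  proof -
    have kinetic: "rho_min * (norm \<xi>)\<^sup>2 * normsq (u n) + rho_min * normsq (u1 n) \<le> 1" using kinetic_ge[OF L(1)[of n] L(2)[of n], of \<xi>] J1[of n] by simp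
    have p: "0 \<le> rho_min * (norm \<xi>)\<^sup>2 * normsq (u n)" "0 \<le> rho_min * normsq (u1 n)" using rho_min(1) normsq_nonneg by auto
    have rk: "0 < rho_min * (norm \<xi>)\<^sup>2" using rho_min(1) k by simp
    have "normsq (u n) \<le> 1 / (rho_min * (norm \<xi>)\<^sup>2)" using kinetic p rk by (simp add: pos_le_divide_eq mult.commute)
    moreover have "normsq (u1 n) \<le> 1 / rho_min" using kinetic p rho_min(1) by (simp add: pos_le_divide_eq mult.commute)
    ultimately show ?thesis by linarith
  qed
  obtain C where C: "0 < C" "\<And>x. rho x \<le> C" using rho_upper by metis
  \<comment> \<open>A common upper bound for the weights C |\<xi>|^2 and C of the two norms in the
    constraint.\<close>
  define D where "D = C * ((norm \<xi>)\<^sup>2 + 1)"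
  have D0: "D > 0" unfolding D_def by (rule mult_pos_pos[OF C(1) add_pos_pos[OF k zero_less_one]])
  have lower: "1 / D \<le> normsq (u n) + normsq (u1 n)" for n
  proof -
    have "1 = kinetic \<xi> (u n) (u1 n)" using J1 by simp
    also have "\<dots> \<le> (norm \<xi>)\<^sup>2 * (C * normsq (u n)) + C * normsq (u1 n)"
      unfolding kinetic_def using C bdd_rho L by (intro add_mono mult_left_mono wprod_le) auto
    also have "\<dots> \<le> (norm \<xi>)\<^sup>2 * (C * normsq (u n)) + C * normsq (u1 n) + (C * normsq (u n) + (norm \<xi>)\<^sup>2 * (C * normsq (u1 n)))"
      using C normsq_nonneg by simp
    also have "\<dots> = D * (normsq (u n) + normsq (u1 n))" by (simp add: D_def algebra_simps)
    finally show ?thesis using D0 by (simp add: pos_divide_le_eq mult.commute)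
  qed
  obtain v v1 v2 where v: "H2R v v1 v2" "Q.B1 v v1 v2 = 0" "normsq v + normsq v1 > 0"
    using Q.minimiser_exists[OF nonneg H bd lower _ lim] D0 by auto
  have EL: "Q.B v v1 v2 \<phi> (deriv \<phi>) (deriv (deriv \<phi>)) = 0" if "test1 \<phi>" for \<phi>
    using Q.Euler_Lagrange[OF nonneg v(1,2) test1_H2R[OF that]] by simp
  obtain V where V: "smooth1 V" "\<And>n. L2R ((deriv ^^ n) V)" "\<exists>x. V x \<noteq> 0"
    "\<And>x. (deriv ^^ 4) V x = Q.q0 x * V x + Q.q1 x * deriv V x + Q.q2 x * deriv (deriv V) x"
    using Q.smooth_solution[OF v(1) v(3) EL] by metis
  have ce: "mag_v + l * \<mu> \<noteq> 0" using Q.c Q.e by simp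
  have "deriv (coeff_b \<xi> l) x = l\<^sup>2 * rho' x" for x
    unfolding coeff_b_def[abs_def] by (intro DERIV_imp_deriv) (auto intro!: derivative_eq_intros rho_deriv)
  then have "(mag_v + l * \<mu>) * (deriv ^^ 4) V x = - (coeff_a \<xi> l x + l * \<mu> * ((norm \<xi>)\<^sup>2)\<^sup>2 - coeff_p \<xi> x) * V x
      + l\<^sup>2 * rho' x * deriv V x + (coeff_b \<xi> l x - 2 * (l * \<mu>) * (norm \<xi>)\<^sup>2) * deriv (deriv V) x" for x
    unfolding V(4) Q.q0_def Q.q1_def Q.q2_def distrib_left using ce by simp
  then have "(mag_v + l * \<mu>) * (deriv ^^ 4) V x + 2 * l * \<mu> * (norm \<xi>)\<^sup>2 * deriv (deriv V) x
       - l\<^sup>2 * rho' x * deriv V x - coeff_b \<xi> l x * deriv (deriv V) x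
       + (coeff_a \<xi> l x + l * \<mu> * (norm \<xi>)^4 - coeff_p \<xi> x) * V x = 0" for x
    by (simp add: algebra_simps)
  then show thesis using that V(1,2,3) by blast
qed

end

section \<open>Horizontally periodic normal modes\<close>

text \<open>The smooth representatives of the intersection of all H^k(R), the class of vertical
  profiles.\<close>

definition smooth_L2 :: "(real \<Rightarrow> real) \<Rightarrow> bool" where
  "smooth_L2 F \<longleftrightarrow> smooth1 F \<and> (\<forall>n. L2R ((deriv ^^ n) F))"

lemma smooth_L2_D: assumes "smooth_L2 F" shows "smooth1 F" "L2R F" "smooth_L2 (deriv F)"
proof -
  show "smooth1 F" using assms by (simp add: smooth_L2_def)
  have "L2R ((deriv ^^ 0) F)" using assms unfolding smooth_L2_def by blast
  then show "L2R F" by simp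
  have "L2R ((deriv ^^ n) (deriv F))" for n
    using assms unfolding smooth_L2_def by (metis funpow.simps(2) funpow_swap1 o_apply)
  then show "smooth_L2 (deriv F)" using assms smooth1_deriv by (simp add: smooth_L2_def)
qed

lemma smooth_L2_derivs: "smooth_L2 F \<Longrightarrow> smooth_L2 ((deriv ^^ n) F)"
  by (induction n) (auto intro: smooth_L2_D)

lemma smooth_L2_coinduct:
  assumes "P f" and step: "\<And>f. P f \<Longrightarrow> L2R f \<and> (\<exists>f'. P f' \<and> (\<forall>x. (f has_real_derivative f' x) (at x)))"
  shows "smooth_L2 f"
proof -
  have sm: "smooth1 f" using smooth1_coinduct[of P f] assms by blast
  have "P ((deriv ^^ n) f)" for n
  proof (induction n)
    case (Suc n)
    from step[OF Suc] obtain f' where f': "P f'" "\<forall>x. ((deriv ^^ n) f has_real_derivative f' x) (at x)" by blast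
    then have "deriv ((deriv ^^ n) f) = f'" by (auto intro: DERIV_imp_deriv)
    then show ?case using f' by simp
  qed (simp add: assms)
  then show ?thesis using sm step by (simp add: smooth_L2_def)
qed

lemma smooth_L2_add: assumes "smooth_L2 f" "smooth_L2 g" shows "smooth_L2 (\<lambda>x. f x + g x)"
proof (rule smooth_L2_coinduct[where P = "\<lambda>h. \<exists>f g. smooth_L2 f \<and> smooth_L2 g \<and> h = (\<lambda>x. f x + g x)"])
  fix h :: "real \<Rightarrow> real" assume "\<exists>f g. smooth_L2 f \<and> smooth_L2 g \<and> h = (\<lambda>x. f x + g x)"
  then obtain f g where fg: "smooth_L2 f" "smooth_L2 g" and h: "h = (\<lambda>x. f x + g x)" by blast
  have "\<forall>x. (h has_real_derivative deriv f x + deriv g x) (at x)"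
    unfolding h using fg smooth_L2_D smooth1_DERIV by (auto intro!: derivative_eq_intros)
  moreover have "\<exists>fa ga. smooth_L2 fa \<and> smooth_L2 ga \<and> (\<lambda>x. deriv f x + deriv g x) = (\<lambda>x. fa x + ga x)"
    using fg smooth_L2_D(3) by blast
  ultimately show "L2R h \<and> (\<exists>f'. (\<exists>f g. smooth_L2 f \<and> smooth_L2 g \<and> f' = (\<lambda>x. f x + g x)) \<and> (\<forall>x. (h has_real_derivative f' x) (at x)))"
    using L2R_add[OF smooth_L2_D(2)[OF fg(1)] smooth_L2_D(2)[OF fg(2)]] unfolding h by blast
qed (use assms in blast)

text \<open>As in \<open>smooth1_mult\<close>, the coinduction runs on finite sums of products.
  Applied with the weights rho and rho', it keeps the profiles of pressure and density in the
  class.\<close>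

lemma smooth_L2_ebc_mult: assumes "asymp_const w" "smooth_L2 f" shows "smooth_L2 (\<lambda>x. w x * f x)"
proof -
  define S where "S = {h. \<exists>w f. asymp_const w \<and> smooth_L2 f \<and> h = (\<lambda>x::real. w x * f x)}"
  define T where "T = {h. \<exists>hs. set hs \<subseteq> S \<and> h = (\<lambda>x::real. \<Sum>u\<leftarrow>hs. u x :: real)}"
  have SL: "L2R h" if "h \<in> S" for h
    using that smooth_L2_D(2) bdd_meas_L2R[OF asymp_const_bdd_meas] unfolding S_def by blast
  have TL: "L2R (\<lambda>x. \<Sum>u\<leftarrow>hs. u x)" if "set hs \<subseteq> S" for hs
    using that
  proof (induction hs)
    case (Cons h hs)
    then have "L2R h" "L2R (\<lambda>x. \<Sum>u\<leftarrow>hs. u x)" using SL by auto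
    then show ?case using L2R_add by fastforce
  qed (simp add: L2R_0)
  have D: "\<exists>hs'. set hs' \<subseteq> S \<and> (\<forall>x. ((\<lambda>x. \<Sum>u\<leftarrow>hs. u x) has_real_derivative (\<Sum>u\<leftarrow>hs'. u x)) (at x))"
    if "set hs \<subseteq> S" for hs
    using that
  proof (induction hs)
    case Nil then show ?case by (auto intro!: exI[of _ "[]"])
  next
    case (Cons h hs)
    then obtain hs' where hs': "set hs' \<subseteq> S"
      "\<And>x. ((\<lambda>x. \<Sum>u\<leftarrow>hs. u x) has_real_derivative (\<Sum>u\<leftarrow>hs'. u x)) (at x)" by auto
    from Cons obtain w f where wf: "asymp_const w" "smooth_L2 f" "h = (\<lambda>x. w x * f x)" unfolding S_def by auto
    have "(\<lambda>x. deriv w x * f x) \<in> S" "(\<lambda>x. w x * deriv f x) \<in> S"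
      using wf(1,2) asymp_const_deriv[OF wf(1)] smooth_L2_D(3)[OF wf(2)] unfolding S_def by blast+
    then have "set ((\<lambda>x. deriv w x * f x) # (\<lambda>x. w x * deriv f x) # hs') \<subseteq> S"
      using hs'(1) by simp
    moreover have "((\<lambda>x. \<Sum>u\<leftarrow>h # hs. u x) has_real_derivative
       (\<Sum>u\<leftarrow>(\<lambda>x. deriv w x * f x) # (\<lambda>x. w x * deriv f x) # hs'. u x)) (at x)" for x
      using wf smooth1_DERIV[of w x] smooth1_DERIV[OF smooth_L2_D(1)[OF wf(2)], of x]
      by (auto intro!: derivative_eq_intros hs'(2) simp: asymp_const_def)
    ultimately show ?case by blast
  qed
  show ?thesis
  proof (rule smooth_L2_coinduct[where P = "\<lambda>h. h \<in> T"])
    have "(\<lambda>x. w x * f x) \<in> S" using assms unfolding S_def by blast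
    then show "(\<lambda>x. w x * f x) \<in> T" unfolding T_def by (auto intro!: exI[of _ "[(\<lambda>x. w x * f x)]"])
  next
    fix h assume "h \<in> T"
    then obtain hs where "set hs \<subseteq> S" "h = (\<lambda>x. \<Sum>u\<leftarrow>hs. u x)" unfolding T_def by blast
    then show "L2R h \<and> (\<exists>f'. f' \<in> T \<and> (\<forall>x. (h has_real_derivative f' x) (at x)))"
      using D[of hs] TL[of hs] unfolding T_def by blast
  qed
qed

lemma smooth_L2_cmult: "smooth_L2 f \<Longrightarrow> smooth_L2 (\<lambda>x. c * f x)"
  by (rule smooth_L2_ebc_mult[OF asymp_const_const])

lemma smooth_L2_tendsto_0: assumes "smooth_L2 f" shows "(f \<longlongrightarrow> 0) at_infinity"
  using assms smooth_L2_D[OF assms] smooth_L2_D(2)[OF smooth_L2_D(3)[OF assms]] smooth1_DERIV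
  by (intro L2R_tendsto_0[of f "deriv f"] smooth1_continuous smooth1_deriv) auto

section \<open>Plane waves in the horizontal variables with a vertical profile\<close>

definition phase :: "real \<times> real \<Rightarrow> real^3 \<Rightarrow> real" where
  "phase \<xi> x = fst \<xi> * x$1 + snd \<xi> * x$2"

text \<open>The scalar is kept apart from the profile: horizontal derivatives change only the scalar
  and swap cosine and sine, the vertical derivative changes only the profile, so the field equations
  reduce to algebra on coefficients.\<close>

definition cos_mode :: "real \<times> real \<Rightarrow> real \<Rightarrow> (real \<Rightarrow> real) \<Rightarrow> real^3 \<Rightarrow> real" where
  "cos_mode \<xi> c F x = c * F (x$3) * cos (phase \<xi> x)"

definition sin_mode :: "real \<times> real \<Rightarrow> real \<Rightarrow> (real \<Rightarrow> real) \<Rightarrow> real^3 \<Rightarrow> real" where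
  "sin_mode \<xi> c F x = c * F (x$3) * sin (phase \<xi> x)"

lemma smooth1_DERIV_shift:
  assumes "smooth1 F" shows "((\<lambda>h. F (s + h)) has_real_derivative deriv F s) (at 0)"
proof -
  have "(F has_real_derivative deriv F s) (at (s + 0))" using smooth1_DERIV[OF assms, of s] by simp
  then have "((\<lambda>h. F (s + h)) has_real_derivative deriv F s * 1) (at 0)"
    by (rule DERIV_chain2) (auto intro!: derivative_eq_intros)
  then show ?thesis by simp
qed

lemma pd_Tc:
  "pd 1 (cos_mode \<xi> c F) = sin_mode \<xi> (- (c * fst \<xi>)) F"
  "pd 2 (cos_mode \<xi> c F) = sin_mode \<xi> (- (c * snd \<xi>)) F"
  "smooth1 F \<Longrightarrow> pd 3 (cos_mode \<xi> c F) = cos_mode \<xi> c (deriv F)"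
proof -
  show "pd 1 (cos_mode \<xi> c F) = sin_mode \<xi> (- (c * fst \<xi>)) F"
    unfolding pd_def cos_mode_def sin_mode_def phase_def
    by (intro ext DERIV_imp_deriv) (auto intro!: derivative_eq_intros simp: axis_def)
  show "pd 2 (cos_mode \<xi> c F) = sin_mode \<xi> (- (c * snd \<xi>)) F"
    unfolding pd_def cos_mode_def sin_mode_def phase_def
    by (intro ext DERIV_imp_deriv) (auto intro!: derivative_eq_intros simp: axis_def)
  assume F: "smooth1 F"
  show "pd 3 (cos_mode \<xi> c F) = cos_mode \<xi> c (deriv F)"
    unfolding pd_def cos_mode_def phase_def
  proof (intro ext DERIV_imp_deriv)
    fix x :: "real^3"
    from smooth1_DERIV_shift[OF F, of "x$3"] have "((\<lambda>h. c * F (x$3 + h) * cos (fst \<xi> * x$1 + snd \<xi> * x$2)) has_real_derivative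
         c * deriv F (x$3) * cos (fst \<xi> * x$1 + snd \<xi> * x$2)) (at 0)"
      by (auto intro!: derivative_eq_intros)
    then show "((\<lambda>h. c * F ((x + h *\<^sub>R axis 3 1)$3) * cos (fst \<xi> * (x + h *\<^sub>R axis 3 1)$1 + snd \<xi> * (x + h *\<^sub>R axis 3 1)$2)) has_real_derivative
         c * deriv F (x$3) * cos (fst \<xi> * x$1 + snd \<xi> * x$2)) (at 0)"
      by (simp add: axis_def)
  qed
qed

lemma pd_Ts:
  "pd 1 (sin_mode \<xi> c F) = cos_mode \<xi> (c * fst \<xi>) F"
  "pd 2 (sin_mode \<xi> c F) = cos_mode \<xi> (c * snd \<xi>) F"
  "smooth1 F \<Longrightarrow> pd 3 (sin_mode \<xi> c F) = sin_mode \<xi> c (deriv F)"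
proof -
  show "pd 1 (sin_mode \<xi> c F) = cos_mode \<xi> (c * fst \<xi>) F"
    unfolding pd_def cos_mode_def sin_mode_def phase_def
    by (intro ext DERIV_imp_deriv) (auto intro!: derivative_eq_intros simp: axis_def)
  show "pd 2 (sin_mode \<xi> c F) = cos_mode \<xi> (c * snd \<xi>) F"
    unfolding pd_def cos_mode_def sin_mode_def phase_def
    by (intro ext DERIV_imp_deriv) (auto intro!: derivative_eq_intros simp: axis_def)
  assume F: "smooth1 F"
  show "pd 3 (sin_mode \<xi> c F) = sin_mode \<xi> c (deriv F)"
    unfolding pd_def sin_mode_def phase_def
  proof (intro ext DERIV_imp_deriv)
    fix x :: "real^3"
    from smooth1_DERIV_shift[OF F, of "x$3"] have "((\<lambda>h. c * F (x$3 + h) * sin (fst \<xi> * x$1 + snd \<xi> * x$2)) has_real_derivative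
         c * deriv F (x$3) * sin (fst \<xi> * x$1 + snd \<xi> * x$2)) (at 0)"
      by (auto intro!: derivative_eq_intros)
    then show "((\<lambda>h. c * F ((x + h *\<^sub>R axis 3 1)$3) * sin (fst \<xi> * (x + h *\<^sub>R axis 3 1)$1 + snd \<xi> * (x + h *\<^sub>R axis 3 1)$2)) has_real_derivative
         c * deriv F (x$3) * sin (fst \<xi> * x$1 + snd \<xi> * x$2)) (at 0)"
      by (simp add: axis_def)
  qed
qed

lemma T_differentiable:
  assumes "smooth1 F" shows "cos_mode \<xi> c F differentiable_on UNIV" "sin_mode \<xi> c F differentiable_on UNIV"
proof -
  have d: "(\<lambda>x::real^3. F (x$3)) differentiable at x" for x
  proof -
    have "F differentiable at (x$3)" using assms smooth1_DERIV real_differentiable_def by blast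
    moreover have "(\<lambda>x::real^3. x$3) differentiable at x"
      by (intro bounded_linear_imp_differentiable bounded_linear_vec_nth)
    ultimately show ?thesis using differentiable_chain_at[of "\<lambda>x::real^3. x$3" x F] by (simp add: o_def)
  qed
  have p: "(\<lambda>x. phase \<xi> x) differentiable at x" for x
    unfolding phase_def by (intro derivative_intros bounded_linear_imp_differentiable bounded_linear_vec_nth)
  have c: "(\<lambda>x. cos (phase \<xi> x)) differentiable at x" "(\<lambda>x. sin (phase \<xi> x)) differentiable at x" for x
  proof -
    have "cos differentiable at (phase \<xi> x)" "sin differentiable at (phase \<xi> x)"
      using DERIV_cos DERIV_sin real_differentiable_def by blast+
    from differentiable_chain_at[OF p this(1)] differentiable_chain_at[OF p this(2)]
    show "(\<lambda>x. cos (phase \<xi> x)) differentiable at x" "(\<lambda>x. sin (phase \<xi> x)) differentiable at x" by (simp_all add: o_def)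
  qed
  show "cos_mode \<xi> c F differentiable_on UNIV" "sin_mode \<xi> c F differentiable_on UNIV"
    unfolding differentiable_on_def cos_mode_def[abs_def] sin_mode_def[abs_def]
    by (auto intro!: differentiable_mult d c differentiable_const)
qed

text \<open>For a fixed frequency this class is closed under partial derivatives and scaling, so
  smoothness, periodicity, integrability and the scaling of norms are checked once for the whole
  class.\<close>

definition modes :: "real \<times> real \<Rightarrow> (real^3 \<Rightarrow> real) set" where
  "modes \<xi> = {f. \<exists>c F. smooth_L2 F \<and> (f = cos_mode \<xi> c F \<or> f = sin_mode \<xi> c F)}"

lemma modes_I: "smooth_L2 F \<Longrightarrow> cos_mode \<xi> c F \<in> modes \<xi>" "smooth_L2 F \<Longrightarrow> sin_mode \<xi> c F \<in> modes \<xi>"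
  unfolding modes_def by blast+

lemma modes_E: assumes "f \<in> modes \<xi>" obtains c F where "smooth_L2 F" "f = cos_mode \<xi> c F" | c F where "smooth_L2 F" "f = sin_mode \<xi> c F"
  using assms unfolding modes_def by blast

lemma modes_pd: assumes "f \<in> modes \<xi>" shows "pd i f \<in> modes \<xi>"
  using assms exhaust_3[of i]
  by (elim modes_E) (auto simp: pd_Tc pd_Ts smooth_L2_D intro!: modes_I)

lemma modes_differentiable: "f \<in> modes \<xi> \<Longrightarrow> f differentiable_on UNIV"
  by (elim modes_E) (auto simp: smooth_L2_D intro!: T_differentiable)

lemma modes_continuous: "f \<in> modes \<xi> \<Longrightarrow> continuous_on UNIV f"
  by (intro differentiable_imp_continuous_on modes_differentiable)

lemma modes_smooth3: assumes "f \<in> modes \<xi>" shows "smooth3 f"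
proof -
  have "foldr pd is f \<in> modes \<xi>" for "is" by (induction "is") (auto simp: assms modes_pd)
  then show ?thesis unfolding smooth3_def using modes_differentiable by blast
qed

lemma T_scale: "(\<lambda>x. e * cos_mode \<xi> c F x) = cos_mode \<xi> (e * c) F" "(\<lambda>x. e * sin_mode \<xi> c F x) = sin_mode \<xi> (e * c) F"
  by (auto simp: cos_mode_def sin_mode_def)

lemma modes_scale: "f \<in> modes \<xi> \<Longrightarrow> (\<lambda>x. e * f x) \<in> modes \<xi>"
  by (elim modes_E) (auto simp: T_scale intro!: modes_I)

lemma pd_scale: assumes "f \<in> modes \<xi>" shows "pd i (\<lambda>x. e * f x) = (\<lambda>x. e * pd i f x)"
  using assms exhaust_3[of i]
  by (elim modes_E) (auto simp: pd_Tc pd_Ts smooth_L2_D T_scale mult.assoc)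

lemma modes_pd_pow: "f \<in> modes \<xi> \<Longrightarrow> (pd i ^^ n) f \<in> modes \<xi>"
  by (induction n) (auto intro: modes_pd)

lemma pd_pow_scale: "f \<in> modes \<xi> \<Longrightarrow> (pd i ^^ n) (\<lambda>x. e * f x) = (\<lambda>x. e * (pd i ^^ n) f x)"
  by (induction n) (auto simp: pd_scale[OF modes_pd_pow])

lemma modes_dmi: "f \<in> modes \<xi> \<Longrightarrow> dmi a b c f \<in> modes \<xi>"
  unfolding dmi_def by (intro modes_pd_pow)

lemma dmi_scale: "f \<in> modes \<xi> \<Longrightarrow> dmi a b c (\<lambda>x. e * f x) = (\<lambda>x. e * dmi a b c f x)"
  unfolding dmi_def
  by (simp only: pd_pow_scale pd_pow_scale[OF modes_pd_pow] pd_pow_scale[OF modes_pd_pow[OF modes_pd_pow]])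

lemma Hk_sq_scale: assumes "f \<in> modes \<xi>" shows "Hk_sq L k (\<lambda>x. e * f x) = e\<^sup>2 * Hk_sq L k f"
  unfolding Hk_sq_def dmi_scale[OF assms] power_mult_distrib
  by (simp add: set_lebesgue_integral_def sum_distrib_left mult.left_commute)

section \<open>Square integrability over the periodicity cell\<close>

lemma Cell_borel: "Cell L \<in> sets borel"
proof -
  have "Cell L = {x. 0 \<le> x$1} \<inter> {x. x$1 < 2 * pi * L} \<inter> {x. 0 \<le> x$2} \<inter> {x. x$2 < 2 * pi * L}"
    by (auto simp: Cell_def)
  moreover have "{x::real^3. 0 \<le> x$i} \<in> sets borel" for i
    by (intro borel_closed closed_Collect_le continuous_intros)
  moreover have "{x::real^3. x$i < 2 * pi * L} \<in> sets borel" for i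
    by (intro borel_open open_Collect_less continuous_intros)
  ultimately show ?thesis by auto
qed

text \<open>The integrand is a product of functions of one coordinate each: indicators of [0, 2 pi
  L) in the horizontal coordinates and F^2 in the vertical one. Tonelli in product form reduces
  finiteness to the three factors.\<close>

lemma Cell_integrable:
  assumes F: "L2R F" shows "integrable lborel (\<lambda>x::real^3. indicator (Cell L) x * (F (x$3))\<^sup>2)"
proof (rule integrableI_bounded)
  have [measurable]: "F \<in> borel_measurable borel" using F L2R_borel by blast
  have [measurable]: "Cell L \<in> sets borel" by (rule Cell_borel)
  have [measurable]: "(\<lambda>x::real^3. x$3) \<in> borel_measurable borel"
    by (intro borel_measurable_continuous_onI continuous_intros)
  show "(\<lambda>x::real^3. indicator (Cell L) x * (F (x$3))\<^sup>2) \<in> borel_measurable lborel" by measurable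
  define h where "h b s = (if b = axis 3 1 then ennreal ((F s)\<^sup>2) else indicator {0..<2 * pi * L} s)" for b :: "real^3" and s
  have B: "Basis = {axis 1 1, axis 2 1, axis 3 (1::real) :: real^3}" "axis 1 1 \<noteq> (axis 2 1 :: real^3)"
     "axis 1 1 \<noteq> (axis 3 1 :: real^3)" "axis 2 1 \<noteq> (axis 3 1 :: real^3)"
  proof -
    have "Basis = (\<lambda>i. axis i (1::real)) ` (UNIV :: 3 set)" by (auto simp: Basis_vec_def)
    then have "Basis = {axis 1 1, axis 2 1, axis (3::3) (1::real)}" unfolding UNIV_3 by simp
    then show "Basis = {axis 1 1, axis 2 1, axis 3 (1::real) :: real^3}" .
  qed (simp_all add: axis_eq_axis)
  have prod3: "(\<Prod>b\<in>Basis. f b) = f (axis 1 1) * (f (axis 2 1) * f (axis 3 1))" for f :: "real^3 \<Rightarrow> ennreal"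
    unfolding B(1) using B(2,3,4) by simp
  have "(\<integral>\<^sup>+x. ennreal (norm (indicator (Cell L) x * (F (x$3))\<^sup>2)) \<partial>lborel) = (\<integral>\<^sup>+x. (\<Prod>b\<in>Basis. h b (x \<bullet> b)) \<partial>lborel)"
  proof (intro nn_integral_cong)
    fix x :: "real^3"
    show "ennreal (norm (indicator (Cell L) x * (F (x$3))\<^sup>2)) = (\<Prod>b\<in>Basis. h b (x \<bullet> b))"
      unfolding prod3 using B(2,3,4) by (auto simp: h_def Cell_def inner_axis indicator_def)
  qed
  also have "\<dots> = (\<Prod>b\<in>Basis. \<integral>\<^sup>+s. h b s \<partial>lborel)"
    by (intro nn_integral_lborel_prod) (auto simp: h_def[abs_def])
  also have "\<dots> < \<infinity>"
  proof -
    have "(\<integral>\<^sup>+s. h b s \<partial>lborel) < \<infinity>" for b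
    proof (cases "b = axis 3 1")
      case True
      then have "(\<integral>\<^sup>+s. h b s \<partial>lborel) = ennreal (normsq F)"
        unfolding h_def normsq_def using nn_integral_eq_integral[OF L2R_int[OF F]] by simp
      then show ?thesis by simp
    next
      case False
      then have "(\<integral>\<^sup>+s. h b s \<partial>lborel) = emeasure lborel {0..<2 * pi * L}" by (simp add: h_def)
      also have "\<dots> \<le> emeasure lborel {0..2 * pi * L}" by (intro emeasure_mono) auto
      also have "\<dots> < \<infinity>" by (simp add: emeasure_lborel_Icc_eq)
      finally show ?thesis .
    qed
    then show ?thesis unfolding prod3 by (simp add: ennreal_mult_less_top)
  qed
  finally show "(\<integral>\<^sup>+x. ennreal (norm (indicator (Cell L) x * (F (x$3))\<^sup>2)) \<partial>lborel) < \<infinity>" .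
qed

lemma modes_Cell_integrable: assumes "f \<in> modes \<xi>" shows "set_integrable lborel (Cell L) (\<lambda>x. (f x)\<^sup>2)"
proof -
  obtain c F where F: "smooth_L2 F" "f = cos_mode \<xi> c F \<or> f = sin_mode \<xi> c F" using assms unfolding modes_def by blast
  have le: "(f x)\<^sup>2 \<le> c\<^sup>2 * (F (x$3))\<^sup>2" for x
  proof -
    have "(cos (phase \<xi> x))\<^sup>2 \<le> 1" "(sin (phase \<xi> x))\<^sup>2 \<le> 1"
      using sin_cos_squared_add[of "phase \<xi> x"] zero_le_power2[of "sin (phase \<xi> x)"] zero_le_power2[of "cos (phase \<xi> x)"] by linarith+
    then show ?thesis using F(2) by (auto simp: cos_mode_def sin_mode_def power_mult_distrib intro!: mult_left_le mult_nonneg_nonneg)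
  qed
  have fm: "f \<in> borel_measurable borel" by (intro borel_measurable_continuous_onI modes_continuous[OF assms])
  show ?thesis
    unfolding set_integrable_def
  proof (rule Bochner_Integration.integrable_bound)
    show "integrable lborel (\<lambda>x. c\<^sup>2 * (indicator (Cell L) x * (F (x$3))\<^sup>2))"
      by (intro integrable_mult_right Cell_integrable smooth_L2_D F)
    show "(\<lambda>x. indicator (Cell L) x *\<^sub>R (f x)\<^sup>2) \<in> borel_measurable lborel" using fm Cell_borel by simp
    show "AE x in lborel. norm (indicator (Cell L) x *\<^sub>R (f x)\<^sup>2) \<le> norm (c\<^sup>2 * (indicator (Cell L) x * (F (x$3))\<^sup>2))"
      using le by (intro AE_I2) (auto simp: indicator_def)
  qed
qed

lemma modes_hper: assumes "f \<in> modes \<xi>" "\<xi> \<in> lattice L" "L > 0" shows "hper L f"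
proof -
  obtain m n :: int where \<xi>: "\<xi> = (of_int m / L, of_int n / L)" using assms(2) unfolding lattice_def by blast
  have "phase \<xi> (x + (2 * pi * L) *\<^sub>R axis 1 1) = phase \<xi> x + 2 * pi * of_int m" for x
    using assms(3) by (simp add: phase_def \<xi> axis_def distrib_left)
  moreover have "phase \<xi> (x + (2 * pi * L) *\<^sub>R axis 2 1) = phase \<xi> x + 2 * pi * of_int n" for x
    using assms(3) by (simp add: phase_def \<xi> axis_def distrib_left)
  moreover have "cos (y + 2 * pi * of_int m) = cos y" "sin (y + 2 * pi * of_int m) = sin y" for y and m :: int
    using sin_cos_eq_iff[of "y + 2 * pi * of_int m" y] by (auto simp: mult.commute)
  moreover have "axis 1 (1::real) $ (3::3) = 0" "axis 2 (1::real) $ (3::3) = 0"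
    by (simp_all add: axis_def)
  ultimately show ?thesis
    using assms(1) unfolding hper_def by (elim modes_E) (simp_all add: cos_mode_def sin_mode_def)
qed

lemma modes_inHk: "f \<in> modes \<xi> \<Longrightarrow> \<xi> \<in> lattice L \<Longrightarrow> L > 0 \<Longrightarrow> inHk L k f"
  unfolding inHk_def by (intro conjI allI impI modes_smooth3 modes_hper modes_Cell_integrable modes_dmi)

section \<open>Strict positivity of L^2 norms\<close>

lemma Hk_sq_nonneg: "0 \<le> Hk_sq L k f"
  unfolding Hk_sq_def set_lebesgue_integral_def by (intro sum_nonneg integral_nonneg_AE AE_I2) simp

text \<open>A continuous function that is nonzero at an interior point of the cell is nonzero on a
  nonempty open set, which is not negligible. The strict inequalities on the point provide an open
  set inside the half-open cell.\<close>

lemma Hk_sq_0_pos: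
  assumes f: "f \<in> modes \<xi>" and x: "0 < x$1" "x$1 < 2 * pi * L" "0 < x$2" "x$2 < 2 * pi * L" "f x \<noteq> 0"
  shows "0 < Hk_sq L 0 f"
proof -
  have H: "Hk_sq L 0 f = (LINT x : Cell L | lborel. (f x)\<^sup>2)" by (simp add: Hk_sq_def dmi_def)
  have "Hk_sq L 0 f \<noteq> 0"
  proof
    assume "Hk_sq L 0 f = 0"
    then have "AE x in lborel. indicator (Cell L) x *\<^sub>R (f x)\<^sup>2 = 0"
      using integral_nonneg_eq_0_iff_AE[OF modes_Cell_integrable[OF f, of L, unfolded set_integrable_def]] H
      by (simp add: set_lebesgue_integral_def)
    define U where "U = {x. 0 < x$1} \<inter> {x. x$1 < 2 * pi * L} \<inter> {x. 0 < x$2} \<inter> {x. x$2 < 2 * pi * L} \<inter> {x. f x \<noteq> 0}"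
    have "open U" unfolding U_def
      by (intro open_Int open_Collect_less open_Collect_neq continuous_intros modes_continuous[OF f])
    have "AE x in lborel. x \<notin> U"
      using \<open>AE x in lborel. _\<close> by eventually_elim (auto simp: U_def Cell_def indicator_def)
    then have "emeasure lborel U = 0" using \<open>open U\<close> by (simp add: AE_iff_measurable[OF _ refl])
    then have "negligible U" using \<open>open U\<close> by (simp add: negligible_iff_null_sets null_sets_def)
    then show False using open_not_negligible[OF \<open>open U\<close>] x by (auto simp: U_def)
  qed
  then show ?thesis using Hk_sq_nonneg[of L 0 f] by simp
qed

text \<open>One point serves for both trigonometric factors: a phase \<theta> with 0 < |\<theta>|
  \<le> 1 < pi/2 has nonzero cosine and nonzero sine.\<close>

lemma small_phase:
  fixes \<xi> :: "real \<times> real"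
  assumes "\<xi> \<noteq> 0" "L > 0"
  obtains a b where "0 < a" "a < 2 * pi * L" "0 < b" "b < 2 * pi * L"
    "cos (fst \<xi> * a + snd \<xi> * b) \<noteq> 0" "sin (fst \<xi> * a + snd \<xi> * b) \<noteq> 0"
proof -
  \<comment> \<open>The first bound keeps d and 2 d inside the cell, the second keeps the phase at
    most 1 in absolute value even with 2 d.\<close>
  define d where "d = min (pi * L / 2) (1 / (2 * (\<bar>fst \<xi>\<bar> + \<bar>snd \<xi>\<bar> + 1)))"
  have d: "0 < d" "2 * d < 2 * pi * L" using assms(2) pi_gt_zero by (auto simp: d_def min_def field_simps mult_pos_pos intro: order_less_le_trans)
  have d2: "d * (\<bar>fst \<xi>\<bar> + \<bar>snd \<xi>\<bar> + 1) \<le> 1 / 2"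
  proof -
    have p: "0 < \<bar>fst \<xi>\<bar> + \<bar>snd \<xi>\<bar> + 1" by linarith
    have "d \<le> 1 / (2 * (\<bar>fst \<xi>\<bar> + \<bar>snd \<xi>\<bar> + 1))" by (simp add: d_def)
    then show ?thesis using p by (simp add: field_simps)
  qed
  \<comment> \<open>The point (d, d) has phase 0 exactly when the components of \<xi> cancel; then
    (d, 2 d) has phase \<open>d * snd \<xi>\<close>, which is nonzero because \<xi> is.\<close>
  define b where "b = (if fst \<xi> + snd \<xi> \<noteq> 0 then d else 2 * d)"
  have b: "0 < b" "b \<le> 2 * d" using d by (auto simp: b_def)
  define \<theta> where "\<theta> = fst \<xi> * d + snd \<xi> * b"
  have "\<theta> \<noteq> 0"
  proof (cases "fst \<xi> + snd \<xi> = 0")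
    case True
    then have f: "fst \<xi> = - snd \<xi>" by simp
    then have "snd \<xi> \<noteq> 0" using assms(1) by (auto simp: prod_eq_iff)
    moreover have "\<theta> = d * snd \<xi>" using True by (simp add: \<theta>_def b_def f)
    ultimately show ?thesis using d by simp
  next
    case False
    then have "\<theta> = d * (fst \<xi> + snd \<xi>)" by (simp add: \<theta>_def b_def algebra_simps)
    then show ?thesis using d False by simp
  qed
  have "\<bar>\<theta>\<bar> \<le> \<bar>fst \<xi>\<bar> * d + \<bar>snd \<xi>\<bar> * b" unfolding \<theta>_def using d b abs_triangle_ineq[of "fst \<xi> * d" "snd \<xi> * b"] by (simp add: abs_mult)
  also have "\<dots> \<le> \<bar>fst \<xi>\<bar> * (2 * d) + \<bar>snd \<xi>\<bar> * (2 * d)" using d b by (intro add_mono mult_left_mono) auto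
  also have "\<dots> \<le> 2 * (d * (\<bar>fst \<xi>\<bar> + \<bar>snd \<xi>\<bar> + 1))" using d by (simp add: algebra_simps)
  also have "\<dots> \<le> 1" using d2 by simp
  finally have t: "\<bar>\<theta>\<bar> \<le> 1" .
  have "cos \<theta> > 0" using t pi_half_gt_zero pi_gt3 by (intro cos_gt_zero_pi) auto
  moreover have "sin \<theta> \<noteq> 0"
    using t \<open>\<theta> \<noteq> 0\<close> pi_gt3 sin_gt_zero[of \<theta>] sin_gt_zero[of "- \<theta>"] by (cases "\<theta> > 0") auto
  ultimately show thesis using that[of d b] d b by (simp add: \<theta>_def)
qed

lemma T_Hk_sq_0_pos:
  assumes "smooth_L2 F" "F s \<noteq> 0" "c \<noteq> 0" "\<xi> \<noteq> 0" "L > 0"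
  shows "0 < Hk_sq L 0 (cos_mode \<xi> c F)" "0 < Hk_sq L 0 (sin_mode \<xi> c F)"
proof -
  obtain a b where ab: "0 < a" "a < 2 * pi * L" "0 < b" "b < 2 * pi * L"
    "cos (fst \<xi> * a + snd \<xi> * b) \<noteq> 0" "sin (fst \<xi> * a + snd \<xi> * b) \<noteq> 0"
    using small_phase[OF assms(4,5)] .
  show "0 < Hk_sq L 0 (cos_mode \<xi> c F)"
    by (rule Hk_sq_0_pos[OF modes_I(1)[OF assms(1)], of "vector [a, b, s]"])
      (use ab assms in \<open>simp_all add: cos_mode_def phase_def\<close>)
  show "0 < Hk_sq L 0 (sin_mode \<xi> c F)"
    by (rule Hk_sq_0_pos[OF modes_I(2)[OF assms(1)], of "vector [a, b, s]"])
      (use ab assms in \<open>simp_all add: sin_mode_def phase_def\<close>)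
qed

lemma modes_tendsto_0: assumes "f \<in> modes \<xi>" shows "((\<lambda>s. f (vector [a, b, s])) \<longlongrightarrow> 0) at_infinity"
proof -
  obtain c F where F: "smooth_L2 F" "f = cos_mode \<xi> c F \<or> f = sin_mode \<xi> c F" using assms unfolding modes_def by blast
  have "((\<lambda>s. c * F s * w) \<longlongrightarrow> c * 0 * w) at_infinity" for w
    by (intro tendsto_intros smooth_L2_tendsto_0 F)
  then show ?thesis using F(2) by (auto simp: cos_mode_def sin_mode_def phase_def)
qed

section \<open>The solution of the linearised problem\<close>

context rt_setting
begin

text \<open>The horizontal velocity is proportional to \<xi>, hence curl-free in the horizontal
  variables, and both horizontal momentum equations yield the same pressure profile. All fields
  carry the factor exp(l t), so every norm grows at exactly that rate.\<close>

lemma mode_solves: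
  assumes \<xi>: "\<xi> \<noteq> 0" "\<xi> \<in> lattice L" and l: "0 < l" and V: "smooth_L2 V" "\<exists>x. V x \<noteq> 0"
    and ode: "\<And>x. (mag_v + l * \<mu>) * (deriv ^^ 4) V x + 2 * l * \<mu> * (norm \<xi>)\<^sup>2 * deriv (deriv V) x
       - l\<^sup>2 * rho' x * deriv V x - coeff_b \<xi> l x * deriv (deriv V) x
       + (coeff_a \<xi> l x + l * \<mu> * (norm \<xi>)^4 - coeff_p \<xi> x) * V x = 0"
  shows "\<exists>vr :: real \<Rightarrow> real^3 \<Rightarrow> real. \<exists>u N :: real \<Rightarrow> real^3 \<Rightarrow> real^3. \<exists>q :: real \<Rightarrow> real^3 \<Rightarrow> real.
    lin_solution vert g \<mu> rho rho' M vr u N q \<and>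
    (\<forall>t>0. \<forall>a b :: real. ((\<lambda>s. vr t (vector [a, b, s])) \<longlongrightarrow> 0) at_infinity \<and>
                ((\<lambda>s. u t (vector [a, b, s])) \<longlongrightarrow> 0) at_infinity \<and>
                ((\<lambda>s. N t (vector [a, b, s])) \<longlongrightarrow> 0) at_infinity) \<and>
    (\<forall>k. inHk L k (vr 0) \<and> vinHk L k (u 0) \<and> vinHk L k (N 0) \<and> inHk L k (q 0)) \<and>
    (\<forall>t>0. \<forall>k.
       inHk L k (vr t) \<and> vinHk L k (u t) \<and> vinHk L k (N t) \<and> inHk L k (q t) \<and>
       sqrt (Hk_sq L k (vr t) + vHk_sq L k (N t) + Hk_sq L k (q t))
         = exp (l * t) * sqrt (Hk_sq L k (vr 0) + vHk_sq L k (N 0) + Hk_sq L k (q 0)) \<and>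
       (\<forall>i. Hk_norm L k (cmp (u t) i) = exp (l * t) * Hk_norm L k (cmp (u 0) i))) \<and>
    (\<forall>x. divg (u 0) x = 0 \<and> divg (N 0) x = 0) \<and>
    sqrt (Hk_sq L 0 (cmp (u 0) 1) + Hk_sq L 0 (cmp (u 0) 2)) * Hk_norm L 0 (cmp (u 0) 3) > 0 \<and>
    (vert \<longrightarrow> Hk_norm L 0 (cmp (N 0) 3) > 0)"
proof -
  define K where "K = (norm \<xi>)\<^sup>2"
  have K: "K > 0" "K = (fst \<xi>)\<^sup>2 + (snd \<xi>)\<^sup>2"
    unfolding K_def using \<xi>(1) by (simp, simp add: norm_prod_def)
  have K0: "K \<noteq> 0" "l \<noteq> 0" using K(1) l by auto
  \<comment> \<open>Oriented to eliminate the square of the first component, so that the simplifier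
    reaches one normal form in \<open>K\<close> and the second component.\<close>
  have Kf: "fst \<xi> * fst \<xi> = K - snd \<xi> * snd \<xi>" "fst \<xi> * (fst \<xi> * y) = (K - snd \<xi> * snd \<xi>) * y" for y
    using K(2) by (simp_all add: power2_eq_square flip: mult.assoc)
  define D where "D j = (deriv ^^ j) V" for j
  have sD: "smooth_L2 (D j)" for j unfolding D_def by (rule smooth_L2_derivs[OF V(1)])
  have smD: "smooth1 (D j)" for j by (rule smooth_L2_D(1)[OF sD])
  have dD: "deriv (D j) = D (Suc j)" for j by (simp add: D_def)
  have DD: "(D j has_real_derivative D (Suc j) s) (at s)" for j s using smooth1_DERIV[OF smD, of j s] by (simp add: dD)
  have D0: "D 0 = V" by (simp add: D_def)
  have pc: "pd 1 (cos_mode \<xi> c (D j)) = sin_mode \<xi> (- (c * fst \<xi>)) (D j)" "pd 2 (cos_mode \<xi> c (D j)) = sin_mode \<xi> (- (c * snd \<xi>)) (D j)"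
    "pd 3 (cos_mode \<xi> c (D j)) = cos_mode \<xi> c (D (Suc j))" for c j
    using pd_Tc(3)[OF smD] by (simp_all add: pd_Tc dD)
  have ps: "pd 1 (sin_mode \<xi> c (D j)) = cos_mode \<xi> (c * fst \<xi>) (D j)" "pd 2 (sin_mode \<xi> c (D j)) = cos_mode \<xi> (c * snd \<xi>) (D j)"
    "pd 3 (sin_mode \<xi> c (D j)) = sin_mode \<xi> c (D (Suc j))" for c j
    using pd_Ts(3)[OF smD] by (simp_all add: pd_Ts dD)
  txt \<open>\<open>U\<close> is divergence free, \<open>W = (Mbar \<cdot> \<nabla>) U / l\<close> integrates the induction equation, and the
    profile \<open>Q\<close> of the pressure is read off the horizontal momentum balance.\<close>
  define U where "U i = (if i = 1 then sin_mode \<xi> (- fst \<xi> / K) (D 1) else if i = 2 then sin_mode \<xi> (- snd \<xi> / K) (D 1) else cos_mode \<xi> 1 (D 0))" for i :: 3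
  define W where "W i = (if vert then
      (if i = 1 then sin_mode \<xi> (- M * fst \<xi> / (l * K)) (D 2) else if i = 2 then sin_mode \<xi> (- M * snd \<xi> / (l * K)) (D 2) else cos_mode \<xi> (M / l) (D 1))
     else (if i = 1 then cos_mode \<xi> (- M * (fst \<xi>)\<^sup>2 / (l * K)) (D 1) else if i = 2 then cos_mode \<xi> (- M * fst \<xi> * snd \<xi> / (l * K)) (D 1) else sin_mode \<xi> (- M * fst \<xi> / l) (D 0)))" for i :: 3
  define Q where "Q = (\<lambda>s. (\<mu> / K + mag_v / (l * K)) * D 3 s + (- (\<mu> + mag_v / l) * D 1 s + (- l / K) * (rho s * D 1 s)))"
  define Q' where "Q' = (\<lambda>s. (\<mu> / K + mag_v / (l * K)) * D 4 s + (- (\<mu> + mag_v / l) * D 2 s + (- l / K) * (rho s * D 2 s + rho' s * D 1 s)))"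
  have sQ: "smooth_L2 Q" unfolding Q_def by (intro smooth_L2_add smooth_L2_cmult smooth_L2_ebc_mult asymp_const_rho sD)
  have "(Q has_real_derivative Q' s) (at s)" for s
  proof -
    have "(D 3 has_real_derivative D 4 s) (at s)" "(D 1 has_real_derivative D 2 s) (at s)"
      using DD[of 3 s] DD[of 1 s] by (simp_all add: numeral_eq_Suc)
    then show ?thesis unfolding Q_def Q'_def by (intro DERIV_add DERIV_cmult DERIV_mult' rho_deriv)
  qed
  then have dQ: "deriv Q = Q'" by (auto intro: DERIV_imp_deriv)
  \<comment> \<open>Density from the mass equation: l times the density equals - rho' times the
    vertical velocity.\<close>
  define P where "P = cos_mode \<xi> (- 1 / l) (\<lambda>s. rho' s * V s)"
  define q0 where "q0 = cos_mode \<xi> 1 Q"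
  have TU: "U i \<in> modes \<xi>" for i unfolding U_def by (auto intro!: modes_I sD)
  have TW: "W i \<in> modes \<xi>" for i unfolding W_def by (auto intro!: modes_I sD)
  have TP: "P \<in> modes \<xi>" unfolding P_def by (intro modes_I smooth_L2_ebc_mult test1_imp_ebc test1_rho' V)
  have Tq: "q0 \<in> modes \<xi>" unfolding q0_def by (intro modes_I sQ)
  define vr where "vr = (\<lambda>t x. exp (l * t) * P x)"
  define q where "q = (\<lambda>t x. exp (l * t) * q0 x)"
  define u where "u = (\<lambda>t x. \<chi> i. exp (l * t) * U i x)"
  define N where "N = (\<lambda>t x. \<chi> i. exp (l * t) * W i x)"
  have cu: "cmp (u t) i = (\<lambda>x. exp (l * t) * U i x)" for t i by (simp add: cmp_def u_def)
  have cN: "cmp (N t) i = (\<lambda>x. exp (l * t) * W i x)" for t i by (simp add: cmp_def N_def)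
  have cu': "cmp (u t) 1 = sin_mode \<xi> (exp (l * t) * (- fst \<xi> / K)) (D 1)"
    "cmp (u t) 2 = sin_mode \<xi> (exp (l * t) * (- snd \<xi> / K)) (D 1)" "cmp (u t) 3 = cos_mode \<xi> (exp (l * t) * 1) (D 0)" for t
    unfolding cu U_def by (auto simp: T_scale)
  have divu: "divg (u t) x = 0" for t x
    unfolding divg_def sum_3 cu' ps pc using K0 by (simp add: cos_mode_def field_simps Kf)
  have divN: "divg (N t) x = 0" for t x
  proof (cases vert)
    case True
    have "cmp (N t) 1 = sin_mode \<xi> (exp (l * t) * (- M * fst \<xi> / (l * K))) (D 2)"
      "cmp (N t) 2 = sin_mode \<xi> (exp (l * t) * (- M * snd \<xi> / (l * K))) (D 2)" "cmp (N t) 3 = cos_mode \<xi> (exp (l * t) * (M / l)) (D 1)"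
      unfolding cN W_def using True by (auto simp: T_scale)
    then show ?thesis unfolding divg_def sum_3 using K0 by (simp add: ps pc) (simp add: cos_mode_def numeral_2_eq_2 field_simps Kf)
  next
    case False
    have "cmp (N t) 1 = cos_mode \<xi> (exp (l * t) * (- M * (fst \<xi>)\<^sup>2 / (l * K))) (D 1)"
      "cmp (N t) 2 = cos_mode \<xi> (exp (l * t) * (- M * fst \<xi> * snd \<xi> / (l * K))) (D 1)" "cmp (N t) 3 = sin_mode \<xi> (exp (l * t) * (- M * fst \<xi> / l)) (D 0)"
      unfolding cN W_def using False by (auto simp: T_scale)
    then show ?thesis unfolding divg_def sum_3 using K0 by (simp add: ps pc) (simp add: sin_mode_def power2_eq_square field_simps Kf)
  qed
  have ode': "(mag_v + l * \<mu>) * D 4 s + 2 * l * \<mu> * K * D 2 s - l\<^sup>2 * rho' s * D 1 s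
      - (l\<^sup>2 * rho s + (4 * l * \<mu> * K + K * mag_v + mag_h \<xi>)) * D 2 s
      + (l\<^sup>2 * K * rho s + K * mag_h \<xi> + l * \<mu> * K\<^sup>2 - g * K * rho' s) * D 0 s = 0" for s
  proof -
    have "(norm \<xi>)^4 = K\<^sup>2" by (simp add: K_def)
    moreover have "D 2 = deriv (deriv V)" "D 1 = deriv V" "D 4 = (deriv ^^ 4) V" by (simp_all add: D_def numeral_2_eq_2)
    ultimately show ?thesis using ode[of s] unfolding coeff_a_def coeff_b_def coeff_p_def K_def[symmetric] D0 by simp
  qed
  \<comment> \<open>This is the vertical momentum balance with the common factors exp(l t) and
    cosine removed; multiplied by l K it becomes the fourth order equation
    \<open>ode'\<close>.\<close>
  have Q'_eq: "Q' s = g * rho' s * D 0 s / l - l * rho s * D 0 s + \<mu> * (D 2 s - K * D 0 s) + mag_h \<xi> * (D 2 s / K - D 0 s) / l" for s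
  proof -
    have "l * K * Q' s = l * K * (g * rho' s * D 0 s / l - l * rho s * D 0 s + \<mu> * (D 2 s - K * D 0 s) + mag_h \<xi> * (D 2 s / K - D 0 s) / l)"
    proof -
      have "l * K * Q' s = (mag_v + l * \<mu>) * D 4 s - (l * \<mu> * K + K * mag_v) * D 2 s - l\<^sup>2 * (rho s * D 2 s + rho' s * D 1 s)"
        unfolding Q'_def using K0 by (simp add: field_simps power2_eq_square)
      moreover have "l * K * (g * rho' s * D 0 s / l - l * rho s * D 0 s + \<mu> * (D 2 s - K * D 0 s) + mag_h \<xi> * (D 2 s / K - D 0 s) / l)
         = g * K * rho' s * D 0 s - l\<^sup>2 * K * rho s * D 0 s + l * K * \<mu> * (D 2 s - K * D 0 s) + mag_h \<xi> * (D 2 s - K * D 0 s)"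
        using K0 by (simp add: field_simps power2_eq_square)
      ultimately show ?thesis using ode'[of s] by (simp add: algebra_simps power2_eq_square)
    qed
    then show ?thesis using K(1) l by simp
  qed
  have time: "((\<lambda>t. exp (l * t) * c) has_real_derivative exp (l * t) * (l * c)) (at t)" for c t
    by (auto intro!: derivative_eq_intros)
  have dvr: "dts vr t x = exp (l * t) * (l * P x)" for t x
    unfolding dts_def vr_def by (rule DERIV_imp_deriv[OF time])
  have du: "dtv u t x = (\<chi> i. exp (l * t) * (l * U i x))" for t x
    unfolding dtv_def u_def by (simp add: DERIV_imp_deriv[OF time])
  have dN: "dtv N t x = (\<chi> i. exp (l * t) * (l * W i x))" for t x
    unfolding dtv_def N_def by (simp add: DERIV_imp_deriv[OF time])
  \<comment> \<open>The vanishing component of the cross product is written as a mode so that the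
    rules for partial derivatives apply to it.\<close>
  have z: "(\<lambda>y. 0) = cos_mode \<xi> 0 (D 0)" by (auto simp: cos_mode_def)
  have gq: "grad (q t) x = vector [sin_mode \<xi> (- (exp (l * t) * fst \<xi>)) Q x, sin_mode \<xi> (- (exp (l * t) * snd \<xi>)) Q x, cos_mode \<xi> (exp (l * t)) Q' x]" for t x
  proof -
    have "q t = cos_mode \<xi> (exp (l * t)) Q" by (simp add: q_def q0_def T_scale)
    then show ?thesis unfolding grad_def vec_eq_iff forall_3 using pd_Tc(3)[OF smooth_L2_D(1)[OF sQ]]
      by (simp add: pd_Tc dQ)
  qed
  have lap: "lapv (u t) x = vector [sin_mode \<xi> (exp (l * t) * (- fst \<xi> / K)) (\<lambda>s. D 3 s - K * D 1 s) x,
      sin_mode \<xi> (exp (l * t) * (- snd \<xi> / K)) (\<lambda>s. D 3 s - K * D 1 s) x, cos_mode \<xi> (exp (l * t)) (\<lambda>s. D 2 s - K * D 0 s) x]" for t x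
    unfolding lapv_def vec_eq_iff forall_3 sum_3 using K0
    by (simp add: cu' pc ps) (simp add: cos_mode_def sin_mode_def Kf field_simps numeral_2_eq_2 numeral_3_eq_3)
  have mom: "rho (x$3) *\<^sub>R dtv u t x + grad (q t) x + (g * vr t x) *\<^sub>R axis 3 1
         = \<mu> *\<^sub>R lapv (u t) x + cross3 (curl (N t) x) (Mbar vert M)"
    and ind: "dtv N t x = curl (\<lambda>y. cross3 (u t y) (Mbar vert M)) x" for t x
  proof -
    define e where "e = exp (l * t)"
    have e: "e \<noteq> 0" by (simp add: e_def)
    have cue: "cmp (u t) 1 = sin_mode \<xi> (e * (- fst \<xi> / K)) (D 1)" "cmp (u t) 2 = sin_mode \<xi> (e * (- snd \<xi> / K)) (D 1)" "cmp (u t) 3 = cos_mode \<xi> e (D 0)"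
      unfolding cu' e_def by simp_all
    have vrx: "vr t x = cos_mode \<xi> (- e / l) (\<lambda>s. rho' s * D 0 s) x" unfolding vr_def P_def e_def D0 by (simp add: cos_mode_def)
    have Ux: "U 1 x = sin_mode \<xi> (- fst \<xi> / K) (D 1) x" "U 2 x = sin_mode \<xi> (- snd \<xi> / K) (D 1) x" "U 3 x = cos_mode \<xi> 1 (D 0) x"
      unfolding U_def by auto
    have "(rho (x$3) *\<^sub>R dtv u t x + grad (q t) x + (g * vr t x) *\<^sub>R axis 3 1
         = \<mu> *\<^sub>R lapv (u t) x + cross3 (curl (N t) x) (Mbar vert M)) \<and>
        dtv N t x = curl (\<lambda>y. cross3 (u t y) (Mbar vert M)) x"
    proof (cases vert)
      case True
      have mm: "mag_v = M\<^sup>2" "mag_h \<xi> = 0" using mag_h_mv_vert[OF True] by auto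
      have cNe: "cmp (N t) 1 = sin_mode \<xi> (e * (- M * fst \<xi> / (l * K))) (D 2)"
        "cmp (N t) 2 = sin_mode \<xi> (e * (- M * snd \<xi> / (l * K))) (D 2)" "cmp (N t) 3 = cos_mode \<xi> (e * (M / l)) (D 1)"
        unfolding cN W_def e_def using True by (auto simp: T_scale)
      have Wx: "W 1 x = sin_mode \<xi> (- M * fst \<xi> / (l * K)) (D 2) x" "W 2 x = sin_mode \<xi> (- M * snd \<xi> / (l * K)) (D 2) x" "W 3 x = cos_mode \<xi> (M / l) (D 1) x"
        unfolding W_def using True by auto
      have Mb: "Mbar vert M = vector [0, 0, M]" unfolding Mbar_def vec_eq_iff forall_3 using True by (simp add: axis_def)
      have cr: "cmp (\<lambda>y. cross3 (u t y) (Mbar vert M)) 1 = sin_mode \<xi> (M * (e * (- snd \<xi> / K))) (D 1)"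
        "cmp (\<lambda>y. cross3 (u t y) (Mbar vert M)) 2 = sin_mode \<xi> (- M * (e * (- fst \<xi> / K))) (D 1)"
        "cmp (\<lambda>y. cross3 (u t y) (Mbar vert M)) 3 = cos_mode \<xi> 0 (D 0)"
      proof -
        have c: "cmp (\<lambda>y. cross3 (u t y) (Mbar vert M)) 1 = (\<lambda>y. M * cmp (u t) 2 y)"
          "cmp (\<lambda>y. cross3 (u t y) (Mbar vert M)) 2 = (\<lambda>y. - M * cmp (u t) 1 y)"
          "cmp (\<lambda>y. cross3 (u t y) (Mbar vert M)) 3 = (\<lambda>y. 0)"
          unfolding Mb by (auto simp: cmp_def cross3_def)
        show "cmp (\<lambda>y. cross3 (u t y) (Mbar vert M)) 1 = sin_mode \<xi> (M * (e * (- snd \<xi> / K))) (D 1)"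
          "cmp (\<lambda>y. cross3 (u t y) (Mbar vert M)) 2 = sin_mode \<xi> (- M * (e * (- fst \<xi> / K))) (D 1)"
          "cmp (\<lambda>y. cross3 (u t y) (Mbar vert M)) 3 = cos_mode \<xi> 0 (D 0)"
          unfolding c cue T_scale z by simp_all
      qed
      have A: "rho (x$3) *\<^sub>R dtv u t x + grad (q t) x + (g * vr t x) *\<^sub>R axis 3 1
         = \<mu> *\<^sub>R lapv (u t) x + cross3 (curl (N t) x) (Mbar vert M)"
        unfolding du gq lap Mb curl_def cNe vrx e_def[symmetric] vec_eq_iff forall_3
        using K0
        by (simp add: pc ps cross3_def axis_def Ux)
          (simp add: cos_mode_def sin_mode_def Q'_eq mm Q_def field_simps power2_eq_square Kf numeral_2_eq_2 numeral_3_eq_3)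
      have "dtv N t x = curl (\<lambda>y. cross3 (u t y) (Mbar vert M)) x"
        unfolding dN curl_def cr e_def[symmetric] vec_eq_iff forall_3
        using K0
        by (simp add: pc ps Wx) (simp add: cos_mode_def sin_mode_def field_simps power2_eq_square Kf numeral_2_eq_2)
      with A show ?thesis by blast
    next
      case False
      have mm: "mag_v = 0" "mag_h \<xi> = M\<^sup>2 * (fst \<xi>)\<^sup>2" using mag_h_mv_hor[OF False] by auto
      have cNe: "cmp (N t) 1 = cos_mode \<xi> (e * (- M * (fst \<xi>)\<^sup>2 / (l * K))) (D 1)"
        "cmp (N t) 2 = cos_mode \<xi> (e * (- M * fst \<xi> * snd \<xi> / (l * K))) (D 1)" "cmp (N t) 3 = sin_mode \<xi> (e * (- M * fst \<xi> / l)) (D 0)"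
        unfolding cN W_def e_def using False by (auto simp: T_scale)
      have Wx: "W 1 x = cos_mode \<xi> (- M * (fst \<xi>)\<^sup>2 / (l * K)) (D 1) x" "W 2 x = cos_mode \<xi> (- M * fst \<xi> * snd \<xi> / (l * K)) (D 1) x" "W 3 x = sin_mode \<xi> (- M * fst \<xi> / l) (D 0) x"
        unfolding W_def using False by auto
      have Mb: "Mbar vert M = vector [M, 0, 0]" unfolding Mbar_def vec_eq_iff forall_3 using False by (simp add: axis_def)
      have cr: "cmp (\<lambda>y. cross3 (u t y) (Mbar vert M)) 1 = cos_mode \<xi> 0 (D 0)"
        "cmp (\<lambda>y. cross3 (u t y) (Mbar vert M)) 2 = cos_mode \<xi> (M * e) (D 0)"
        "cmp (\<lambda>y. cross3 (u t y) (Mbar vert M)) 3 = sin_mode \<xi> (- M * (e * (- snd \<xi> / K))) (D 1)"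
      proof -
        have c: "cmp (\<lambda>y. cross3 (u t y) (Mbar vert M)) 1 = (\<lambda>y. 0)"
          "cmp (\<lambda>y. cross3 (u t y) (Mbar vert M)) 2 = (\<lambda>y. M * cmp (u t) 3 y)"
          "cmp (\<lambda>y. cross3 (u t y) (Mbar vert M)) 3 = (\<lambda>y. - M * cmp (u t) 2 y)"
          unfolding Mb by (auto simp: cmp_def cross3_def)
        show "cmp (\<lambda>y. cross3 (u t y) (Mbar vert M)) 1 = cos_mode \<xi> 0 (D 0)"
          "cmp (\<lambda>y. cross3 (u t y) (Mbar vert M)) 2 = cos_mode \<xi> (M * e) (D 0)"
          "cmp (\<lambda>y. cross3 (u t y) (Mbar vert M)) 3 = sin_mode \<xi> (- M * (e * (- snd \<xi> / K))) (D 1)"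
          unfolding c cue T_scale z by simp_all
      qed
      have A: "rho (x$3) *\<^sub>R dtv u t x + grad (q t) x + (g * vr t x) *\<^sub>R axis 3 1
         = \<mu> *\<^sub>R lapv (u t) x + cross3 (curl (N t) x) (Mbar vert M)"
        unfolding du gq lap Mb curl_def cNe vrx e_def[symmetric] vec_eq_iff forall_3
        using K0
        by (simp add: pc ps cross3_def axis_def Ux)
          (simp add: cos_mode_def sin_mode_def Q'_eq mm Q_def field_simps power2_eq_square Kf numeral_2_eq_2 numeral_3_eq_3)
      have "dtv N t x = curl (\<lambda>y. cross3 (u t y) (Mbar vert M)) x"
        unfolding dN curl_def cr e_def[symmetric] vec_eq_iff forall_3
        using K0
        by (simp add: pc ps Wx) (simp add: cos_mode_def sin_mode_def field_simps power2_eq_square Kf numeral_2_eq_2)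
      with A show ?thesis by blast
    qed
    then show "rho (x$3) *\<^sub>R dtv u t x + grad (q t) x + (g * vr t x) *\<^sub>R axis 3 1
         = \<mu> *\<^sub>R lapv (u t) x + cross3 (curl (N t) x) (Mbar vert M)"
      "dtv N t x = curl (\<lambda>y. cross3 (u t y) (Mbar vert M)) x" by auto
  qed
  have diff: "(\<lambda>s. exp (l * s) * c) differentiable (at t)" for c t
    using time real_differentiable_def by blast
  have sol: "lin_solution vert g \<mu> rho rho' M vr u N q"
    unfolding lin_solution_def
  proof (intro allI impI conjI mom ind divu divN)
    fix t x
    show "dts vr t x + rho' (x$3) * (u t x $ 3) = 0"
      unfolding dvr using l by (simp add: P_def u_def U_def cos_mode_def D0)
  qed (use diff[of 1] in \<open>auto simp: vr_def u_def N_def\<close>)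
  have Tt: "vr t \<in> modes \<xi>" "q t \<in> modes \<xi>" "cmp (u t) i \<in> modes \<xi>" "cmp (N t) i \<in> modes \<xi>" for t i
    unfolding vr_def q_def cu cN by (intro modes_scale TP Tq TU TW)+
  have dec: "((\<lambda>s. vr t (vector [a, b, s])) \<longlongrightarrow> 0) at_infinity \<and>
                ((\<lambda>s. u t (vector [a, b, s])) \<longlongrightarrow> 0) at_infinity \<and>
                ((\<lambda>s. N t (vector [a, b, s])) \<longlongrightarrow> 0) at_infinity" for t a b
  proof (intro conjI)
    show "((\<lambda>s. vr t (vector [a, b, s])) \<longlongrightarrow> 0) at_infinity" by (rule modes_tendsto_0[OF Tt(1)])
    show "((\<lambda>s. u t (vector [a, b, s])) \<longlongrightarrow> 0) at_infinity" "((\<lambda>s. N t (vector [a, b, s])) \<longlongrightarrow> 0) at_infinity"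
      using modes_tendsto_0[OF Tt(3)] modes_tendsto_0[OF Tt(4)] by (auto intro!: vec_tendstoI simp: cmp_def)
  qed
  have inH: "inHk L k (vr t) \<and> vinHk L k (u t) \<and> vinHk L k (N t) \<and> inHk L k (q t)" for t k
    unfolding vinHk_def by (intro conjI allI modes_inHk[where \<xi> = \<xi>] Tt \<xi> L_pos)
  have sc: "Hk_sq L k (vr t) = (exp (l * t))\<^sup>2 * Hk_sq L k (vr 0)" "Hk_sq L k (q t) = (exp (l * t))\<^sup>2 * Hk_sq L k (q 0)"
    "Hk_sq L k (cmp (u t) i) = (exp (l * t))\<^sup>2 * Hk_sq L k (cmp (u 0) i)"
    "Hk_sq L k (cmp (N t) i) = (exp (l * t))\<^sup>2 * Hk_sq L k (cmp (N 0) i)" for t k i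
    unfolding vr_def q_def cu cN Hk_sq_scale[OF TP] Hk_sq_scale[OF Tq] Hk_sq_scale[OF TU] Hk_sq_scale[OF TW] by simp_all
  have nrm: "sqrt (Hk_sq L k (vr t) + vHk_sq L k (N t) + Hk_sq L k (q t))
         = exp (l * t) * sqrt (Hk_sq L k (vr 0) + vHk_sq L k (N 0) + Hk_sq L k (q 0))" for t k
  proof -
    have "Hk_sq L k (vr t) + vHk_sq L k (N t) + Hk_sq L k (q t) = (exp (l * t))\<^sup>2 * (Hk_sq L k (vr 0) + vHk_sq L k (N 0) + Hk_sq L k (q 0))"
      unfolding vHk_sq_def sc(1)[of k t] sc(2)[of k t] sc(4)[of k t] by (simp add: sum_distrib_left distrib_left)
    then show ?thesis by (simp add: real_sqrt_mult)
  qed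
  have nru: "Hk_norm L k (cmp (u t) i) = exp (l * t) * Hk_norm L k (cmp (u 0) i)" for t k i
    unfolding Hk_norm_def sc(3)[of k t] by (simp add: real_sqrt_mult)
  obtain s0 where s0: "D 0 s0 \<noteq> 0" using V(2) D0 by auto
  \<comment> \<open>A vanishing derivative would make V constant, and decay at infinity would make
    it zero; so the profile V' of the horizontal velocity is nontrivial.\<close>
  obtain s1 where s1: "D 1 s1 \<noteq> 0"
  proof (rule ccontr)
    assume "\<not> thesis"
    then have "D 1 s = 0" for s using that by blast
    then have "(D 0 has_real_derivative 0) (at s)" for s using DD[of 0 s] by simp
    then have "D 0 s = D 0 s0" for s using DERIV_isconst_all by blast
    then obtain d where d: "D 0 = (\<lambda>s. d)" by blast
    have "((\<lambda>s::real. d) \<longlongrightarrow> 0) at_infinity" using smooth_L2_tendsto_0[OF sD[of 0]] unfolding d .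
    then have "D 0 s0 = 0" unfolding d by (rule tendsto_unique[OF trivial_limit_at_infinity tendsto_const])
    then show False using s0 by simp
  qed
  have h3: "0 < Hk_sq L 0 (cmp (u 0) 3)"
    unfolding cu'(3) by (rule T_Hk_sq_0_pos(1)[OF sD s0 _ \<xi>(1) L_pos]) simp
  \<comment> \<open>At least one component of \<xi> is nonzero, and the corresponding velocity
    component does not vanish.\<close>
  have h12: "0 < Hk_sq L 0 (cmp (u 0) 1) + Hk_sq L 0 (cmp (u 0) 2)"
  proof (cases "fst \<xi> = 0")
    case False
    then have "0 < Hk_sq L 0 (cmp (u 0) 1)" unfolding cu'(1) using K(1)
      by (intro T_Hk_sq_0_pos(2)[OF sD s1 _ \<xi>(1) L_pos]) auto
    then show ?thesis using Hk_sq_nonneg[of L 0 "cmp (u 0) 2"] by linarith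
  next
    case True
    then have "snd \<xi> \<noteq> 0" using \<xi>(1) by (auto simp: prod_eq_iff)
    then have "0 < Hk_sq L 0 (cmp (u 0) 2)" unfolding cu'(2) using K(1)
      by (intro T_Hk_sq_0_pos(2)[OF sD s1 _ \<xi>(1) L_pos]) auto
    then show ?thesis using Hk_sq_nonneg[of L 0 "cmp (u 0) 1"] by linarith
  qed
  have hN: "0 < Hk_norm L 0 (cmp (N 0) 3)" if vert
  proof -
    have "M \<noteq> 0" using M_cond that by auto
    have "cmp (N 0) 3 = cos_mode \<xi> (M / l) (D 1)" unfolding cN W_def using that by (auto simp: T_scale)
    then show ?thesis unfolding Hk_norm_def using T_Hk_sq_0_pos(1)[OF sD s1 _ \<xi>(1) L_pos, of "M / l"] \<open>M \<noteq> 0\<close> l by simp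
  qed
  have pos: "sqrt (Hk_sq L 0 (cmp (u 0) 1) + Hk_sq L 0 (cmp (u 0) 2)) * Hk_norm L 0 (cmp (u 0) 3) > 0"
    unfolding Hk_norm_def using h3 h12 by simp
  show ?thesis
    by (rule exI[of _ vr], rule exI[of _ u], rule exI[of _ N], rule exI[of _ q])
      (intro conjI allI impI sol dec[THEN conjunct1] dec[THEN conjunct2, THEN conjunct1] dec[THEN conjunct2, THEN conjunct2]
        inH[THEN conjunct1] inH[THEN conjunct2, THEN conjunct1]
        inH[THEN conjunct2, THEN conjunct2, THEN conjunct1] inH[THEN conjunct2, THEN conjunct2, THEN conjunct2]
        nrm nru divu divN pos hN)
qed

end

theorem theorem2p3:
  fixes L g \<mu> M :: real and vert :: bool and rho rho' :: "real \<Rightarrow> real"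
  assumes L_pos: "L > 0" and g_pos: "g > 0" and mu_pos: "\<mu> > 0"
    and rho_deriv: "\<And>x. (rho has_real_derivative rho' x) (at x)"
    and rho'_smooth: "\<And>n x. ((deriv ^^ n) rho') differentiable (at x)"
    and rho'_supp: "\<exists>R. \<forall>x. \<bar>x\<bar> > R \<longrightarrow> rho' x = 0"
    and rho_bdd: "bounded (range rho)"
    and rho_inf: "Inf (range rho) > 0"
    and rho'_pos: "\<exists>x30. rho' x30 > 0"
    and M_cond: "if vert then 0 < \<bar>M\<bar> \<and> ereal \<bar>M\<bar> < Mc g rho' else M \<noteq> 0"
  shows "\<exists>\<Lambda>s :: real. \<exists>vr :: real \<Rightarrow> real^3 \<Rightarrow> real. \<exists>u N :: real \<Rightarrow> real^3 \<Rightarrow> real^3.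
           \<exists>q :: real \<Rightarrow> real^3 \<Rightarrow> real.
    2 * Lambda vert g \<mu> rho rho' M L / 3 < \<Lambda>s \<and> \<Lambda>s \<le> Lambda vert g \<mu> rho rho' M L \<and>
    lin_solution vert g \<mu> rho rho' M vr u N q \<and>
    (\<forall>t>0. \<forall>a b :: real. ((\<lambda>s. vr t (vector [a, b, s])) \<longlongrightarrow> 0) at_infinity \<and>
                ((\<lambda>s. u t (vector [a, b, s])) \<longlongrightarrow> 0) at_infinity \<and>
                ((\<lambda>s. N t (vector [a, b, s])) \<longlongrightarrow> 0) at_infinity) \<and>
    (\<forall>k. inHk L k (vr 0) \<and> vinHk L k (u 0) \<and> vinHk L k (N 0) \<and> inHk L k (q 0)) \<and>
    (\<forall>t>0. \<forall>k.
       inHk L k (vr t) \<and> vinHk L k (u t) \<and> vinHk L k (N t) \<and> inHk L k (q t) \<and>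
       sqrt (Hk_sq L k (vr t) + vHk_sq L k (N t) + Hk_sq L k (q t))
         = exp (\<Lambda>s * t) * sqrt (Hk_sq L k (vr 0) + vHk_sq L k (N 0) + Hk_sq L k (q 0)) \<and>
       (\<forall>i. Hk_norm L k (cmp (u t) i) = exp (\<Lambda>s * t) * Hk_norm L k (cmp (u 0) i))) \<and>
    (\<forall>x. divg (u 0) x = 0 \<and> divg (N 0) x = 0) \<and>
    sqrt (Hk_sq L 0 (cmp (u 0) 1) + Hk_sq L 0 (cmp (u 0) 2)) * Hk_norm L 0 (cmp (u 0) 3) > 0 \<and>
    (vert \<longrightarrow> Hk_norm L 0 (cmp (N 0) 3) > 0)"
proof -
  interpret rt_setting L g \<mu> M vert rho rho'
    using assms by (rule rt_setting.intro)
  obtain \<xi> where \<xi>: "\<xi> \<in> lattice L" "\<xi> \<noteq> 0" "0 < growth \<xi>" "(growth \<xi>)\<^sup>2 = - alph \<xi> (growth \<xi>)"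
    "2 * Lambda vert g \<mu> rho rho' M L / 3 < growth \<xi>" "growth \<xi> \<le> Lambda vert g \<mu> rho rho' M L"
    using near_max_growth by blast
  obtain V where V: "smooth1 V" "\<And>n. L2R ((deriv ^^ n) V)" "\<exists>x. V x \<noteq> 0"
    "\<And>x. (mag_v + growth \<xi> * \<mu>) * (deriv ^^ 4) V x + 2 * growth \<xi> * \<mu> * (norm \<xi>)\<^sup>2 * deriv (deriv V) x
       - (growth \<xi>)\<^sup>2 * rho' x * deriv V x - coeff_b \<xi> (growth \<xi>) x * deriv (deriv V) x
       + (coeff_a \<xi> (growth \<xi>) x + growth \<xi> * \<mu> * (norm \<xi>)^4 - coeff_p \<xi> x) * V x = 0"
    using growing_mode[OF \<xi>(2,3,4)] by blast
  have "smooth_L2 V" using V(1,2) by (simp add: smooth_L2_def)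
  from mode_solves[OF \<xi>(2,1,3) this V(3,4)] show ?thesis
    using \<xi>(5,6) by (intro exI[of _ "growth \<xi>"]) blast
qed

end
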